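(* Let $0<\theta<2$, $\alpha=\frac2{2+\theta}$, $t_0>0$, $\tau_0=\log t_0$. Let $(u,m)\in C^1(\mathbb R\times(t_0,\infty))\times C(\mathbb R\times[t_0,\infty))$, $m\ge0$, satisfy $-u_t+\frac12u_x^2=m^\theta$ in the classical sense and $m_t-(mu_x)_x=0$ in the distributional sense in $\mathbb R\times(t_0,\infty)$. Assume there are functions $\gamma_L,\gamma_R\in W^{1,\infty}_{\mathrm{loc}}((t_0,\infty))$ with $\{m(\cdot,t)>0\}=(\gamma_L(t),\gamma_R(t))$ for every $t\in(t_0,\infty)$, and let $a=\int_{\mathbb R}m(\cdot,t_0)\,dx>0$. Let $(v,\mu)$ be the continuous rescaling of $(u,m)$, let $w(\eta,\tau)=v(\eta,\tau)+\frac\alpha2\eta^2$, and let $\mathcal E_{w,\mu}:[\tau_0,\infty)\to\mathbb R$ be the functional defined in the context. Assume that $\mu$ is bounded and uniformly continuous on $\mathbb R\times(\tau_0,\infty)$, that for some constants $\rho,K>0$ $$\|\mu^\theta\|_{H^1(\mathbb R\times(\tau_1-\rho,\tau_1+\rho))}\le K\qquad\text{for every }\tau_1\in(\tau_0+\rho,\infty),$$ and that there is a constant $R\ge R_a$ such that $\mathrm{supp}(\mu)\subset[-R,R]\times[\tau_0,\infty)$ and $Dv\in C^1(\{\mu>0\})\cap L^\infty((-R,R)\times(\tau_0,\infty))$. Then $\mathcal E_{w,\mu}(\tau)$ converges exponentially to $0$. Indeed, setting $k=\frac{2-\theta}{2+\theta}=2\alpha-1$, $$0\le\mathcal E_{w,\mu}(\tau)\le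 e^{-2k\tau}\,\mathcal E_{w,\mu}(\tau_0),\qquad \tau\in[\tau_0,\infty).$$ Moreover, $\mu w_\eta^2\to0$ and $\mu\to M_a$ exponentially in the following sense: $$\int_{\mathbb R}\mu w_\eta^2\,d\eta\le Ce^{-k\tau},\qquad \tau\in(\tau_0+\rho,\infty),$$ and $$\int_{\mathbb R}\Big(F(\mu)-F(M_a)-\big(R_a-\tfrac{\alpha(1-\alpha)}2\eta^2\big)(\mu-M_a)\Big)d\eta\le Ce^{-k\tau},\qquad \tau\in(\tau_0+\rho,\infty),$$ where $C=C\big(K,R,\|\mu\|_{L^\infty(\mathbb R\times(\tau_0,\infty))},\|Dw\|_{L^\infty(\{\mu>0\})},\rho,\rho^{-1}\big)$.
   Context: Continuous rescaling: for $(\eta,\tau)\in\mathbb R\times[\tau_0,\infty)$ set $t=e^\tau$, $x=t^\alpha\eta$, and $\mu(\eta,\tau)=t^\alpha m(x,t)$, $v(\eta,\tau)=t^{1-2\alpha}u(x,t)$. $D=(\partial_\eta,\partial_\tau)$. $R_a>0$ is the unique constant with $\int_{\mathbb R}\big(R_a-\frac{\alpha(1-\alpha)}2\eta^2\big)_+^{1/\theta}d\eta=a$, and $M_a(\eta)=\big(R_a-\frac{\alpha(1-\alpha)}2\eta^2\big)_+^{1/\theta}$. $F(s)=\frac{s^{\theta+1}}{\theta+1}$ for $s\ge0$. The functional is $$\mathcal E_{w,\mu}(\tau)=\int_{\mathbb R}\Big(\tfrac12\mu|w_\eta|^2-\Big(F(\mu)-F(M_a)-\big(R_a-\tfrac{\alpha(1-\alpha)}2\eta^2\big)(\mu-M_a)\Big)\Big)d\eta,\quad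 \tau\in[\tau_0,\infty).$$
   Formalization: The decay factors are e^{-2k(τ-τ_0)} and Ce^{-k(τ-τ_0)} in place of e^{-2kτ} and Ce^{-kτ}, as the printed ones fail for t_0>1 (at τ=τ_0 they force E(τ_0)=0); Dv∈C^1({μ>0}) is understood up to τ=τ_0, with Dv(·,τ_0) the limit from τ>τ_0. *)

theory Defs
  imports "HOL-Analysis.Analysis" "HOL-Probability.Essential_Supremum"
begin

text \<open>
  Functions of space and time are curried, as in \<open>u x t\<close>. Function-space predicates
  take functions of the pair \<open>(x, t)\<close>.
\<close>

section \<open>Function spaces\<close>

text \<open>
  \<open>Ck_on n f S\<close> is used for open sets \<open>S\<close> and for relatively open subsets \<open>S\<close> of a closed half
  plane. In both cases the derivative within \<open>S\<close> is unique; in the second case the predicate is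
  regularity up to the part of the boundary contained in \<open>S\<close>.
\<close>

primrec Ck_on ::
  "nat \<Rightarrow> ('a::euclidean_space \<Rightarrow> 'b::real_normed_vector) \<Rightarrow> 'a set \<Rightarrow> bool" where
  "Ck_on 0 f S \<longleftrightarrow> continuous_on S f"
| "Ck_on (Suc n) f S \<longleftrightarrow>
     (\<exists>f'. (\<forall>z\<in>S. (f has_derivative f' z) (at z within S)) \<and> (\<forall>h. Ck_on n (\<lambda>z. f' z h) S))"

definition test_function :: "'a::euclidean_space set \<Rightarrow> ('a \<Rightarrow> real) \<Rightarrow> bool" where
  "test_function U \<phi> \<longleftrightarrow>
     (\<forall>n. Ck_on n \<phi> UNIV) \<and> compact (closure {z. \<phi> z \<noteq> 0}) \<and> closure {z. \<phi> z \<noteq> 0} \<subseteq> U"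

text \<open>The vector field \<open>g\<close> is the distributional gradient of \<open>f\<close> in the open set \<open>U\<close>. Both are
  locally integrable wherever this is used.\<close>

definition weak_gradient ::
  "'a::euclidean_space set \<Rightarrow> ('a \<Rightarrow> real) \<Rightarrow> ('a \<Rightarrow> 'a) \<Rightarrow> bool" where
  "weak_gradient U f g \<longleftrightarrow>
     (\<forall>\<phi>. test_function U \<phi> \<longrightarrow> (\<forall>b\<in>Basis.
        (LINT z:U|lborel. f z * frechet_derivative \<phi> (at z) b) =
        - (LINT z:U|lborel. (g z \<bullet> b) * \<phi> z)))"

definition Linf_norm ::
  "'a::euclidean_space set \<Rightarrow> ('a \<Rightarrow> 'b::real_normed_vector) \<Rightarrow> ereal" where
  "Linf_norm U f = esssup (restrict_space lborel U) (\<lambda>z. ereal (norm (f z)))"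

definition Linf_on :: "'a::euclidean_space set \<Rightarrow> ('a \<Rightarrow> 'b::real_normed_vector) \<Rightarrow> bool" where
  "Linf_on U f \<longleftrightarrow> set_borel_measurable lborel U f \<and> Linf_norm U f < \<infinity>"

definition L2_on :: "'a::euclidean_space set \<Rightarrow> ('a \<Rightarrow> 'b::real_normed_vector) \<Rightarrow> bool" where
  "L2_on U f \<longleftrightarrow>
     set_borel_measurable lborel U f \<and> set_integrable lborel U (\<lambda>z. (norm (f z))\<^sup>2)"

text \<open>\<open>f\<close> belongs to \<open>H\<^sup>1(U)\<close> and its norm there is at most \<open>K\<close>.\<close>

definition H1_norm_le :: "'a::euclidean_space set \<Rightarrow> ('a \<Rightarrow> real) \<Rightarrow> real \<Rightarrow> bool" where
  "H1_norm_le U f K \<longleftrightarrow>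
     L2_on U f \<and>
     (\<exists>g. L2_on U g \<and> weak_gradient U f g \<and>
        sqrt ((LINT z:U|lborel. (f z)\<^sup>2) + (LINT z:U|lborel. (norm (g z))\<^sup>2)) \<le> K)"

text \<open>\<open>W\<^sup>1\<^sup>,\<^sup>\<infinity>\<close> locally in the open set \<open>I\<close>. Elements of this space are identified with their continuous
  representatives, so that their pointwise values are meaningful.\<close>

definition W1inf_loc :: "real set \<Rightarrow> (real \<Rightarrow> real) \<Rightarrow> bool" where
  "W1inf_loc I f \<longleftrightarrow>
     continuous_on I f \<and>
     (\<exists>g. (\<forall>J. compact J \<and> J \<subseteq> I \<longrightarrow> Linf_on J g) \<and> weak_gradient I f g)"

section \<open>The mean field game system\<close>

definition HJ_classical ::
  "real \<Rightarrow> real \<Rightarrow> (real \<Rightarrow> real \<Rightarrow> real) \<Rightarrow> (real \<Rightarrow> real \<Rightarrow> real) \<Rightarrow> bool" where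
  "HJ_classical \<theta> t0 u m \<longleftrightarrow>
     (\<forall>x. \<forall>t>t0. - deriv (\<lambda>s. u x s) t + (deriv (\<lambda>y. u y t) x)\<^sup>2 / 2 = m x t powr \<theta>)"

definition continuity_distributional ::
  "real \<Rightarrow> (real \<Rightarrow> real \<Rightarrow> real) \<Rightarrow> (real \<Rightarrow> real \<Rightarrow> real) \<Rightarrow> bool" where
  "continuity_distributional t0 u m \<longleftrightarrow>
     (\<forall>\<phi>. test_function (UNIV \<times> {t0<..}) \<phi> \<longrightarrow>
        (LINT z:UNIV \<times> {t0<..}|lborel. (case z of (x, t) \<Rightarrow>
            - m x t * frechet_derivative \<phi> (at (x, t)) (0, 1)
            + m x t * deriv (\<lambda>y. u y t) x * frechet_derivative \<phi> (at (x, t)) (1, 0))) = 0)"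

section \<open>Continuous rescaling\<close>

definition rescaled_density ::
  "real \<Rightarrow> (real \<Rightarrow> real \<Rightarrow> real) \<Rightarrow> real \<Rightarrow> real \<Rightarrow> real" where
  "rescaled_density \<alpha> m \<eta> \<tau> = (let t = exp \<tau> in t powr \<alpha> * m (t powr \<alpha> * \<eta>) t)"

definition rescaled_value ::
  "real \<Rightarrow> (real \<Rightarrow> real \<Rightarrow> real) \<Rightarrow> real \<Rightarrow> real \<Rightarrow> real" where
  "rescaled_value \<alpha> u \<eta> \<tau> = (let t = exp \<tau> in t powr (1 - 2 * \<alpha>) * u (t powr \<alpha> * \<eta>) t)"

text \<open>
  The gradient \<open>D = (\<partial>\<^sub>\<eta>, \<partial>\<^sub>\<tau>)\<close> of a function which is only meaningful for \<open>\<tau> > \<tau>\<^sub>0\<close>. At the initial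
  time it is the limit of the gradients from \<open>\<tau> > \<tau>\<^sub>0\<close>. If \<open>grad_upto \<tau>0 f\<close> is continuous on a
  relatively open set of the closed half plane, this limit exists at its initial points.
\<close>

definition grad_upto :: "real \<Rightarrow> (real \<Rightarrow> real \<Rightarrow> real) \<Rightarrow> real \<times> real \<Rightarrow> real \<times> real" where
  "grad_upto \<tau>0 f z =
     (let D = (\<lambda>(\<eta>, \<tau>). (deriv (\<lambda>y. f y \<tau>) \<eta>, deriv (\<lambda>s. f \<eta> s) \<tau>))
      in if snd z > \<tau>0 then D z else Lim (at z within UNIV \<times> {\<tau>0<..}) D)"

section \<open>Stationary profile and energy\<close>

definition R_mass :: "real \<Rightarrow> real \<Rightarrow> real \<Rightarrow> real" where
  "R_mass \<theta> \<alpha> a =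
     (THE r. r > 0 \<and> (LINT \<eta>|lborel. max 0 (r - \<alpha> * (1 - \<alpha>) / 2 * \<eta>\<^sup>2) powr (1 / \<theta>)) = a)"

definition M_profile :: "real \<Rightarrow> real \<Rightarrow> real \<Rightarrow> real \<Rightarrow> real" where
  "M_profile \<theta> \<alpha> a \<eta> = max 0 (R_mass \<theta> \<alpha> a - \<alpha> * (1 - \<alpha>) / 2 * \<eta>\<^sup>2) powr (1 / \<theta>)"

definition F_pot :: "real \<Rightarrow> real \<Rightarrow> real" where
  "F_pot \<theta> s = s powr (\<theta> + 1) / (\<theta> + 1)"

definition potential_density ::
  "real \<Rightarrow> real \<Rightarrow> real \<Rightarrow> (real \<Rightarrow> real \<Rightarrow> real) \<Rightarrow> real \<Rightarrow> real \<Rightarrow> real" where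
  "potential_density \<theta> \<alpha> a \<mu> \<tau> \<eta> =
     F_pot \<theta> (\<mu> \<eta> \<tau>) - F_pot \<theta> (M_profile \<theta> \<alpha> a \<eta>)
     - (R_mass \<theta> \<alpha> a - \<alpha> * (1 - \<alpha>) / 2 * \<eta>\<^sup>2) * (\<mu> \<eta> \<tau> - M_profile \<theta> \<alpha> a \<eta>)"

definition energy ::
  "real \<Rightarrow> real \<Rightarrow> real \<Rightarrow> real \<Rightarrow> (real \<Rightarrow> real \<Rightarrow> real) \<Rightarrow> (real \<Rightarrow> real \<Rightarrow> real) \<Rightarrow> real \<Rightarrow> real" where
  "energy \<theta> \<alpha> a \<tau>0 w \<mu> \<tau> =
     (LINT \<eta>|lborel. 1 / 2 * \<mu> \<eta> \<tau> * \<bar>fst (grad_upto \<tau>0 w (\<eta>, \<tau>))\<bar>\<^sup>2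
        - potential_density \<theta> \<alpha> a \<mu> \<tau> \<eta>)"

end

theory Submission
  imports Defs "HOL-Complex_Analysis.Great_Picard"
begin

text \<open>
  In the rescaled variables \<open>w\<close> solves \<open>- w\<^sub>\<tau> - k w + w\<^sub>\<eta>\<^sup>2 / 2 = \<mu>\<^sup>\<theta> + c \<eta>\<^sup>2\<close> with \<open>c = \<alpha> (1 - \<alpha>) / 2\<close>,
  and \<open>\<mu>\<^sub>\<tau> = (\<mu> w\<^sub>\<eta>)\<^sub>\<eta>\<close>; testing with smooth bumps, the latter holds classically for the primitive of \<open>\<mu>\<close>
  in \<open>\<eta>\<close>. Write the energy as \<open>D / 2 - \<Phi>\<close> with \<open>D = \<integral> \<mu> w\<^sub>\<eta>\<^sup>2\<close> and \<open>\<Phi> \<ge> 0\<close>. Time increments of \<open>w\<close>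
  as test functions, together with Young's inequality, give \<open>E' = - k D = - 2 k (E + \<Phi>)\<close>, hence the
  exponential decay. Since \<open>E\<close> is nonincreasing and bounded below and \<open>\<mu>\<close> is uniformly continuous, \<open>D \<longlonglongrightarrow> 0\<close>;
  along a sequence of times \<open>\<mu>\<close> converges uniformly, the limit has locally constant pressure
  \<open>\<mu>\<^sup>\<theta> + c \<eta>\<^sup>2\<close> where it is positive, and therefore is the stationary profile. So \<open>E \<longlonglongrightarrow> 0\<close> along that
  sequence, and \<open>E \<ge> 0\<close>. Finally \<open>\<Phi> \<le> D / 2\<close> is small on average over a time window by the decay of \<open>\<integral> D\<close>,
  and the bound on \<open>\<mu>\<^sup>\<theta>\<close> in \<open>H\<^sup>1\<close> controls the decrease of \<open>\<Phi>\<close> over that window, which gives the pointwise rates.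
\<close>

section \<open>Smooth functions\<close>

text \<open>The obstacle is regularity: \<open>w\<close> is only C^1 and \<open>\<mu>\<close> only
  continuous, so the energy cannot be differentiated in time directly. The time derivative of the
  cumulative mass is classical, and every integral against \<open>\<mu>\<close> is differentiated
  through it. The sign of the energy is not visible in its integrand, where the nonnegative density
  of \<Phi> is subtracted; it comes from the behaviour at large times. The same limit supplies the
  existence of the number R_a of the given mass, so only its uniqueness is shown separately. The
  pointwise rates carry k and not 2 k because the decrease of \<Phi> over a time window is a
  space-time integral of pressure gradient times flux. The gradient is merely bounded in L^2, by K,
  while the squared L^2 norm of the flux is controlled by the dissipated energy, of order X^2 with X
  = exp (- k (\<tau> - \<tau>0)); the product is of order X. The constant involves no initial
  energy, since that is at most R * Mb * W^2.\<close>

lemma Ck_on_const: "Ck_on n (\<lambda>_. c) S"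
proof (induction n arbitrary: c)
  case (Suc n)
  show ?case
    by (auto intro!: exI[of _ "\<lambda>_ _. 0"] Suc.IH)
qed auto

lemma Ck_on_Suc_imp: "Ck_on (Suc n) f S \<Longrightarrow> Ck_on n f S"
proof (induction n arbitrary: f)
  case 0
  then show ?case
    by (auto simp: continuous_on_eq_continuous_within intro: has_derivative_continuous)
next
  case (Suc n)
  from Suc.prems obtain f' where f':
    "\<forall>z\<in>S. (f has_derivative f' z) (at z within S)" "\<forall>h. Ck_on (Suc n) (\<lambda>z. f' z h) S"
    by (subst (asm) Ck_on.simps(2)) blast
  have "\<forall>h. Ck_on n (\<lambda>z. f' z h) S"
    using f'(2) Suc.IH by blast
  with f'(1) show ?case by auto
qed

lemma Ck_on_add:
  "Ck_on n f S \<Longrightarrow> Ck_on n g S \<Longrightarrow> Ck_on n (\<lambda>z. f z + g z) S"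
proof (induction n arbitrary: f g)
  case 0
  then show ?case by (auto intro: continuous_intros)
next
  case (Suc n)
  from Suc.prems obtain f' g' where
    "\<forall>z\<in>S. (f has_derivative f' z) (at z within S)" "\<forall>h. Ck_on n (\<lambda>z. f' z h) S"
    "\<forall>z\<in>S. (g has_derivative g' z) (at z within S)" "\<forall>h. Ck_on n (\<lambda>z. g' z h) S"
    by auto
  then show ?case
    by (auto intro!: exI[of _ "\<lambda>z h. f' z h + g' z h"] has_derivative_add Suc.IH)
qed

lemma Ck_on_mult:
  fixes f g :: "'a::euclidean_space \<Rightarrow> real"
  shows "Ck_on n f S \<Longrightarrow> Ck_on n g S \<Longrightarrow> Ck_on n (\<lambda>z. f z * g z) S"
proof (induction n arbitrary: f g)
  case 0
  then show ?case by (auto intro: continuous_intros)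
next
  case (Suc n)
  from Suc.prems obtain f' g' where
    *: "\<forall>z\<in>S. (f has_derivative f' z) (at z within S)" "\<forall>h. Ck_on n (\<lambda>z. f' z h) S"
    "\<forall>z\<in>S. (g has_derivative g' z) (at z within S)" "\<forall>h. Ck_on n (\<lambda>z. g' z h) S"
    by auto
  have "Ck_on n f S" "Ck_on n g S"
    using Suc.prems Ck_on_Suc_imp by blast+
  with * show ?case
    by (auto intro!: exI[of _ "\<lambda>z h. f z * g' z h + f' z h * g z"] has_derivative_mult
        Ck_on_add Suc.IH)
qed

lemma Ck_on_power:
  fixes f :: "'a::euclidean_space \<Rightarrow> real"
  shows "Ck_on n f S \<Longrightarrow> Ck_on n (\<lambda>z. f z ^ i) S"
  by (induction i) (auto intro: Ck_on_mult Ck_on_const)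

lemma Ck_on_affine:
  fixes f :: "'b::euclidean_space \<Rightarrow> 'c::real_normed_vector" and L :: "'a::euclidean_space \<Rightarrow> 'b"
  assumes "bounded_linear L"
  shows "Ck_on n f UNIV \<Longrightarrow> Ck_on n (\<lambda>z. f (L z + c)) UNIV"
proof (induction n arbitrary: f)
  case 0
  then show ?case
    using linear_continuous_on[OF assms, of UNIV]
    by (auto intro!: continuous_intros continuous_on_compose2[of UNIV f])
next
  case (Suc n)
  from Suc.prems obtain f' where f':
    "\<forall>z. (f has_derivative f' z) (at z)" "\<forall>h. Ck_on n (\<lambda>z. f' z h) UNIV"
    by auto
  have "((\<lambda>z. f (L z + c)) has_derivative (\<lambda>h. f' (L z + c) (L h))) (at z)" for z
  proof -
    have "((\<lambda>z. L z + c) has_derivative L) (at z)"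
      using bounded_linear_imp_has_derivative[OF assms]
      by (auto intro!: derivative_eq_intros)
    then show ?thesis
      using f'(1) by (intro has_derivative_compose[where f = "\<lambda>z. L z + c" and g = f]) auto
  qed
  moreover have "Ck_on n (\<lambda>z. f' (L z + c) (L h)) UNIV" for h
    using f'(2) Suc.IH by auto
  ultimately show ?case
    by (auto intro!: exI[of _ "\<lambda>z h. f' (L z + c) (L h)"])
qed

lemma Ck_on_Suc_real:
  fixes f f' :: "real \<Rightarrow> real"
  assumes "\<And>x. (f has_real_derivative f' x) (at x)" "Ck_on n f' UNIV"
  shows "Ck_on (Suc n) f UNIV"
  using assms
  by (auto intro!: exI[of _ "\<lambda>x h. f' x * h"] Ck_on_mult Ck_on_const
      simp: has_field_derivative_def)

section \<open>Smooth transition functions built from exp (- 1 / x)\<close>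

lemma Ck_on_real_family:
  fixes F :: "'i \<Rightarrow> real \<Rightarrow> real"
  assumes "\<And>i x. (F i has_real_derivative F (s i) x) (at x)"
  shows "Ck_on n (F i) UNIV"
proof (induction n arbitrary: i)
  case 0
  show ?case using assms DERIV_continuous_on[of UNIV "F i"]
    by (metis Ck_on.simps(1) has_field_derivative_at_within)
next
  case (Suc n)
  show ?case by (rule Ck_on_Suc_real[OF assms Suc.IH])
qed

text \<open>The polynomial index makes the family closed under differentiation: the derivative of
  q(1/x) exp(-1/x) is x^(-2) (q - q')(1/x) exp(-1/x), again a member. Smoothness at 0 then needs
  only a first derivative there, for all q at once.\<close>

definition exp_inv_poly :: "real poly \<Rightarrow> real \<Rightarrow> real" where
  "exp_inv_poly q x = (if x \<le> 0 then 0 else poly q (1 / x) * exp (- (1 / x)))"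

lemma tendsto_poly_exp_at_top:
  "((\<lambda>y. poly q y * exp (- y)) \<longlongrightarrow> (0::real)) at_top"
proof -
  have "((\<lambda>y. \<Sum>i\<le>degree q. coeff q i * (y ^ i / exp y)) \<longlongrightarrow> (\<Sum>i\<le>degree q. coeff q i * (0::real))) at_top"
    by (intro tendsto_intros tendsto_power_div_exp_0)
  then show ?thesis
    by (simp add: poly_altdef sum_distrib_right exp_minus divide_inverse mult.assoc)
qed

lemma exp_inv_poly_tendsto_0: "(exp_inv_poly q \<longlongrightarrow> 0) (at 0)"
proof -
  have "((\<lambda>x. poly q (inverse x) * exp (- inverse x)) \<longlongrightarrow> 0) (at_right 0)"
    by (rule filterlim_compose[OF tendsto_poly_exp_at_top filterlim_inverse_at_top_right])
  then have "(exp_inv_poly q \<longlongrightarrow> 0) (at_right 0)"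
    by (rule Lim_transform_eventually)
      (auto simp: eventually_at_filter exp_inv_poly_def inverse_eq_divide)
  moreover have "(exp_inv_poly q \<longlongrightarrow> 0) (at_left 0)"
    by (rule Lim_transform_eventually[OF tendsto_const])
      (auto simp: eventually_at_filter exp_inv_poly_def)
  ultimately show ?thesis by (simp add: filterlim_at_split)
qed

lemma exp_inv_poly_deriv:
  "(exp_inv_poly q has_real_derivative exp_inv_poly ([:0, 0, 1:] * (q - pderiv q)) x) (at x)"
proof (cases x "0::real" rule: linorder_cases)
  case less
  have "((\<lambda>_. 0) has_real_derivative 0) (at x)" by simp
  then have "(exp_inv_poly q has_real_derivative 0) (at x)"
    by (rule has_field_derivative_transform_within_open[of _ _ _ "{..<0}"])
      (use less in \<open>auto simp: exp_inv_poly_def\<close>)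
  then show ?thesis using less by (simp add: exp_inv_poly_def)
next
  case equal
  \<comment> \<open>The difference quotient at 0 is itself a member of the family, with polynomial X
    q, so it tends to 0.\<close>
  have "(exp_inv_poly ([:0, 1:] * q) \<longlongrightarrow> 0) (at 0)" by (rule exp_inv_poly_tendsto_0)
  then have "((\<lambda>h. (exp_inv_poly q (0 + h) - exp_inv_poly q 0) / h) \<longlongrightarrow> 0) (at 0)"
    by (rule Lim_transform_eventually)
      (auto simp: eventually_at_filter exp_inv_poly_def field_simps)
  then show ?thesis using equal by (simp add: DERIV_def exp_inv_poly_def)
next
  case greater
  have "((\<lambda>x. poly q (1 / x) * exp (- (1 / x))) has_real_derivative
      poly ([:0, 0, 1:] * (q - pderiv q)) (1 / x) * exp (- (1 / x))) (at x)"
    using greater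
    by (auto intro!: derivative_eq_intros DERIV_chain2[OF poly_DERIV]
        simp: field_simps power2_eq_square)
  then have "(exp_inv_poly q has_real_derivative
      poly ([:0, 0, 1:] * (q - pderiv q)) (1 / x) * exp (- (1 / x))) (at x)"
    by (rule has_field_derivative_transform_within_open[of _ _ _ "{0<..}"])
      (use greater in \<open>auto simp: exp_inv_poly_def\<close>)
  then show ?thesis using greater by (simp add: exp_inv_poly_def)
qed

lemma Ck_on_exp_inv_poly: "Ck_on n (exp_inv_poly q) UNIV"
  by (rule Ck_on_real_family[where F = exp_inv_poly and s = "\<lambda>q. [:0, 0, 1:] * (q - pderiv q)",
        OF exp_inv_poly_deriv])

text \<open>Mass one and support in [0, 1], to the right of 0: a bump rescaled and moved to s looks
  only at what lies after s, so a right neighbourhood suffices for concentration, and the primitive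
  \<open>smooth_step\<close> rises from 0 to 1 exactly on [0, 1].\<close>

definition smooth_bump :: "real \<Rightarrow> real" where
  "smooth_bump x = exp_inv_poly 1 x * exp_inv_poly 1 (1 - x)
     / integral {0..1} (\<lambda>x. exp_inv_poly 1 x * exp_inv_poly 1 (1 - x))"

definition smooth_step :: "real \<Rightarrow> real" where
  "smooth_step x = integral {0..x} smooth_bump"

lemma
  shows smooth_step_deriv: "(smooth_step has_real_derivative smooth_bump x) (at x)"
    and Ck_on_smooth_step: "Ck_on n smooth_step UNIV"
    and smooth_bump_nonneg: "0 \<le> smooth_bump x"
    and smooth_step_0: "x \<le> 0 \<Longrightarrow> smooth_step x = 0"
    and smooth_step_1: "1 \<le> x \<Longrightarrow> smooth_step x = 1"
    and smooth_bump_0: "x \<le> 0 \<or> 1 \<le> x \<Longrightarrow> smooth_bump x = 0"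
    and continuous_on_smooth_bump: "continuous_on S smooth_bump"
proof -
  define b where "b x = exp_inv_poly 1 x * exp_inv_poly 1 (1 - x)" for x
  have Cb: "Ck_on n b UNIV" for n
    unfolding b_def
    using Ck_on_affine[of "uminus :: real \<Rightarrow> real" n "exp_inv_poly 1" 1]
    by (intro Ck_on_mult Ck_on_exp_inv_poly) (simp_all add: bounded_linear_minus bounded_linear_ident Ck_on_exp_inv_poly)
  have cont: "continuous_on S b" for S
    using Cb[of 0] continuous_on_subset by auto
  have b0: "0 \<le> b x" for x
    by (simp add: b_def exp_inv_poly_def)
  have bz: "b x = 0" if "x \<le> 0 \<or> 1 \<le> x" for x
    using that by (auto simp: b_def exp_inv_poly_def)
  define I where "I = integral {0..1} b"
  have "I > 0"
  proof -
    have "I \<ge> 0" unfolding I_def by (intro integral_nonneg integrable_continuous_real cont b0)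
    moreover have "I \<noteq> 0"
    proof
      assume "I = 0"
      have "(b has_integral I) (cbox 0 1)"
        unfolding I_def box_real by (intro integrable_integral integrable_continuous_real cont)
      with \<open>I = 0\<close> have "(b has_integral 0) (cbox 0 1)" by simp
      then have "b (1/2) = 0"
        by (rule has_integral_0_cbox_imp_0[OF cont b0]) auto
      then show False by (simp add: b_def exp_inv_poly_def)
    qed
    ultimately show ?thesis by simp
  qed
  define st where "st x = integral {0..x} b / I" for x
  have st_eq: "smooth_step = st" and sb_eq: "smooth_bump = (\<lambda>x. b x / I)"
    by (auto simp: fun_eq_iff smooth_step_def smooth_bump_def[abs_def] st_def b_def[abs_def] I_def)
  \<comment> \<open>The interval \<open>{0..x}\<close> is empty for negative x. Moving the base
    point to -1, where the integrand still vanishes, gives a two-sided derivative at 0.\<close>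
  have int0: "integral {0..x} b = integral {-1..x} b" if "x \<ge> -1" for x
  proof (cases "x \<le> 0")
    case True
    have "integral {-1..x} b = integral {-1..x} (\<lambda>_. 0)"
      by (rule integral_cong) (use True bz in auto)
    moreover have "integral {0..x} b = integral {0..x} (\<lambda>_. 0)"
      by (rule integral_cong) (use True bz in auto)
    ultimately show ?thesis by simp
  next
    case False
    have "integral {-1..0} b = integral {-1..0} (\<lambda>_::real. 0)"
      by (rule integral_cong) (use bz in auto)
    moreover have "integral {-1..0} b + integral {0..x} b = integral {-1..x} b"
      by (rule Henstock_Kurzweil_Integration.integral_combine) (use False in \<open>auto intro: integrable_continuous_real cont\<close>)
    ultimately show ?thesis by simp
  qed
  have stz: "st x = 0" if "x \<le> 0" for x
  proof -
    have "integral {0..x} b = integral {0..x} (\<lambda>_. 0)"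
      by (rule integral_cong) (use that bz in auto)
    then show ?thesis by (simp add: st_def)
  qed
  have der: "(st has_real_derivative b x / I) (at x)" for x
  proof (cases "x < 0")
    case True
    have "((\<lambda>_. 0) has_real_derivative 0) (at x)" by simp
    then have "(st has_real_derivative 0) (at x)"
      by (rule has_field_derivative_transform_within_open[of _ _ _ "{..<0}"])
        (use True stz in auto)
    then show ?thesis using True bz by simp
  next
    case False
    have "((\<lambda>u. integral {-1..u} b) has_real_derivative b x) (at x within {-1..x+1})"
      by (rule integral_has_real_derivative) (use False cont in auto)
    then have "((\<lambda>u. integral {-1..u} b) has_real_derivative b x) (at x)"
      using False by (simp add: at_within_Icc_at)
    then have "((\<lambda>u. integral {-1..u} b / I) has_real_derivative b x / I) (at x)"
      by (rule DERIV_cdivide)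
    then show ?thesis
      by (rule has_field_derivative_transform_within_open[of _ _ _ "{-1<..}"])
        (use False int0 in \<open>auto simp: st_def\<close>)
  qed
  have st1: "st x = 1" if "1 \<le> x" for x
  proof -
    have "integral {1..x} b = integral {1..x} (\<lambda>_. 0)"
      by (rule integral_cong) (use bz in auto)
    moreover have "integral {0..1} b + integral {1..x} b = integral {0..x} b"
      by (rule Henstock_Kurzweil_Integration.integral_combine) (use that in \<open>auto intro: integrable_continuous_real cont\<close>)
    ultimately show ?thesis using \<open>I > 0\<close> by (simp add: st_def I_def)
  qed
  have Cb': "Ck_on n (\<lambda>x. b x / I) UNIV" for n
    using Ck_on_mult[OF Cb Ck_on_const, of n "1 / I"] by simp
  have "Ck_on n st UNIV" for n
    using Ck_on_Suc_real[OF der Cb'] Ck_on_Suc_imp by blast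
  then show "Ck_on n smooth_step UNIV" by (simp add: st_eq)
  show "(smooth_step has_real_derivative smooth_bump x) (at x)" using der by (simp add: st_eq sb_eq)
  show "0 \<le> smooth_bump x" using b0 \<open>I > 0\<close> by (simp add: sb_eq)
  show "x \<le> 0 \<Longrightarrow> smooth_step x = 0" using stz by (simp add: st_eq)
  show "1 \<le> x \<Longrightarrow> smooth_step x = 1" using st1 by (simp add: st_eq)
  show "x \<le> 0 \<or> 1 \<le> x \<Longrightarrow> smooth_bump x = 0" using bz by (simp add: sb_eq)
  show "continuous_on S smooth_bump" using cont \<open>I > 0\<close> by (auto simp: sb_eq intro!: continuous_intros)
qed

lemma smooth_step_mono: "x \<le> y \<Longrightarrow> smooth_step x \<le> smooth_step y"
  by (rule DERIV_nonneg_imp_nondecreasing) (use smooth_step_deriv smooth_bump_nonneg in blast)+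

lemma smooth_step_bounds: "0 \<le> smooth_step x" "smooth_step x \<le> 1"
  using smooth_step_mono[of "min x 0" x] smooth_step_mono[of x "max x 1"]
  by (auto simp: smooth_step_0 smooth_step_1)

lemma smooth_step_scaled_deriv:
  "((\<lambda>x. smooth_step ((x - p) / l)) has_real_derivative smooth_bump ((x - p) / l) / l) (at x)"
proof -
  have "((\<lambda>x. (x - p) / l) has_real_derivative 1 / l) (at x)"
    by (intro derivative_eq_intros DERIV_cdivide) auto
  from DERIV_chain2[OF smooth_step_deriv this] show ?thesis by simp
qed

lemma continuous_on_smooth: "(\<And>n. Ck_on n f S) \<Longrightarrow> continuous_on S f"
  by (metis Ck_on.simps(1))

section \<open>Recognising test functions and computing their partial derivatives\<close>

lemma test_functionI:
  fixes \<phi> :: "'a::euclidean_space \<Rightarrow> real"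
  assumes "\<And>n. Ck_on n \<phi> UNIV" "compact K" "K \<subseteq> U" "\<And>z. z \<notin> K \<Longrightarrow> \<phi> z = 0"
  shows "test_function U \<phi>"
proof -
  have "{z. \<phi> z \<noteq> 0} \<subseteq> K" using assms(4) by blast
  then have "closure {z. \<phi> z \<noteq> 0} \<subseteq> K"
    by (simp add: assms(2) closure_minimal compact_imp_closed)
  moreover have "compact (closure {z. \<phi> z \<noteq> 0})"
    using \<open>{z. \<phi> z \<noteq> 0} \<subseteq> K\<close> assms(2) bounded_subset compact_closure compact_imp_bounded by blast
  ultimately show ?thesis using assms(1,3) by (auto simp: test_function_def)
qed

lemma frechet_derivative_slices:
  fixes \<phi> :: "real \<times> real \<Rightarrow> real"
  assumes "Ck_on 1 \<phi> UNIV"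
  shows "((\<lambda>y. \<phi> (y, t)) has_real_derivative d) (at x) \<Longrightarrow> frechet_derivative \<phi> (at (x, t)) (1, 0) = d"
    and "((\<lambda>s. \<phi> (x, s)) has_real_derivative d) (at t) \<Longrightarrow> frechet_derivative \<phi> (at (x, t)) (0, 1) = d"
proof -
  have "\<phi> differentiable (at (x, t))"
    using assms by (auto simp: differentiable_def)
  then have D: "(\<phi> has_derivative frechet_derivative \<phi> (at (x, t))) (at (x, t))"
    by (simp add: frechet_derivative_works)
  {
    assume d: "((\<lambda>y. \<phi> (y, t)) has_real_derivative d) (at x)"
    have "((\<lambda>y. \<phi> (y, t)) has_derivative (\<lambda>h. frechet_derivative \<phi> (at (x, t)) (h, 0))) (at x)"
      by (rule has_derivative_compose[of "\<lambda>y. (y, t)", OF _ D])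
        (auto intro!: derivative_eq_intros)
    with d have "(\<lambda>h. frechet_derivative \<phi> (at (x, t)) (h, 0)) = (\<lambda>h. d * h)"
      unfolding has_field_derivative_def by (rule has_derivative_unique[symmetric])
    from fun_cong[OF this, of 1] show "frechet_derivative \<phi> (at (x, t)) (1, 0) = d" by simp
  }
  {
    assume d: "((\<lambda>s. \<phi> (x, s)) has_real_derivative d) (at t)"
    have "((\<lambda>s. \<phi> (x, s)) has_derivative (\<lambda>h. frechet_derivative \<phi> (at (x, t)) (0, h))) (at t)"
      by (rule has_derivative_compose[of "\<lambda>s. (x, s)", OF _ D])
        (auto intro!: derivative_eq_intros)
    with d have "(\<lambda>h. frechet_derivative \<phi> (at (x, t)) (0, h)) = (\<lambda>h. d * h)"
      unfolding has_field_derivative_def by (rule has_derivative_unique[symmetric])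
    from fun_cong[OF this, of 1] show "frechet_derivative \<phi> (at (x, t)) (0, 1) = d" by simp
  }
qed

lemma Ck_on_fst:
  fixes f :: "real \<Rightarrow> real"
  shows "Ck_on n f UNIV \<Longrightarrow> Ck_on n (\<lambda>z::real \<times> real. f (fst z)) UNIV"
  using Ck_on_affine[of fst n f 0] by (simp add: bounded_linear_fst)

lemma Ck_on_snd:
  fixes f :: "real \<Rightarrow> real"
  shows "Ck_on n f UNIV \<Longrightarrow> Ck_on n (\<lambda>z::real \<times> real. f (snd z)) UNIV"
  using Ck_on_affine[of snd n f 0] by (simp add: bounded_linear_snd)

lemma Ck_on_scale_shift:
  fixes f :: "real \<Rightarrow> real"
  assumes "Ck_on n f UNIV"
  shows "Ck_on n (\<lambda>x. f ((x - p) / l)) UNIV"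
  using Ck_on_affine[OF bounded_linear_divide assms, of l "- p / l"]
  by (simp add: diff_divide_distrib)

section \<open>The continuity equation\<close>

lemma integral_smooth_bump: "integral {0..1} smooth_bump = 1"
  using fundamental_theorem_of_calculus[of 0 1 smooth_step smooth_bump]
  by (simp add: has_real_derivative_iff_has_vector_derivative[symmetric] smooth_step_0 smooth_step_1
      has_field_derivative_at_within smooth_step_deriv integral_unique)

lemma integral_bump_scaled:
  fixes f :: "real \<Rightarrow> real"
  assumes "continuous_on {A..B} f" "A \<le> s" "0 < e" "s + e \<le> B"
  shows "integral {A..B} (\<lambda>x. smooth_bump ((x - s) / e) / e * f x)
       = integral {0..1} (\<lambda>x. smooth_bump x * f (s + e * x))"
proof -
  have c: "continuous_on {s..s+e} f"
    using assms by (auto intro: continuous_on_subset)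
  have [simp]: "(e * e + e * s) / e = e + s"
    using assms by (simp add: field_simps)
  have "((\<lambda>x. smooth_bump x * f (s + e * x)) has_integral
      integral {0..1} (\<lambda>x. smooth_bump x * f (s + e * x))) {0..1}"
    using assms
    by (intro integrable_integral integrable_continuous_real continuous_intros
        continuous_on_smooth_bump continuous_on_compose2[OF c]) auto
  from has_integral_affinity'[OF this[folded box_real], of "1 / e" "- s / e"]
  have "((\<lambda>x. smooth_bump ((x - s) / e) * f x) has_integral
      e * integral {0..1} (\<lambda>x. smooth_bump x * f (s + e * x))) {s..s+e}"
    using assms by (simp add: field_simps)
  from has_integral_divide[OF this, of e]
  have "((\<lambda>x. smooth_bump ((x - s) / e) / e * f x) has_integral
      integral {0..1} (\<lambda>x. smooth_bump x * f (s + e * x))) {s..s+e}"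
    using assms by (simp add: field_simps)
  then have "((\<lambda>x. smooth_bump ((x - s) / e) / e * f x) has_integral
      integral {0..1} (\<lambda>x. smooth_bump x * f (s + e * x))) {A..B}"
    by (rule has_integral_on_superset) (use assms in \<open>auto simp: smooth_bump_0 field_simps\<close>)
  then show ?thesis by (rule integral_unique)
qed

text \<open>After the substitution x = s + e y the width e stands only inside f, so the limit is the
  continuity at e = 0 of a parameter integral, whose value there is f s times the mass of the
  bump.\<close>

lemma bump_concentrates:
  fixes f :: "real \<Rightarrow> real"
  assumes c: "continuous_on {A..B} f" and AB: "A \<le> s" "s < B"
  shows "((\<lambda>e. integral {A..B} (\<lambda>x. smooth_bump ((x - s) / e) / e * f x)) \<longlongrightarrow> f s) (at_right 0)"
proof -
  have "continuous_on {0..B - s} (\<lambda>e. integral (cbox 0 1) (\<lambda>x. smooth_bump x * f (s + e * x)))"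
  proof (rule integral_continuous_on_param)
    have "s + e * x \<in> {A..B}" if "e \<in> {0..B - s}" "x \<in> {0..1}" for e x
      using that AB mult_left_le[of x e] by (auto intro: add_increasing2)
    then show "continuous_on ({0..B - s} \<times> cbox 0 1) (\<lambda>(e, x). smooth_bump x * f (s + e * x))"
      by (auto simp: split_beta intro!: continuous_intros continuous_on_compose2[OF c]
          continuous_on_compose2[OF continuous_on_smooth_bump[of UNIV]])
  qed
  then have "((\<lambda>e. integral {0..1} (\<lambda>x. smooth_bump x * f (s + e * x)))
      \<longlongrightarrow> integral {0..1} (\<lambda>x. smooth_bump x * f (s + 0 * x))) (at 0 within {0..B - s})"
    using AB unfolding continuous_on_def box_real by (elim ballE[of _ _ 0]) auto
  then have "((\<lambda>e. integral {0..1} (\<lambda>x. smooth_bump x * f (s + e * x))) \<longlongrightarrow> f s) (at_right 0)"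
    using AB by (simp add: at_within_Icc_at_right integral_smooth_bump)
  moreover have "eventually (\<lambda>e. e \<in> {0<..<B - s}) (at_right 0)"
    using AB eventually_at_right_real by simp
  then have "eventually (\<lambda>e. integral {0..1} (\<lambda>x. smooth_bump x * f (s + e * x))
      = integral {A..B} (\<lambda>x. smooth_bump ((x - s) / e) / e * f x)) (at_right 0)"
    by eventually_elim (use integral_bump_scaled[OF c] AB in auto)
  ultimately show ?thesis
    by (rule Lim_transform_eventually)
qed

text \<open>Bridge between the Bochner integrals of the definitions and the gauge integral, in which
  the fundamental theorem and the exchange of integrations are carried out.\<close>

lemma set_lebesgue_integral_eq_integral_cbox:
  fixes G :: "'a::euclidean_space \<Rightarrow> real"
  assumes "continuous_on (cbox a b) G" "\<And>z. z \<in> U \<Longrightarrow> z \<notin> cbox a b \<Longrightarrow> G z = 0" "cbox a b \<subseteq> U"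
  shows "(LINT z:U|lborel. G z) = integral (cbox a b) G"
proof -
  have "(LINT z:U|lborel. G z) = (LINT z:cbox a b|lborel. G z)"
    unfolding set_lebesgue_integral_def
    by (rule Bochner_Integration.integral_cong) (use assms in \<open>auto simp: indicator_def\<close>)
  also have "\<dots> = integral (cbox a b) G"
    by (rule set_borel_integral_eq_integral)
      (use borel_integrable_compact[OF compact_cbox assms(1)] in \<open>simp add: set_integrable_def\<close>)
  finally show ?thesis .
qed

text \<open>Products \<psi>(x) \<xi>(t) are enough to recover the flux form of the equation. Fubini
  turns the space-time identity into the statement that the integral of \<psi> m has the integral of
  - \<psi>' J as its weak derivative in time.\<close>

lemma weak_continuity_tensor:
  fixes m J :: "real \<Rightarrow> real \<Rightarrow> real"
  assumes cm: "continuous_on (UNIV \<times> {t0<..<T}) (\<lambda>(x, t). m x t)"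
    and cJ: "continuous_on (UNIV \<times> {t0<..<T}) (\<lambda>(x, t). J x t)"
    and weak: "\<And>\<phi>. test_function (UNIV \<times> {t0<..}) \<phi> \<Longrightarrow>
        (LINT z:UNIV \<times> {t0<..}|lborel. (case z of (x, t) \<Rightarrow>
            - m x t * frechet_derivative \<phi> (at (x, t)) (0, 1)
            + J x t * frechet_derivative \<phi> (at (x, t)) (1, 0))) = 0"
    and psi: "\<And>n. Ck_on n \<psi> UNIV" "\<And>x. (\<psi> has_real_derivative \<psi>' x) (at x)" "continuous_on UNIV \<psi>'"
      "\<And>x. x \<notin> {-L..L} \<Longrightarrow> \<psi> x = 0" "\<And>x. x \<notin> {-L..L} \<Longrightarrow> \<psi>' x = 0"
    and chi: "\<And>n. Ck_on n \<xi> UNIV" "\<And>x. (\<xi> has_real_derivative \<xi>' x) (at x)" "continuous_on UNIV \<xi>'"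
      "\<And>x. x \<notin> {c..d} \<Longrightarrow> \<xi> x = 0" "\<And>x. x \<notin> {c..d} \<Longrightarrow> \<xi>' x = 0"
    and cd: "t0 < c" "d < T"
  shows "integral {c..d} (\<lambda>t. \<xi>' t * integral {-L..L} (\<lambda>x. \<psi> x * m x t))
       = integral {c..d} (\<lambda>t. \<xi> t * integral {-L..L} (\<lambda>x. \<psi>' x * J x t))"
proof -
  define \<phi> where "\<phi> z = \<psi> (fst z) * \<xi> (snd z)" for z :: "real \<times> real"
  have C: "Ck_on n \<phi> UNIV" for n
    unfolding \<phi>_def by (intro Ck_on_mult Ck_on_fst Ck_on_snd psi chi)
  have tf: "test_function (UNIV \<times> {t0<..}) \<phi>"
    by (rule test_functionI[OF C, of "{-L..L} \<times> {c..d}"])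
      (use cd in \<open>auto simp: \<phi>_def intro!: compact_Times intro: psi(4) chi(4)\<close>)
  have d1: "frechet_derivative \<phi> (at (x, t)) (1, 0) = \<psi>' x * \<xi> t" for x t
    by (rule frechet_derivative_slices(1)[OF C]) (auto simp: \<phi>_def intro!: derivative_eq_intros psi(2))
  have d2: "frechet_derivative \<phi> (at (x, t)) (0, 1) = \<psi> x * \<xi>' t" for x t
    by (rule frechet_derivative_slices(2)[OF C]) (auto simp: \<phi>_def intro!: derivative_eq_intros chi(2))
  define G where "G z = (case z of (x, t) \<Rightarrow> - m x t * (\<psi> x * \<xi>' t) + J x t * (\<psi>' x * \<xi> t))" for z
  have sub: "cbox (-L, c) (L, d) \<subseteq> UNIV \<times> {t0<..<T}"
    using cd by (auto simp: cbox_Pair_iff)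
  have cpsi: "continuous_on UNIV \<psi>" "continuous_on UNIV \<xi>"
    using psi(1)[of 0] chi(1)[of 0] by auto
  note cont2 = continuous_on_subset[OF cm sub] continuous_on_subset[OF cJ sub]
    continuous_on_compose2[OF psi(3)] continuous_on_compose2[OF chi(3)]
    continuous_on_compose2[OF cpsi(1)] continuous_on_compose2[OF cpsi(2)]
  have cG: "continuous_on (cbox (-L, c) (L, d)) G"
    unfolding G_def split_beta
    by (intro continuous_intros cont2[unfolded split_beta]) auto
  have "0 = (LINT z:UNIV \<times> {t0<..}|lborel. G z)"
    using weak[OF tf] by (simp add: d1 d2 G_def)
  also have "\<dots> = integral (cbox (-L, c) (L, d)) G"
  proof (rule set_lebesgue_integral_eq_integral_cbox[OF cG])
    show "G z = 0" if "z \<notin> cbox (- L, c) (L, d)" for z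
    proof -
      obtain x t where z: "z = (x, t)" by fastforce
      have "x \<notin> {-L..L} \<or> t \<notin> {c..d}" using that z by (auto simp: cbox_Pair_iff)
      then consider "x \<notin> {-L..L}" | "t \<notin> {c..d}" by blast
      then show ?thesis
        by cases (auto simp: G_def z psi(4,5)[of x] chi(4,5)[of t])
    qed
  qed (use sub in auto)
  also have "\<dots> = integral (cbox (-L) L) (\<lambda>x. integral (cbox c d) (\<lambda>t. G (x, t)))"
    by (rule integral_prod_continuous[OF cG])
  also have "\<dots> = integral (cbox c d) (\<lambda>t. integral (cbox (-L) L) (\<lambda>x. G (x, t)))"
    by (rule integral_swap_continuous[where f = "\<lambda>x t. G (x, t)"]) (use cG in simp)
  also have "\<dots> = integral {c..d} (\<lambda>t. \<xi> t * integral {-L..L} (\<lambda>x. \<psi>' x * J x t)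
      - \<xi>' t * integral {-L..L} (\<lambda>x. \<psi> x * m x t))"
  proof (simp only: box_real, rule integral_cong)
    fix t assume t: "t \<in> {c..d}"
    have cm': "continuous_on {-L..L} (\<lambda>x. m x t)" and cJ': "continuous_on {-L..L} (\<lambda>x. J x t)"
      by (rule continuous_on_compose2[OF cm, of _ "\<lambda>x. (x, t)", simplified];
          use t cd in \<open>auto intro!: continuous_intros\<close>)
         (rule continuous_on_compose2[OF cJ, of _ "\<lambda>x. (x, t)", simplified];
          use t cd in \<open>auto intro!: continuous_intros\<close>)
    have cpsi': "continuous_on {-L..L} \<psi>" "continuous_on {-L..L} \<psi>'"
      using cpsi psi(3) continuous_on_subset by blast+
    have "integral {-L..L} (\<lambda>x. G (x, t))
      = integral {-L..L} (\<lambda>x. \<xi> t * (\<psi>' x * J x t) - \<xi>' t * (\<psi> x * m x t))"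
      by (rule integral_cong) (simp add: G_def algebra_simps)
    also have "\<dots> = integral {-L..L} (\<lambda>x. \<xi> t * (\<psi>' x * J x t)) - integral {-L..L} (\<lambda>x. \<xi>' t * (\<psi> x * m x t))"
      by (intro Henstock_Kurzweil_Integration.integral_diff integrable_continuous_real continuous_intros cm' cJ' cpsi')
    finally show "integral {-L..L} (\<lambda>x. G (x, t)) = \<xi> t * integral {-L..L} (\<lambda>x. \<psi>' x * J x t)
      - \<xi>' t * integral {-L..L} (\<lambda>x. \<psi> x * m x t)"
      by simp
  qed
  also have "\<dots> = integral {c..d} (\<lambda>t. \<xi> t * integral {-L..L} (\<lambda>x. \<psi>' x * J x t))
      - integral {c..d} (\<lambda>t. \<xi>' t * integral {-L..L} (\<lambda>x. \<psi> x * m x t))"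
  proof -
    have sub': "{c..d} \<times> cbox (-L) L \<subseteq> {t0<..<T} \<times> UNIV" using cd by auto
    have sw: "continuous_on ({c..d} \<times> cbox (-L) L) (\<lambda>(t, x). f x t)"
      if "continuous_on (UNIV \<times> {t0<..<T}) (\<lambda>(x, t). f x t :: real)" for f
      using sub' by (auto simp: split_beta intro!: continuous_intros continuous_on_compose2[OF that[unfolded split_beta], of _ "\<lambda>z. (snd z, fst z)", simplified])
    have "continuous_on {c..d} (\<lambda>t. integral (cbox (-L) L) (\<lambda>x. \<psi>' x * J x t))"
      "continuous_on {c..d} (\<lambda>t. integral (cbox (-L) L) (\<lambda>x. \<psi> x * m x t))"
      using sw[OF cm] sw[OF cJ]
      by (intro integral_continuous_on_param;
          auto simp: split_beta intro!: continuous_intros continuous_on_compose2[OF cpsi(1)] continuous_on_compose2[OF psi(3)])+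
    then show ?thesis
      using cpsi chi(3)
      by (intro Henstock_Kurzweil_Integration.integral_diff integrable_continuous_real continuous_intros)
        (auto intro: continuous_on_subset)
  qed
  finally show ?thesis by simp
qed

lemma continuous_on_slice:
  fixes f :: "real \<Rightarrow> real \<Rightarrow> real"
  assumes "continuous_on (UNIV \<times> T) (\<lambda>(x, t). f x t)"
  shows "t \<in> T \<Longrightarrow> continuous_on S (\<lambda>x. f x t)" "S \<subseteq> T \<Longrightarrow> continuous_on S (\<lambda>t. f x t)"
proof -
  show "continuous_on S (\<lambda>x. f x t)" if "t \<in> T"
  proof -
    have "continuous_on S (\<lambda>x. (\<lambda>(x, t). f x t) (x, t))"
      by (rule continuous_on_compose2[OF assms]) (use that in \<open>auto intro!: continuous_intros\<close>)
    then show ?thesis by simp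
  qed
  show "continuous_on S (\<lambda>t. f x t)" if "S \<subseteq> T"
  proof -
    have "continuous_on S (\<lambda>t. (\<lambda>(x, t). f x t) (x, t))"
      by (rule continuous_on_compose2[OF assms]) (use that in \<open>auto intro!: continuous_intros\<close>)
    then show ?thesis by simp
  qed
qed

lemma continuous_on_integral_slice:
  fixes f :: "real \<Rightarrow> real \<Rightarrow> real"
  assumes "continuous_on (UNIV \<times> T) (\<lambda>(x, t). f x t)"
  shows "continuous_on T (\<lambda>t. integral {a..b} (\<lambda>x. f x t))"
proof -
  have "continuous_on (T \<times> cbox a b) (\<lambda>z. (\<lambda>(x, t). f x t) (snd z, fst z))"
    by (rule continuous_on_compose2[OF assms]) (auto intro!: continuous_intros)
  then have "continuous_on (T \<times> cbox a b) (\<lambda>(t, x). f x t)"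
    by (simp add: split_beta)
  from integral_continuous_on_param[OF this] show ?thesis by simp
qed

text \<open>Du Bois-Reymond argument in time: a continuous function whose integral against \<xi>'
  vanishes for all these cut-offs takes equal values at s and t, because \<xi>' concentrates at
  these two times with opposite signs.\<close>

lemma weak_continuity_slice:
  fixes m J :: "real \<Rightarrow> real \<Rightarrow> real"
  assumes cm: "continuous_on (UNIV \<times> {t0<..<T}) (\<lambda>(x, t). m x t)"
    and cJ: "continuous_on (UNIV \<times> {t0<..<T}) (\<lambda>(x, t). J x t)"
    and weak: "\<And>\<phi>. test_function (UNIV \<times> {t0<..}) \<phi> \<Longrightarrow>
        (LINT z:UNIV \<times> {t0<..}|lborel. (case z of (x, t) \<Rightarrow>
            - m x t * frechet_derivative \<phi> (at (x, t)) (0, 1)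
            + J x t * frechet_derivative \<phi> (at (x, t)) (1, 0))) = 0"
    and psi: "\<And>n. Ck_on n \<psi> UNIV" "\<And>x. (\<psi> has_real_derivative \<psi>' x) (at x)" "continuous_on UNIV \<psi>'"
      "\<And>x. x \<notin> {-L..L} \<Longrightarrow> \<psi> x = 0" "\<And>x. x \<notin> {-L..L} \<Longrightarrow> \<psi>' x = 0"
    and st: "t0 < s" "s < t" "t < T"
  shows "integral {-L..L} (\<lambda>x. \<psi> x * m x t) - integral {-L..L} (\<lambda>x. \<psi> x * m x s)
       = - integral {s..t} (\<lambda>r. integral {-L..L} (\<lambda>x. \<psi>' x * J x r))"
proof -
  \<comment> \<open>\<open>c\<close> and \<open>d\<close> leave a margin inside (t0, T): the
    cut-offs live in [c, d], hence have compact support in the open half plane, and all integrands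
    are continuous there.\<close>
  define c where "c = (t0 + s) / 2"
  define d where "d = (t + T) / 2"
  have cd: "t0 < c" "c < s" "t < d" "d < T" using st by (auto simp: c_def d_def)
  define \<Theta> where "\<Theta> t = integral {-L..L} (\<lambda>x. \<psi> x * m x t)" for t
  define \<Lambda> where "\<Lambda> t = integral {-L..L} (\<lambda>x. \<psi>' x * J x t)" for t
  have cpsi: "continuous_on UNIV \<psi>" using psi(1)[of 0] by simp
  have cT: "continuous_on {t0<..<T} \<Theta>" unfolding \<Theta>_def
    using cm by (intro continuous_on_integral_slice)
      (auto simp: split_beta intro!: continuous_intros continuous_on_compose2[OF cpsi])
  have cL: "continuous_on {t0<..<T} \<Lambda>" unfolding \<Lambda>_def
    using cJ by (intro continuous_on_integral_slice)
      (auto simp: split_beta intro!: continuous_intros continuous_on_compose2[OF psi(3)])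
  have cT': "continuous_on {c..d} \<Theta>" and cL': "continuous_on {c..d} \<Lambda>"
    using cd by (auto intro: continuous_on_subset[OF cT] continuous_on_subset[OF cL])
  define A where "A t = integral {c..t} \<Lambda>" for t
  have dA: "(A has_real_derivative \<Lambda> x) (at x within {c..d})" if "x \<in> {c..d}" for x
    unfolding A_def by (rule integral_has_real_derivative[OF cL' that])
  have cA: "continuous_on {c..d} A"
    using dA by (meson DERIV_continuous_on)
  \<comment> \<open>\<open>V\<close> should be constant: its weak derivative is that of \<Theta>
    plus \<Lambda>, which cancel by the tensor identity.\<close>
  define V where "V t = \<Theta> t + A t" for t
  have cV: "continuous_on {c..d} V" unfolding V_def by (intro continuous_intros cT' cA)
  define F where "F e = integral {c..d} (\<lambda>x. smooth_bump ((x - s) / e) / e * V x)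
       - integral {c..d} (\<lambda>x. smooth_bump ((x - t) / e) / e * V x)" for e
  have "(F \<longlongrightarrow> V s - V t) (at_right 0)" unfolding F_def
    by (intro tendsto_diff bump_concentrates cV) (use cd st in auto)
  moreover have "eventually (\<lambda>e. F e = 0) (at_right 0)"
  proof -
    have "eventually (\<lambda>e. e \<in> {0<..<d - t}) (at_right 0)"
      using cd eventually_at_right_real by simp
    then show ?thesis
    proof eventually_elim
      fix e assume e: "e \<in> {0<..<d - t}"
      \<comment> \<open>A smooth version of the indicator of [s, t], with edges of width e. It
        vanishes at \<open>c\<close> and \<open>d\<close> too, so the integration by parts below has
        no boundary terms.\<close>
      define \<xi> where "\<xi> x = smooth_step ((x - s) / e) + (-1) * smooth_step ((x - t) / e)" for x
      define \<xi>' where "\<xi>' x = smooth_bump ((x - s) / e) / e + (-1) * (smooth_bump ((x - t) / e) / e)" for x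
      have Cx: "Ck_on n \<xi> UNIV" for n
        unfolding \<xi>_def
        by (intro Ck_on_add Ck_on_mult Ck_on_const Ck_on_scale_shift Ck_on_smooth_step)
      have dx: "(\<xi> has_real_derivative \<xi>' x) (at x)" for x
        unfolding \<xi>_def \<xi>'_def by (intro DERIV_add DERIV_cmult smooth_step_scaled_deriv)
      have cx: "continuous_on UNIV \<xi>'" unfolding \<xi>'_def
        by (intro continuous_intros continuous_on_compose2[OF continuous_on_smooth_bump[of UNIV]]) (use e in auto)
      have x0: "\<xi> x = 0" "\<xi>' x = 0" if "x \<notin> {c<..<d}" for x
      proof -
        have "x \<le> s \<or> x \<ge> t + e" using that cd e by auto
        then consider "x \<le> s" | "x \<ge> t + e" by blast
        then have "\<xi> x = 0 \<and> \<xi>' x = 0"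
        proof cases
          case 1
          then have "(x - s) / e \<le> 0" "(x - t) / e \<le> 0" using e st by (auto simp: divide_le_0_iff)
          then show ?thesis by (simp add: \<xi>_def \<xi>'_def smooth_step_0 smooth_bump_0)
        next
          case 2
          then have "1 \<le> (x - s) / e" "1 \<le> (x - t) / e" using e st by (auto simp: field_simps)
          then show ?thesis by (auto simp: \<xi>_def \<xi>'_def smooth_step_1 smooth_bump_0)
        qed
        then show "\<xi> x = 0" "\<xi>' x = 0" by auto
      qed
      have T: "integral {c..d} (\<lambda>t. \<xi>' t * \<Theta> t) = integral {c..d} (\<lambda>t. \<xi> t * \<Lambda> t)"
        unfolding \<Theta>_def \<Lambda>_def
        by (rule weak_continuity_tensor[OF cm cJ weak psi Cx dx cx])
          (use cd in \<open>auto intro!: x0\<close>)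
      have cx': "continuous_on {c..d} \<xi>" "continuous_on {c..d} \<xi>'"
        using Cx[of 0] cx by (auto intro: continuous_on_subset)
      have "((\<lambda>x. \<xi>' x * A x + \<xi> x * \<Lambda> x) has_integral \<xi> d * A d - \<xi> c * A c) {c..d}"
      proof (rule fundamental_theorem_of_calculus)
        show "((\<lambda>x. \<xi> x * A x) has_vector_derivative \<xi>' x * A x + \<xi> x * \<Lambda> x) (at x within {c..d})"
          if "x \<in> {c..d}" for x
          unfolding has_real_derivative_iff_has_vector_derivative[symmetric]
          by (rule derivative_eq_intros has_field_derivative_at_within[OF dx] dA[OF that] refl)+ simp
      qed (use cd st in auto)
      then have "integral {c..d} (\<lambda>x. \<xi>' x * A x + \<xi> x * \<Lambda> x) = 0"
        using x0[of c] x0[of d] by (auto simp: integral_unique)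
      moreover have "integral {c..d} (\<lambda>x. \<xi>' x * A x + \<xi> x * \<Lambda> x)
        = integral {c..d} (\<lambda>x. \<xi>' x * A x) + integral {c..d} (\<lambda>x. \<xi> x * \<Lambda> x)"
        by (intro Henstock_Kurzweil_Integration.integral_add integrable_continuous_real continuous_intros cx' cA cL')
      moreover have "integral {c..d} (\<lambda>x. \<xi>' x * V x)
        = integral {c..d} (\<lambda>x. \<xi>' x * \<Theta> x) + integral {c..d} (\<lambda>x. \<xi>' x * A x)"
        unfolding V_def distrib_left
        by (intro Henstock_Kurzweil_Integration.integral_add integrable_continuous_real continuous_intros cx' cA cT')
      moreover have "integral {c..d} (\<lambda>x. \<xi>' x * V x) = F e"
      proof -
        have cb: "continuous_on {c..d} (\<lambda>x. smooth_bump ((x - p) / e))" for p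
          by (intro continuous_intros continuous_on_compose2[OF continuous_on_smooth_bump[of UNIV]]) (use e in auto)
        have "F e = integral {c..d} (\<lambda>x. smooth_bump ((x - s) / e) / e * V x - smooth_bump ((x - t) / e) / e * V x)"
          unfolding F_def using e
          by (intro Henstock_Kurzweil_Integration.integral_diff[symmetric] integrable_continuous_real continuous_intros cb cV) auto
        then show ?thesis by (simp add: \<xi>'_def algebra_simps)
      qed
      ultimately show "F e = 0" using T by simp
    qed
  qed
  ultimately have "((\<lambda>_. 0) \<longlongrightarrow> V s - V t) (at_right (0::real))"
    by (rule Lim_transform_eventually)
  then have "V s - V t = 0"
    using tendsto_unique[OF trivial_limit_at_right_real _ tendsto_const] by blast
  moreover have "A t - A s = integral {s..t} \<Lambda>"
    unfolding A_def
    using Henstock_Kurzweil_Integration.integral_combine[of c s t \<Lambda>,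
        OF _ _ integrable_continuous_real[OF continuous_on_subset[OF cL']]] cd st
    by auto
  ultimately have "\<Theta> t - \<Theta> s = - integral {s..t} \<Lambda>" by (simp add: V_def)
  then show ?thesis by (simp add: \<Theta>_def \<Lambda>_def[abs_def])
qed

text \<open>The test function is a smooth version of the indicator of [-L, y]. Its left edge lies in
  [-L - 1, -L], where \<open>m\<close> and \<open>J\<close> vanish, so only the right edge
  contributes; it concentrates at y and leaves the flux through y. The horizon T is there because a
  spatial bound L on the support is available only up to a finite time.\<close>

lemma weak_continuity_flux:
  fixes m J :: "real \<Rightarrow> real \<Rightarrow> real"
  assumes cm: "continuous_on (UNIV \<times> {t0<..<T}) (\<lambda>(x, t). m x t)"
    and cJ: "continuous_on (UNIV \<times> {t0<..<T}) (\<lambda>(x, t). J x t)"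
    and weak: "\<And>\<phi>. test_function (UNIV \<times> {t0<..}) \<phi> \<Longrightarrow>
        (LINT z:UNIV \<times> {t0<..}|lborel. (case z of (x, t) \<Rightarrow>
            - m x t * frechet_derivative \<phi> (at (x, t)) (0, 1)
            + J x t * frechet_derivative \<phi> (at (x, t)) (1, 0))) = 0"
    and z: "\<And>x t. t0 < t \<Longrightarrow> t < T \<Longrightarrow> L \<le> \<bar>x\<bar> \<Longrightarrow> m x t = 0"
      "\<And>x t. t0 < t \<Longrightarrow> t < T \<Longrightarrow> L \<le> \<bar>x\<bar> \<Longrightarrow> J x t = 0"
    and st: "t0 < s" "s < t" "t < T" and y: "-L \<le> y" and L: "0 < L"
  shows "integral {-L..y} (\<lambda>x. m x t) - integral {-L..y} (\<lambda>x. m x s) = integral {s..t} (J y)"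
proof -
  define L' where "L' = L + \<bar>y\<bar> + 3"
  have cmt: "continuous_on S (\<lambda>x. m x r)" "continuous_on S (\<lambda>x. J x r)" if "r \<in> {s..t}" for r S
    using that st by (auto intro!: continuous_on_slice[OF cm] continuous_on_slice[OF cJ])
  define B where "B x = integral {s..t} (J x)" for x
  have sub: "UNIV \<times> cbox s t \<subseteq> UNIV \<times> {t0<..<T}" using st by auto
  have cB: "continuous_on S B" for S
    unfolding B_def box_real[symmetric]
    using continuous_on_subset[OF integral_continuous_on_param[OF continuous_on_subset[OF cJ sub]]]
    by blast
  define \<psi> where "\<psi> e x = smooth_step ((x - (- L - 1)) / 1) + (-1) * smooth_step ((x - y) / e)" for e x
  define \<psi>' where "\<psi>' e x = smooth_bump ((x - (- L - 1)) / 1) / 1 + (-1) * (smooth_bump ((x - y) / e) / e)" for e x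
  have Cx: "Ck_on n (\<psi> e) UNIV" for n e
    unfolding \<psi>_def by (intro Ck_on_add Ck_on_mult Ck_on_const Ck_on_scale_shift Ck_on_smooth_step)
  have dx: "(\<psi> e has_real_derivative \<psi>' e x) (at x)" for x e
    unfolding \<psi>_def \<psi>'_def by (intro DERIV_add DERIV_cmult smooth_step_scaled_deriv)
  have cx: "continuous_on UNIV (\<psi>' e)" if "e > 0" for e unfolding \<psi>'_def
    by (intro continuous_intros continuous_on_compose2[OF continuous_on_smooth_bump[of UNIV]]) (use that in auto)
  have x0: "\<psi> e x = 0 \<and> \<psi>' e x = 0" if "x \<notin> {-L'..L'}" "0 < e" "e < 1" for x e
  proof -
    have "x \<le> - L - 1 \<or> x \<ge> y + 1 \<and> x \<ge> -L" using that L by (auto simp: L'_def)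
    then consider "x \<le> - L - 1" | "x \<ge> y + 1 \<and> x \<ge> -L" by blast
    then show ?thesis
    proof cases
      case 1
      then have "(x - y) / e \<le> 0" using y that by (auto simp: divide_le_0_iff)
      then show ?thesis using 1 by (auto simp: \<psi>_def \<psi>'_def smooth_step_0 smooth_bump_0)
    next
      case 2
      then have "1 \<le> (x - y) / e" using that by (auto simp: field_simps)
      then show ?thesis using 2 by (auto simp: \<psi>_def \<psi>'_def smooth_step_1 smooth_bump_0)
    qed
  qed
  have e01: "eventually (\<lambda>e::real. e \<in> {0<..<1}) (at_right 0)"
    using eventually_at_right_real by simp
  have main: "integral {-L'..L'} (\<lambda>x. \<psi> e x * m x t) - integral {-L'..L'} (\<lambda>x. \<psi> e x * m x s)
       = integral {-L'..L'} (\<lambda>x. smooth_bump ((x - y) / e) / e * B x)" if e: "0 < e" "e < 1" for e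
  proof -
    have sw: "continuous_on (cbox (-L', s) (L', t)) (\<lambda>(x, r). smooth_bump ((x - y) / e) / e * J x r)"
      using st e by (auto simp: split_beta intro!: continuous_intros
         continuous_on_compose2[OF continuous_on_smooth_bump[of UNIV]] continuous_on_subset[OF cJ[unfolded split_beta]])
    have "integral {-L'..L'} (\<lambda>x. \<psi> e x * m x t) - integral {-L'..L'} (\<lambda>x. \<psi> e x * m x s)
       = - integral {s..t} (\<lambda>r. integral {-L'..L'} (\<lambda>x. \<psi>' e x * J x r))"
      by (rule weak_continuity_slice[OF cm cJ weak Cx dx cx]) (use e st x0 in auto)
    also have "integral {s..t} (\<lambda>r. integral {-L'..L'} (\<lambda>x. \<psi>' e x * J x r))
       = integral {s..t} (\<lambda>r. - integral {-L'..L'} (\<lambda>x. smooth_bump ((x - y) / e) / e * J x r))"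
    proof (rule integral_cong)
      fix r assume r: "r \<in> {s..t}"
      have "integral {-L'..L'} (\<lambda>x. \<psi>' e x * J x r) = integral {-L'..L'} (\<lambda>x. - (smooth_bump ((x - y) / e) / e * J x r))"
      proof (rule integral_cong)
        fix x
        \<comment> \<open>The bump of the left edge is supported where the flux is zero.\<close>
        have "smooth_bump (x - (-L-1)) * J x r = 0"
        proof (cases "-L-1 < x \<and> x < -L")
          case True
          then have "J x r = 0" using z(2)[of r x] r st by auto
          then show ?thesis by simp
        qed (auto simp: smooth_bump_0)
        then show "\<psi>' e x * J x r = - (smooth_bump ((x - y) / e) / e * J x r)"
          unfolding \<psi>'_def distrib_right by simp
      qed
      then show "integral {-L'..L'} (\<lambda>x. \<psi>' e x * J x r)
        = - integral {-L'..L'} (\<lambda>x. smooth_bump ((x - y) / e) / e * J x r)" by simp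
    qed
    also have "- \<dots> = integral (cbox s t) (\<lambda>r. integral (cbox (-L') L') (\<lambda>x. smooth_bump ((x - y) / e) / e * J x r))"
      by simp
    also have "\<dots> = integral (cbox (-L') L') (\<lambda>x. integral (cbox s t) (\<lambda>r. smooth_bump ((x - y) / e) / e * J x r))"
      by (rule integral_swap_continuous[OF sw, symmetric])
    finally show ?thesis by (simp add: B_def)
  qed
  have lim: "((\<lambda>e. integral {-L'..L'} (\<lambda>x. \<psi> e x * m x r)) \<longlongrightarrow> integral {-L..y} (\<lambda>x. m x r)) (at_right 0)"
    if r: "r \<in> {s..t}" for r
  proof -
    have "compact ((\<lambda>x. m x r) ` {y..y+1})" by (intro compact_continuous_image cmt r) auto
    then obtain M where M: "\<And>x. x \<in> {y..y+1} \<Longrightarrow> \<bar>m x r\<bar> \<le> M"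
      by (metis bounded_real compact_imp_bounded imageI)
    \<comment> \<open>The two integrands differ only on [y, y + e], where the cut-off is between 0
      and 1, so the error is at most e times the maximum of \<open>m\<close>.\<close>
    have bound: "\<bar>integral {-L'..L'} (\<lambda>x. \<psi> e x * m x r) - integral {-L..y} (\<lambda>x. m x r)\<bar> \<le> M * e"
      if e: "e \<in> {0<..<1}" for e
    proof -
      have cp: "continuous_on S (\<psi> e)" for S using Cx[of 0] by (auto intro: continuous_on_subset)
      have int: "(\<lambda>x. \<psi> e x * m x r) integrable_on {a..b}" for a b
        by (intro integrable_continuous_real continuous_intros cp cmt r)
      have "integral {-L'..-L} (\<lambda>x. \<psi> e x * m x r) = integral {-L'..-L} (\<lambda>_. 0::real)"
        by (rule integral_cong) (use z(1)[of r] r st in auto)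
      moreover have "integral {y+e..L'} (\<lambda>x. \<psi> e x * m x r) = integral {y+e..L'} (\<lambda>_. 0::real)"
      proof (rule integral_cong)
        fix x assume x: "x \<in> {y+e..L'}"
        then have "1 \<le> (x - y) / e" using e by (auto simp: field_simps)
        then show "\<psi> e x * m x r = 0"
          using z(1)[of r x] r st x e y
          by (cases "x \<ge> -L") (auto simp: \<psi>_def smooth_step_1)
      qed
      moreover have "integral {-L..y} (\<lambda>x. \<psi> e x * m x r) = integral {-L..y} (\<lambda>x. m x r)"
      proof (rule integral_cong)
        fix x assume x: "x \<in> {-L..y}"
        then have "(x - y) / e \<le> 0" using e by (auto simp: divide_le_0_iff)
        then show "\<psi> e x * m x r = m x r" using x by (simp add: \<psi>_def smooth_step_1 smooth_step_0)
      qed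
      moreover have "integral {-L'..-L} (\<lambda>x. \<psi> e x * m x r) + integral {-L..L'} (\<lambda>x. \<psi> e x * m x r)
         = integral {-L'..L'} (\<lambda>x. \<psi> e x * m x r)"
        by (rule Henstock_Kurzweil_Integration.integral_combine) (use int L in \<open>auto simp: L'_def\<close>)
      moreover have "integral {-L..y} (\<lambda>x. \<psi> e x * m x r) + integral {y..L'} (\<lambda>x. \<psi> e x * m x r)
         = integral {-L..L'} (\<lambda>x. \<psi> e x * m x r)"
        by (rule Henstock_Kurzweil_Integration.integral_combine) (use int L y in \<open>auto simp: L'_def\<close>)
      moreover have "integral {y..y+e} (\<lambda>x. \<psi> e x * m x r) + integral {y+e..L'} (\<lambda>x. \<psi> e x * m x r)
         = integral {y..L'} (\<lambda>x. \<psi> e x * m x r)"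
        by (rule Henstock_Kurzweil_Integration.integral_combine) (use int L y e in \<open>auto simp: L'_def\<close>)
      moreover have "norm (integral {y..y+e} (\<lambda>x. \<psi> e x * m x r)) \<le> M * (y + e - y)"
      proof (rule integral_bound)
        show "norm (\<psi> e x * m x r) \<le> M" if x: "x \<in> {y..y+e}" for x
        proof -
          have "\<psi> e x = 1 - smooth_step ((x - y) / e)" using x y by (simp add: \<psi>_def smooth_step_1)
          then have "\<bar>\<psi> e x\<bar> \<le> 1" using smooth_step_bounds[of "(x - y) / e"] by auto
          moreover have "\<bar>m x r\<bar> \<le> M" using M[of x] x e by auto
          ultimately show ?thesis
            using mult_mono[of "\<bar>\<psi> e x\<bar>" 1 "\<bar>m x r\<bar>" M] by (simp add: abs_mult)
        qed
      qed (use e in \<open>auto intro!: continuous_intros cp cmt r\<close>)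
      ultimately show ?thesis by simp
    qed
    have M0: "((\<lambda>e. M * e) \<longlongrightarrow> 0) (at_right 0)"
      using tendsto_mult_right_zero[OF tendsto_ident_at] by blast
    have "((\<lambda>e. integral {-L'..L'} (\<lambda>x. \<psi> e x * m x r) - integral {-L..y} (\<lambda>x. m x r)) \<longlongrightarrow> 0) (at_right 0)"
    proof (rule Lim_null_comparison[OF _ M0])
      show "\<forall>\<^sub>F e in at_right 0. norm (integral {-L'..L'} (\<lambda>x. \<psi> e x * m x r) - integral {-L..y} (\<lambda>x. m x r)) \<le> M * e"
        using e01 by eventually_elim (use bound in simp)
    qed
    then show ?thesis by (simp add: LIM_zero_iff)
  qed
  have "((\<lambda>e. integral {-L'..L'} (\<lambda>x. \<psi> e x * m x t) - integral {-L'..L'} (\<lambda>x. \<psi> e x * m x s))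
     \<longlongrightarrow> integral {-L..y} (\<lambda>x. m x t) - integral {-L..y} (\<lambda>x. m x s)) (at_right 0)"
    by (intro tendsto_diff lim) (use st in auto)
  moreover have "((\<lambda>e. integral {-L'..L'} (\<lambda>x. \<psi> e x * m x t) - integral {-L'..L'} (\<lambda>x. \<psi> e x * m x s))
     \<longlongrightarrow> B y) (at_right 0)"
  proof (rule Lim_transform_eventually)
    show "((\<lambda>e. integral {-L'..L'} (\<lambda>x. smooth_bump ((x - y) / e) / e * B x)) \<longlongrightarrow> B y) (at_right 0)"
      by (rule bump_concentrates[OF cB]) (use L in \<open>auto simp: L'_def\<close>)
    show "\<forall>\<^sub>F e in at_right 0. integral {-L'..L'} (\<lambda>x. smooth_bump ((x - y) / e) / e * B x)
      = integral {-L'..L'} (\<lambda>x. \<psi> e x * m x t) - integral {-L'..L'} (\<lambda>x. \<psi> e x * m x s)"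
      using e01 by eventually_elim (simp add: main)
  qed
  ultimately show ?thesis
    unfolding B_def using tendsto_unique trivial_limit_at_right_real by blast
qed

text \<open>The flux is continuous in time, so the integrated identity differentiates at every t.
  This is the only form in which the continuity equation is used later.\<close>

lemma weak_continuity_flux_deriv:
  fixes m J :: "real \<Rightarrow> real \<Rightarrow> real"
  assumes cm: "continuous_on (UNIV \<times> {t0<..<T}) (\<lambda>(x, t). m x t)"
    and cJ: "continuous_on (UNIV \<times> {t0<..<T}) (\<lambda>(x, t). J x t)"
    and weak: "\<And>\<phi>. test_function (UNIV \<times> {t0<..}) \<phi> \<Longrightarrow>
        (LINT z:UNIV \<times> {t0<..}|lborel. (case z of (x, t) \<Rightarrow>
            - m x t * frechet_derivative \<phi> (at (x, t)) (0, 1)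
            + J x t * frechet_derivative \<phi> (at (x, t)) (1, 0))) = 0"
    and z: "\<And>x t. t0 < t \<Longrightarrow> t < T \<Longrightarrow> L \<le> \<bar>x\<bar> \<Longrightarrow> m x t = 0"
      "\<And>x t. t0 < t \<Longrightarrow> t < T \<Longrightarrow> L \<le> \<bar>x\<bar> \<Longrightarrow> J x t = 0"
    and t: "t0 < t" "t < T" and y: "-L \<le> y" and L: "0 < L"
  shows "((\<lambda>t. integral {-L..y} (\<lambda>x. m x t)) has_real_derivative J y t) (at t)"
proof -
  define s where "s = (t0 + t) / 2"
  define r where "r = (t + T) / 2"
  have sr: "t0 < s" "s < t" "t < r" "r < T" using t by (auto simp: s_def r_def)
  have "((\<lambda>x. integral {s..x} (J y) + integral {-L..y} (\<lambda>x. m x s)) has_real_derivative J y t + 0) (at t within {s..r})"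
    by (intro DERIV_add DERIV_const integral_has_real_derivative continuous_on_slice[OF cJ])
      (use sr in auto)
  then have "((\<lambda>x. integral {s..x} (J y) + integral {-L..y} (\<lambda>x. m x s)) has_real_derivative J y t) (at t)"
    using sr by (simp add: at_within_Icc_at)
  then show ?thesis
    by (rule has_field_derivative_transform_within_open[of _ _ _ "{s<..<r}"])
      (use sr weak_continuity_flux[OF cm cJ weak z sr(1) _ _ y L] in \<open>auto simp: algebra_simps\<close>)
qed

section \<open>The energy identity\<close>

text \<open>The hypotheses are deliberately asymmetric: one partial derivative is required only at
  the point itself, the other continuously nearby. In applications the first slot is the time of the
  density, whose differentiability is known only through the flux.\<close>

lemma has_real_derivative_diagonal:
  fixes f g :: "real \<Rightarrow> real \<Rightarrow> real"
  assumes U: "open U" "convex U" "t \<in> U"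
    and fx: "((\<lambda>s. f s t) has_real_derivative a) (at t)"
    and fy: "\<And>s r. s \<in> U \<Longrightarrow> r \<in> U \<Longrightarrow> ((\<lambda>r. f s r) has_real_derivative g s r) (at r)"
    and cg: "continuous_on (U \<times> U) (\<lambda>(s, r). g s r)"
  shows "((\<lambda>t. f t t) has_real_derivative a + g t t) (at t)"
proof -
  have "((\<lambda>(x, y). f x y) has_derivative
      (\<lambda>(tx, ty). a * tx + blinfun_mult_right (g t t) ty)) (at (t, t) within U \<times> U)"
  proof (rule has_derivative_partialsI[where fy = "\<lambda>x y. blinfun_mult_right (g x y)"])
    show "((\<lambda>x. f x t) has_derivative (*) a) (at t within U)"
      using fx by (simp add: has_field_derivative_def has_derivative_at_withinI)
    show "((\<lambda>y. f x y) has_derivative blinfun_apply (blinfun_mult_right (g x y))) (at y within U)"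
      if "x \<in> U" "y \<in> U" for x y
      using fy[OF that] by (simp add: has_field_derivative_def has_derivative_at_withinI)
    have "continuous_on (U \<times> U) (\<lambda>z. blinfun_mult_right ((\<lambda>(s, r). g s r) z))"
      by (intro bounded_linear.continuous_on[OF bounded_linear_blinfun_mult_right] cg)
    then show "continuous (at (t, t) within U \<times> U) (\<lambda>(x, y). blinfun_mult_right (g x y))"
      using U unfolding continuous_on_eq_continuous_within split_beta by blast
  qed (use U in auto)
  then have "((\<lambda>(x, y). f x y) has_derivative (\<lambda>(tx, ty). a * tx + g t t * ty)) (at (t, t))"
    using U by (subst (asm) at_within_open) (auto simp: open_Times)
  then have "((\<lambda>t. (\<lambda>(x, y). f x y) (t, t)) has_derivative (\<lambda>h. (\<lambda>(tx, ty). a * tx + g t t * ty) (h, h))) (at t)"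
    by (rule has_derivative_compose[rotated]) (auto intro!: derivative_eq_intros)
  moreover have "(\<lambda>h. a * h + g t t * h) = (*) (a + g t t)"
    by (simp add: fun_eq_iff distrib_right)
  ultimately show ?thesis by (simp add: has_field_derivative_def)
qed

lemma continuous_on_integral_slice2:
  fixes f g :: "real \<Rightarrow> real \<Rightarrow> real"
  assumes f: "continuous_on (UNIV \<times> S) (\<lambda>(x, t). f x t)" and g: "continuous_on (UNIV \<times> T) (\<lambda>(x, t). g x t)"
  shows "continuous_on (S \<times> T) (\<lambda>(s, t). integral {a..b} (\<lambda>x. f x s * g x t))"
proof -
  have "continuous_on ((S \<times> T) \<times> cbox a b) (\<lambda>z. (\<lambda>(x, t). f x t) (snd z, fst (fst z)) * (\<lambda>(x, t). g x t) (snd z, snd (fst z)))"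
    by (intro continuous_intros continuous_on_compose2[OF f] continuous_on_compose2[OF g]) auto
  then have "continuous_on ((S \<times> T) \<times> cbox a b) (\<lambda>(z, x). f x (fst z) * g x (snd z))"
    by (simp add: split_beta)
  from integral_continuous_on_param[OF this] show ?thesis by (simp add: split_beta)
qed

text \<open>Fenchel inequality for F(s) = s^(\<theta>+1) / (\<theta>+1), whose Legendre dual at
  r^\<theta> is \<theta> / (\<theta>+1) r^(\<theta>+1). Equality at s = r is what makes it a
  convexity statement for F.\<close>

lemma Young_powr:
  fixes s r :: real
  assumes "0 \<le> s" "0 \<le> r" "0 < \<theta>"
  shows "s * r powr \<theta> \<le> s powr (\<theta> + 1) / (\<theta> + 1) + \<theta> / (\<theta> + 1) * r powr (\<theta> + 1)"
proof -
  have "s * r powr \<theta> \<le> s powr (\<theta> + 1) / (\<theta> + 1) + (r powr \<theta>) powr ((\<theta> + 1) / \<theta>) / ((\<theta> + 1) / \<theta>)"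
    by (rule Youngs_inequality) (use assms in \<open>auto simp: field_simps\<close>)
  then show ?thesis using assms by (simp add: powr_powr mult.commute)
qed

lemma powr_plus_one: "0 \<le> s \<Longrightarrow> 0 < \<theta> \<Longrightarrow> s powr (\<theta> + 1) = s * s powr \<theta>" for s \<theta> :: real
  by (cases "s = 0") (auto simp: powr_add)

text \<open>What remains of the problem after rescaling. \<open>p\<close> and \<open>z\<close> are
  the two partial derivatives of \<open>w\<close>; the continuity equation appears only as a
  classical derivative of the cumulative mass. The density is continuous up to \<open>T0\<close>,
  whereas \<open>w\<close> and its derivatives are controlled only after \<open>T0\<close>, and
  \<open>p\<close> is bounded only where the density is positive.\<close>

locale rescaled_flow =
  fixes \<mu> w p z :: "real \<Rightarrow> real \<Rightarrow> real" and T0 R \<theta> c k Mb W :: real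
  assumes params: "0 < R" "0 < \<theta>" "0 < c" "0 < k" "0 \<le> W"
    and cmu0: "continuous_on (UNIV \<times> {T0..}) (\<lambda>(x, t). \<mu> x t)"
    and mu_nonneg: "T0 \<le> t \<Longrightarrow> 0 \<le> \<mu> x t"
    and mu_supp: "T0 \<le> t \<Longrightarrow> R \<le> \<bar>x\<bar> \<Longrightarrow> \<mu> x t = 0"
    and mu_bd: "T0 \<le> t \<Longrightarrow> \<mu> x t \<le> Mb"
    and cw: "continuous_on (UNIV \<times> {T0<..}) (\<lambda>(x, t). w x t)"
    and cp: "continuous_on (UNIV \<times> {T0<..}) (\<lambda>(x, t). p x t)"
    and cz: "continuous_on (UNIV \<times> {T0<..}) (\<lambda>(x, t). z x t)"
    and dw_x: "T0 < t \<Longrightarrow> ((\<lambda>x. w x t) has_real_derivative p x t) (at x)"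
    and dw_t: "T0 < t \<Longrightarrow> ((\<lambda>t. w x t) has_real_derivative z x t) (at t)"
    and HJ: "T0 < t \<Longrightarrow> z x t = - k * w x t + (p x t)\<^sup>2 / 2 - \<mu> x t powr \<theta> - c * x\<^sup>2"
    and flux: "T0 < t \<Longrightarrow> -R \<le> y \<Longrightarrow>
      ((\<lambda>t. integral {-R..y} (\<lambda>x. \<mu> x t)) has_real_derivative \<mu> y t * p y t) (at t)"
    and p_bd: "T0 < t \<Longrightarrow> 0 < \<mu> x t \<Longrightarrow> \<bar>p x t\<bar> \<le> W"
begin

lemma cmu: "continuous_on (UNIV \<times> {T0<..}) (\<lambda>(x, t). \<mu> x t)"
  by (rule continuous_on_subset[OF cmu0]) auto

lemma cf: "continuous_on (UNIV \<times> {T0..}) (\<lambda>(x, t). \<mu> x t powr \<theta>)"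
  unfolding split_beta
  by (intro continuous_on_powr' continuous_on_const cmu0[unfolded split_beta])
    (use params mu_nonneg in auto)

lemma cf': "continuous_on (UNIV \<times> {T0..}) (\<lambda>(x, t). \<mu> x t powr (\<theta> + 1))"
  unfolding split_beta
  by (intro continuous_on_powr' continuous_on_const cmu0[unfolded split_beta])
    (use params mu_nonneg in auto)

lemmas slices =
  continuous_on_slice(1)[OF cmu] continuous_on_slice(1)[OF cw] continuous_on_slice(1)[OF cp]
  continuous_on_slice(1)[OF cz] continuous_on_slice(1)[OF cf] continuous_on_slice(1)[OF cf']

lemmas cont = continuous_on_mult continuous_on_diff continuous_on_add continuous_on_const continuous_on_id
  continuous_on_power continuous_on_minus continuous_on_divide

definition "N y t = integral {-R..y} (\<lambda>x. \<mu> x t)"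

lemma N_deriv_x: 
  assumes "T0 < t" "x \<in> {-R..R}"
  shows "((\<lambda>y. N y t) has_real_derivative \<mu> x t) (at x within {-R..R})"
  unfolding N_def by (intro integral_has_real_derivative slices) (use assms in auto)

lemma cN: "T0 < t \<Longrightarrow> continuous_on {-R..R} (\<lambda>x. N x t)"
  using N_deriv_x by (meson DERIV_continuous_on)

text \<open>The equation \<mu>_t = (\<mu> p)_x tested with a C^1 function that itself depends on
  time. The later starting time \<open>T1\<close> admits test functions obtained from
  \<open>w\<close> by a time shift into the past.\<close>

lemma transport:
  assumes T: "T0 \<le> T1" "T1 < t"
    and c: "continuous_on (UNIV \<times> {T1<..}) (\<lambda>(x, t). \<psi> x t)"
      "continuous_on (UNIV \<times> {T1<..}) (\<lambda>(x, t). \<psi>x x t)"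
      "continuous_on (UNIV \<times> {T1<..}) (\<lambda>(x, t). \<psi>t x t)"
    and dx: "\<And>x t. T1 < t \<Longrightarrow> ((\<lambda>x. \<psi> x t) has_real_derivative \<psi>x x t) (at x)"
    and dt: "\<And>x t. T1 < t \<Longrightarrow> ((\<lambda>t. \<psi> x t) has_real_derivative \<psi>t x t) (at t)"
  shows "((\<lambda>t. integral {-R..R} (\<lambda>x. \<mu> x t * \<psi> x t)) has_real_derivative
    integral {-R..R} (\<lambda>x. \<mu> x t * \<psi>t x t) - integral {-R..R} (\<lambda>x. \<mu> x t * p x t * \<psi>x x t)) (at t)"
proof -
  have sub: "UNIV \<times> {T1<..} \<subseteq> UNIV \<times> {T0<..}" using T by auto
  note c' = continuous_on_subset[OF cmu sub] continuous_on_subset[OF cp sub] c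
  define f where "f s r = integral {-R..R} (\<lambda>x. \<mu> x s * \<psi> x r)" for s r
  \<comment> \<open>With the test function frozen at time t, integration by parts moves the other
    time variable from \<open>\<mu>\<close>, which has no time derivative, to \<open>N\<close>,
    which has one.\<close>
  have parts: "f s t = N R s * \<psi> R t - integral {-R..R} (\<lambda>x. N x s * \<psi>x x t)" if s: "T1 < s" for s
  proof -
    have "((\<lambda>x. \<mu> x s * \<psi> x t + \<psi>x x t * N x s) has_integral N R s * \<psi> R t - N (-R) s * \<psi> (-R) t) {-R..R}"
    proof (rule fundamental_theorem_of_calculus)
      show "((\<lambda>x. N x s * \<psi> x t) has_vector_derivative \<mu> x s * \<psi> x t + \<psi>x x t * N x s) (at x within {-R..R})"
        if "x \<in> {-R..R}" for x
        unfolding has_real_derivative_iff_has_vector_derivative[symmetric]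
        by (intro DERIV_mult N_deriv_x has_field_derivative_at_within[OF dx]) (use that s T in auto)
    qed (use params in auto)
    moreover have "N (-R) s = 0" by (simp add: N_def)
    ultimately have "integral {-R..R} (\<lambda>x. \<mu> x s * \<psi> x t + \<psi>x x t * N x s) = N R s * \<psi> R t"
      by (simp add: integral_unique)
    moreover have "integral {-R..R} (\<lambda>x. \<mu> x s * \<psi> x t + \<psi>x x t * N x s)
       = f s t + integral {-R..R} (\<lambda>x. \<psi>x x t * N x s)"
      unfolding f_def
      by (intro Henstock_Kurzweil_Integration.integral_add integrable_continuous_real cont cN
          continuous_on_slice(1)[OF c'(1)] continuous_on_slice(1)[OF c(1)] continuous_on_slice(1)[OF c(2)])
        (use s T in auto)
    ultimately show ?thesis by (simp add: mult.commute)
  qed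
  have "((\<lambda>s. N R s * \<psi> R t - integral (cbox (-R) R) (\<lambda>x. N x s * \<psi>x x t)) has_real_derivative
     (\<mu> R t * p R t) * \<psi> R t - integral (cbox (-R) R) (\<lambda>x. \<mu> x t * p x t * \<psi>x x t)) (at t within {T1<..})"
  proof (rule DERIV_diff)
    have "(N R has_real_derivative \<mu> R t * p R t) (at t within {T1<..})"
      unfolding N_def using params T by (intro has_field_derivative_at_within[OF flux]) auto
    then show "((\<lambda>s. N R s * \<psi> R t) has_real_derivative (\<mu> R t * p R t) * \<psi> R t) (at t within {T1<..})"
      by (rule DERIV_cmult_right)
    show "((\<lambda>s. integral (cbox (-R) R) (\<lambda>x. N x s * \<psi>x x t)) has_real_derivative
      integral (cbox (-R) R) (\<lambda>x. \<mu> x t * p x t * \<psi>x x t)) (at t within {T1<..})"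
    proof (rule leibniz_rule_field_derivative[where fx = "\<lambda>s x. \<mu> x s * p x s * \<psi>x x t"])
      show "((\<lambda>s. N x s * \<psi>x x t) has_real_derivative \<mu> x s * p x s * \<psi>x x t) (at s within {T1<..})"
        if "s \<in> {T1<..}" "x \<in> cbox (-R) R" for s x
        unfolding N_def using that T by (intro DERIV_cmult_right has_field_derivative_at_within[OF flux]) auto
      show "(\<lambda>x. N x s * \<psi>x x t) integrable_on cbox (-R) R" if "s \<in> {T1<..}" for s
        using that T unfolding box_real
        by (intro integrable_continuous_real cont cN continuous_on_slice(1)[OF c(2)]) auto
      have "continuous_on ({T1<..} \<times> cbox (- R) R)
         (\<lambda>y. (\<lambda>(x, t). \<mu> x t) (snd y, fst y) * (\<lambda>(x, t). p x t) (snd y, fst y) * (\<lambda>(x, t). \<psi>x x t) (snd y, t))"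
        using T by (intro continuous_intros continuous_on_compose2[OF c'(1)] continuous_on_compose2[OF c'(2)]
              continuous_on_compose2[OF c(2)]) auto
      then show "continuous_on ({T1<..} \<times> cbox (- R) R) (\<lambda>(s, x). \<mu> x s * p x s * \<psi>x x t)"
        by (simp add: split_beta)
    qed (use T in auto)
  qed
  then have "((\<lambda>s. N R s * \<psi> R t - integral {-R..R} (\<lambda>x. N x s * \<psi>x x t)) has_real_derivative
     - integral {-R..R} (\<lambda>x. \<mu> x t * p x t * \<psi>x x t)) (at t)"
    using T params mu_supp[of t R] by (simp add: at_within_open[of _ "{T1<..}"])
  then have fx: "((\<lambda>s. f s t) has_real_derivative - integral {-R..R} (\<lambda>x. \<mu> x t * p x t * \<psi>x x t)) (at t)"
    by (rule has_field_derivative_transform_within_open[of _ _ _ "{T1<..}"]) (use T parts in auto)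
  have "((\<lambda>t. f t t) has_real_derivative - integral {-R..R} (\<lambda>x. \<mu> x t * p x t * \<psi>x x t)
      + integral {-R..R} (\<lambda>x. \<mu> x t * \<psi>t x t)) (at t)"
  proof (rule has_real_derivative_diagonal[where U = "{T1<..}" and f = f and g = "\<lambda>s r. integral {-R..R} (\<lambda>x. \<mu> x s * \<psi>t x r)"])
    show "continuous_on ({T1<..} \<times> {T1<..}) (\<lambda>(s, r). integral {- R..R} (\<lambda>x. \<mu> x s * \<psi>t x r))"
      by (rule continuous_on_integral_slice2[OF c'(1) c(3)])
    fix s r assume sr: "s \<in> {T1<..}" "r \<in> {T1<..}"
    have "((\<lambda>r. integral (cbox (-R) R) (\<lambda>x. \<mu> x s * \<psi> x r)) has_real_derivative
       integral (cbox (-R) R) (\<lambda>x. \<mu> x s * \<psi>t x r)) (at r within {T1<..})"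
    proof (rule leibniz_rule_field_derivative)
      show "((\<lambda>r. \<mu> x s * \<psi> x r) has_real_derivative \<mu> x s * \<psi>t x r) (at r within {T1<..})"
        if "r \<in> {T1<..}" for r x
        using that by (intro DERIV_cmult has_field_derivative_at_within[OF dt]) auto
      show "(\<lambda>x. \<mu> x s * \<psi> x r) integrable_on cbox (- R) R" if "r \<in> {T1<..}" for r
        using that sr by (intro integrable_continuous continuous_intros continuous_on_slice(1)[OF c'(1)] continuous_on_slice(1)[OF c(1)]) auto
      have "continuous_on ({T1<..} \<times> cbox (- R) R) (\<lambda>y. (\<lambda>(x, t). \<mu> x t) (snd y, s) * (\<lambda>(x, t). \<psi>t x t) (snd y, fst y))"
        using sr by (intro continuous_intros continuous_on_compose2[OF c'(1)] continuous_on_compose2[OF c(3)]) auto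
      then show "continuous_on ({T1<..} \<times> cbox (- R) R) (\<lambda>(r, x). \<mu> x s * \<psi>t x r)"
        by (simp add: split_beta)
    qed (use sr in auto)
    then show "((\<lambda>r. f s r) has_real_derivative integral {- R..R} (\<lambda>x. \<mu> x s * \<psi>t x r)) (at r)"
      using sr by (simp add: f_def at_within_open[of _ "{T1<..}"])
  qed (use T fx in auto)
  then show ?thesis by (simp add: f_def)
qed

text \<open>The density and the value function are taken at two separate times so that each can be
  varied alone.\<close>

definition "B s r = integral {-R..R} (\<lambda>x. \<mu> x s * w x r)"
definition "Z s r = integral {-R..R} (\<lambda>x. \<mu> x s * z x r)"
definition "D t = integral {-R..R} (\<lambda>x. \<mu> x t * (p x t)\<^sup>2)"
text \<open>The integral of the Legendre dual of F at \<mu>^\<theta>, that is, the integral of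
  \<mu>^(\<theta>+1) minus that of F(\<mu>).\<close>

definition "G t = integral {-R..R} (\<lambda>x. \<theta> / (\<theta> + 1) * \<mu> x t powr (\<theta> + 1))"
definition "Pot t = integral {-R..R} (\<lambda>x. \<mu> x t powr (\<theta> + 1) / (\<theta> + 1) + c * x\<^sup>2 * \<mu> x t)"
definition "En t = D t / 2 - Pot t"

lemma cZ: "continuous_on ({T0<..} \<times> {T0<..}) (\<lambda>(s, t). Z s t)"
  unfolding Z_def by (rule continuous_on_integral_slice2[OF cmu cz])

lemma cG: "continuous_on {T0..} G"
  unfolding G_def[abs_def] using cf' params
  by (intro continuous_on_integral_slice) (auto simp: split_beta intro!: continuous_intros)

lemma cD: "continuous_on {T0<..} D"
  unfolding D_def[abs_def] using cmu cp
  by (intro continuous_on_integral_slice) (auto simp: split_beta intro!: continuous_intros)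

lemma cPot: "continuous_on {T0..} Pot"
  unfolding Pot_def[abs_def] using cf' cmu0 params
  by (intro continuous_on_integral_slice) (auto simp: split_beta intro!: continuous_intros)

lemma B_deriv:
  assumes "T0 < s" "T0 < r"
  shows "((\<lambda>r. B s r) has_real_derivative Z s r) (at r)"
proof -
  have "((\<lambda>r. integral (cbox (-R) R) (\<lambda>x. \<mu> x s * w x r)) has_real_derivative
     integral (cbox (-R) R) (\<lambda>x. \<mu> x s * z x r)) (at r within {T0<..})"
  proof (rule leibniz_rule_field_derivative)
    show "((\<lambda>r. \<mu> x s * w x r) has_real_derivative \<mu> x s * z x r) (at r within {T0<..})"
      if "r \<in> {T0<..}" for r x
      using that by (intro DERIV_cmult has_field_derivative_at_within[OF dw_t]) auto
    show "(\<lambda>x. \<mu> x s * w x r) integrable_on cbox (- R) R" if "r \<in> {T0<..}" for r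
      using that assms by (intro integrable_continuous continuous_intros slices) auto
    have "continuous_on ({T0<..} \<times> cbox (- R) R) (\<lambda>y. (\<lambda>(x, t). \<mu> x t) (snd y, s) * (\<lambda>(x, t). z x t) (snd y, fst y))"
      using assms by (intro continuous_intros continuous_on_compose2[OF cmu] continuous_on_compose2[OF cz]) auto
    then show "continuous_on ({T0<..} \<times> cbox (- R) R) (\<lambda>(r, x). \<mu> x s * z x r)"
      by (simp add: split_beta)
  qed (use assms in auto)
  then show ?thesis
    using assms by (simp add: B_def Z_def at_within_open[of _ "{T0<..}"])
qed

lemma B_diag_deriv:
  assumes "T0 < t"
  shows "((\<lambda>t. B t t) has_real_derivative Z t t - D t) (at t)"
  using transport[OF order_refl assms cw cp cz dw_x dw_t]
  by (simp add: B_def Z_def D_def power2_eq_square mult.assoc)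

text \<open>Write q and n for the values of \<open>p\<close> and \<open>\<mu>\<close> at time t + h.
  The Hamilton-Jacobi equation turns the integrand of the derivative into - k times that of the left
  bracket, plus \<mu> (q - p)^2 / 2, plus \<mu>^(\<theta>+1) - \<mu> n^\<theta>. The square is
  dropped, and \<open>Young_powr\<close> bounds the last difference below by the integrand of G(t) -
  G(t + h). Neither loss depends on the sign of h, and both vanish at h = 0.\<close>

lemma B_shift_deriv:
  assumes "T0 < t" "T0 < t + h"
  shows "\<exists>A'. ((\<lambda>t. B t (t + h) - B t t) has_real_derivative A') (at t)
      \<and> - k * (B t (t + h) - B t t) - (G (t + h) - G t) \<le> A'"
proof -
  define T1 where "T1 = max T0 (T0 - h)"
  have T1: "T0 \<le> T1" "T1 < t" using assms by (auto simp: T1_def)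
  have c: "continuous_on (UNIV \<times> {T1<..}) (\<lambda>(x, t). f x (t + h))"
    if "continuous_on (UNIV \<times> {T0<..}) (\<lambda>(x, t). f x t)" for f :: "real \<Rightarrow> real \<Rightarrow> real"
  proof -
    have "continuous_on (UNIV \<times> {T1<..}) (\<lambda>y. (\<lambda>(x, t). f x t) (fst y, snd y + h))"
      by (rule continuous_on_compose2[OF that]) (auto simp: T1_def intro!: continuous_intros)
    then show ?thesis by (simp add: split_beta)
  qed
  have dt: "((\<lambda>t. w x (t + h)) has_real_derivative z x (t + h)) (at t)" if "T1 < t" for x t
    using DERIV_shift[of "\<lambda>t. w x t" "z x (t + h)" t h] dw_t[of "t + h" x] that by (simp add: T1_def)
  have "((\<lambda>t. B t (t + h)) has_real_derivative
    integral {-R..R} (\<lambda>x. \<mu> x t * z x (t + h)) - integral {-R..R} (\<lambda>x. \<mu> x t * p x t * p x (t + h))) (at t)"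
    unfolding B_def by (rule transport[OF T1 c[OF cw] c[OF cp] c[OF cz] _ dt]) (auto intro!: dw_x simp: T1_def)
  from DERIV_diff[OF this B_diag_deriv[OF assms(1)]]
  have d: "((\<lambda>t. B t (t + h) - B t t) has_real_derivative
    integral {-R..R} (\<lambda>x. \<mu> x t * z x (t + h)) - integral {-R..R} (\<lambda>x. \<mu> x t * p x t * p x (t + h)) - (Z t t - D t)) (at t)"
    (is "(_ has_real_derivative ?A) _") .
  have 1: "((\<lambda>x. \<mu> x t * z x (t + h) - \<mu> x t * p x t * p x (t + h) - (\<mu> x t * z x t - \<mu> x t * (p x t)\<^sup>2)) has_integral ?A) {-R..R}"
    unfolding Z_def D_def using assms
    by (intro has_integral_diff integrable_integral integrable_continuous_real cont slices) auto
  have 2: "((\<lambda>x. - k * (\<mu> x t * w x (t + h) - \<mu> x t * w x t)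
      - (\<theta> / (\<theta> + 1) * \<mu> x (t + h) powr (\<theta> + 1) - \<theta> / (\<theta> + 1) * \<mu> x t powr (\<theta> + 1)))
      has_integral (- k * (B t (t + h) - B t t) - (G (t + h) - G t))) {-R..R}"
    unfolding B_def G_def using assms
    by (intro has_integral_diff has_integral_mult_right integrable_integral integrable_continuous_real cont slices) auto
  have "- k * (B t (t + h) - B t t) - (G (t + h) - G t) \<le> ?A"
  proof (rule has_integral_le[OF 2 1])
    fix x
    have nn: "0 \<le> \<mu> x t" "0 \<le> \<mu> x (t + h)" using assms mu_nonneg by auto
    have "\<mu> x t * \<mu> x (t + h) powr \<theta> \<le> \<mu> x t powr (\<theta> + 1) / (\<theta> + 1) + \<theta> / (\<theta> + 1) * \<mu> x (t + h) powr (\<theta> + 1)"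
      by (rule Young_powr) (use nn params in auto)
    moreover have "\<mu> x t powr (\<theta> + 1) / (\<theta> + 1) = \<mu> x t powr (\<theta> + 1) - \<theta> / (\<theta> + 1) * \<mu> x t powr (\<theta> + 1)"
      using params by (simp add: field_simps)
    moreover have "0 \<le> \<mu> x t * (p x (t + h) - p x t)\<^sup>2" using nn by simp
    moreover have "\<mu> x t powr (\<theta> + 1) = \<mu> x t * \<mu> x t powr \<theta>" using nn params by (intro powr_plus_one) auto
    ultimately show "- k * (\<mu> x t * w x (t + h) - \<mu> x t * w x t)
      - (\<theta> / (\<theta> + 1) * \<mu> x (t + h) powr (\<theta> + 1) - \<theta> / (\<theta> + 1) * \<mu> x t powr (\<theta> + 1))
      \<le> \<mu> x t * z x (t + h) - \<mu> x t * p x t * p x (t + h) - (\<mu> x t * z x t - \<mu> x t * (p x t)\<^sup>2)"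
      unfolding HJ[OF assms(1)] HJ[OF assms(2)]
      by (simp add: power2_eq_square algebra_simps)
  qed
  with d show ?thesis by blast
qed

text \<open>For every \<open>h\<close>, positive or negative, the inequality of the previous lemma integrates to
  \<open>L h \<ge> 0\<close>, while \<open>L 0 = 0\<close>. Hence \<open>L' 0 = 0\<close>, which is the energy identity without any
  second derivatives of \<open>w\<close>.\<close>

lemma energy_balance:
  assumes t: "T0 < t1" "t1 < t2"
  shows "Z t2 t2 + G t2 - (Z t1 t1 + G t1) = - k * integral {t1..t2} (\<lambda>t. Z t t)"
proof -
  define d where "d = (t1 - T0) / 2"
  have d: "0 < d" "T0 < t1 - d" using t by (auto simp: d_def field_simps)
  define U where "U = {-d<..<d}"
  define A where "A h t = B t (t + h) - B t t" for h t
  \<comment> \<open>The slack in the inequality of \<open>B_shift_deriv\<close> after integration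
    over [t1, t2].\<close>
  define L where "L h = A h t2 - A h t1 + k * integral {t1..t2} (A h) + integral {t1..t2} (\<lambda>t. G (t + h)) - integral {t1..t2} G" for h
  have "A 0 = (\<lambda>_. 0)" by (simp add: A_def fun_eq_iff)
  then have L0: "L 0 = 0" by (simp add: L_def)
  have cA: "continuous_on {t1..t2} (A h)" if "h \<in> U" for h
  proof (intro continuous_at_imp_continuous_on ballI)
    fix x assume "x \<in> {t1..t2}"
    then have "T0 < x" "T0 < x + h" using that d by (auto simp: U_def)
    from B_shift_deriv[OF this] show "isCont (A h) x"
      unfolding A_def[abs_def] using DERIV_isCont by blast
  qed
  have cGs: "continuous_on {t1..t2} (\<lambda>t. G (t + h))" if "h \<in> U" for h
    by (rule continuous_on_compose2[OF cG]) (use that d in \<open>auto simp: U_def intro!: continuous_intros\<close>)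
  have cG0: "continuous_on {t1..t2} G"
    by (rule continuous_on_subset[OF cG]) (use t in auto)
  have Lpos: "0 \<le> L h" if h: "h \<in> U" for h
  proof -
    have "\<exists>A'. \<forall>x\<in>{t1..t2}. (A h has_real_derivative A' x) (at x)
      \<and> - k * A h x - (G (x + h) - G x) \<le> A' x"
      using B_shift_deriv[of _ h] h d unfolding A_def[abs_def] U_def
      by (intro bchoice) auto
    then obtain A' where A': "\<And>x. x \<in> {t1..t2} \<Longrightarrow> (A h has_real_derivative A' x) (at x)"
      "\<And>x. x \<in> {t1..t2} \<Longrightarrow> - k * A h x - (G (x + h) - G x) \<le> A' x" by blast
    have 1: "(A' has_integral A h t2 - A h t1) {t1..t2}"
      by (rule fundamental_theorem_of_calculus)
        (use t A'(1) in \<open>auto simp: has_real_derivative_iff_has_vector_derivative[symmetric] intro: has_field_derivative_at_within\<close>)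
    have 2: "((\<lambda>x. - k * A h x - (G (x + h) - G x)) has_integral
       - k * integral {t1..t2} (A h) - (integral {t1..t2} (\<lambda>t. G (t + h)) - integral {t1..t2} G)) {t1..t2}"
      by (intro has_integral_diff has_integral_mult_right integrable_integral integrable_continuous_real cA cGs cG0 h)
    have "- k * integral {t1..t2} (A h) - (integral {t1..t2} (\<lambda>t. G (t + h)) - integral {t1..t2} G) \<le> A h t2 - A h t1"
      by (rule has_integral_le[OF 2 1 A'(2)])
    then show ?thesis by (simp add: L_def)
  qed
  have dA: "((\<lambda>h. A h t) has_real_derivative Z t (t + h)) (at h)" if "t \<in> {t1..t2}" "h \<in> U" for t h
  proof -
    have "((\<lambda>h. B t (t + h)) has_real_derivative Z t (t + h)) (at h)"
      using DERIV_shift[of "\<lambda>r. B t r" "Z t (t + h)" h t] B_deriv[of t "t + h"] that d t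
      by (simp add: U_def add.commute)
    from DERIV_diff[OF this DERIV_const[of "B t t"]] show ?thesis by (simp add: A_def)
  qed
  have dIA: "((\<lambda>h. integral {t1..t2} (A h)) has_real_derivative integral {t1..t2} (\<lambda>t. Z t t)) (at 0)"
  proof -
    have "((\<lambda>h. integral (cbox t1 t2) (A h)) has_real_derivative integral (cbox t1 t2) (\<lambda>t. Z t (t + 0))) (at 0 within U)"
    proof (rule leibniz_rule_field_derivative)
      have "continuous_on (U \<times> cbox t1 t2) (\<lambda>y. (\<lambda>(s, t). Z s t) (snd y, snd y + fst y))"
        by (rule continuous_on_compose2[OF cZ]) (use d t in \<open>auto simp: U_def intro!: continuous_intros\<close>)
      then show "continuous_on (U \<times> cbox t1 t2) (\<lambda>(h, t). Z t (t + h))" by (simp add: split_beta)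
    qed (use d dA cA in \<open>auto simp: U_def intro!: integrable_continuous_real intro: has_field_derivative_at_within\<close>)
    then show ?thesis using d by (simp add: U_def at_within_open[of _ "{-d<..<d}"])
  qed
  \<comment> \<open>\<open>G\<close> is only continuous, so the integral of G(t + h) is
    differentiated in h after being written as a difference of values of a primitive.\<close>
  define \<Gamma> where "\<Gamma> x = integral {t1-d..x} G" for x
  have cG1: "continuous_on {t1-d..t2+d} G"
    by (rule continuous_on_subset[OF cG]) (use t d in auto)
  have dG: "(\<Gamma> has_real_derivative G x) (at x)" if "x \<in> {t1-d<..<t2+d}" for x
    using integral_has_real_derivative[OF cG1, of x] that unfolding \<Gamma>_def
    by (simp add: at_within_Icc_at)
  have dGs: "((\<lambda>h. \<Gamma> (x + h)) has_real_derivative G (x + h)) (at h)" "((\<lambda>x. \<Gamma> (x + h)) has_real_derivative G (x + h)) (at x)"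
    if "x \<in> {t1..t2}" "h \<in> U" for x h
    using DERIV_shift[of \<Gamma> "G (x + h)" h x] DERIV_shift[of \<Gamma> "G (x + h)" x h] dG[of "x + h"] that
    by (auto simp: U_def add.commute)
  have IG: "integral {t1..t2} (\<lambda>t. G (t + h)) = \<Gamma> (t2 + h) - \<Gamma> (t1 + h)" if "h \<in> U" for h
    by (rule integral_unique, rule fundamental_theorem_of_calculus)
      (use t dGs(2)[OF _ that] in \<open>auto simp: has_real_derivative_iff_has_vector_derivative[symmetric] intro: has_field_derivative_at_within\<close>)
  have "((\<lambda>h. A h t2 - A h t1 + k * integral {t1..t2} (A h) + (\<Gamma> (t2 + h) - \<Gamma> (t1 + h)) - integral {t1..t2} G)
     has_real_derivative Z t2 (t2 + 0) - Z t1 (t1 + 0) + k * integral {t1..t2} (\<lambda>t. Z t t) + (G (t2 + 0) - G (t1 + 0)) - 0) (at 0)"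
    by (intro DERIV_add DERIV_diff DERIV_const DERIV_cmult dA dIA dGs) (use t d in \<open>auto simp: U_def\<close>)
  then have "(L has_real_derivative Z t2 (t2 + 0) - Z t1 (t1 + 0) + k * integral {t1..t2} (\<lambda>t. Z t t) + (G (t2 + 0) - G (t1 + 0)) - 0) (at 0)"
    by (rule has_field_derivative_transform_within_open[of _ _ _ U])
      (use d in \<open>auto simp: L_def IG, auto simp: U_def\<close>)
  then have "Z t2 (t2 + 0) - Z t1 (t1 + 0) + k * integral {t1..t2} (\<lambda>t. Z t t) + (G (t2 + 0) - G (t1 + 0)) - 0 = 0"
    by (rule DERIV_local_min[of _ _ _ d]) (use d Lpos L0 in \<open>auto simp: U_def abs_less_iff\<close>)
  then show ?thesis by simp
qed

text \<open>The Hamilton-Jacobi equation multiplied by \<open>\<mu>\<close> and integrated. It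
  converts Z + G, the quantity of \<open>energy_balance\<close>, into the energy up to the term k
  B.\<close>

lemma En_eq:
  assumes "T0 < t"
  shows "En t = Z t t + k * B t t + G t"
proof -
  have 1: "((\<lambda>x. \<mu> x t * z x t + k * (\<mu> x t * w x t) + \<theta> / (\<theta> + 1) * \<mu> x t powr (\<theta> + 1)) has_integral (Z t t + k * B t t + G t)) {-R..R}"
    unfolding Z_def B_def G_def using assms
    by (intro has_integral_add has_integral_mult_right integrable_integral integrable_continuous_real cont slices) auto
  have "((\<lambda>x. (1 / 2) * (\<mu> x t * (p x t)\<^sup>2) - (\<mu> x t powr (\<theta> + 1) / (\<theta> + 1) + c * x\<^sup>2 * \<mu> x t)) has_integral ((1 / 2) * D t - Pot t)) {-R..R}"
    unfolding D_def Pot_def using assms params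
    by (intro has_integral_diff has_integral_mult_right integrable_integral integrable_continuous_real cont slices) auto
  then have 2: "((\<lambda>x. \<mu> x t * z x t + k * (\<mu> x t * w x t) + \<theta> / (\<theta> + 1) * \<mu> x t powr (\<theta> + 1)) has_integral ((1 / 2) * D t - Pot t)) {-R..R}"
  proof (rule has_integral_eq[rotated])
    fix x
    have "\<mu> x t powr (\<theta> + 1) = \<mu> x t * \<mu> x t powr \<theta>" using assms mu_nonneg params by (intro powr_plus_one) auto
    then show "(1 / 2) * (\<mu> x t * (p x t)\<^sup>2) - (\<mu> x t powr (\<theta> + 1) / (\<theta> + 1) + c * x\<^sup>2 * \<mu> x t)
      = \<mu> x t * z x t + k * (\<mu> x t * w x t) + \<theta> / (\<theta> + 1) * \<mu> x t powr (\<theta> + 1)"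
      unfolding HJ[OF assms] using params by (simp add: field_simps)
  qed
  from has_integral_unique[OF 1 2] show ?thesis by (simp add: En_def)
qed

text \<open>The integral of \<open>Z\<close> produced by \<open>energy_balance\<close> cancels
  against k times the increment of \<open>B\<close>, whose derivative is Z - D; only the dissipation
  is left.\<close>

lemma En_diff:
  assumes t: "T0 < t1" "t1 < t2"
  shows "En t2 - En t1 = - k * integral {t1..t2} D"
proof -
  have cZ': "continuous_on {t1..t2} (\<lambda>t. Z t t)"
  proof -
    have "continuous_on {t1..t2} (\<lambda>t. (\<lambda>(s, t). Z s t) (t, t))"
      by (rule continuous_on_compose2[OF cZ]) (use t in \<open>auto intro!: continuous_intros\<close>)
    then show ?thesis by simp
  qed
  have cD': "continuous_on {t1..t2} D" by (rule continuous_on_subset[OF cD]) (use t in auto)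
  have "((\<lambda>t. Z t t - D t) has_integral B t2 t2 - B t1 t1) {t1..t2}"
    by (rule fundamental_theorem_of_calculus)
      (use t in \<open>auto simp: has_real_derivative_iff_has_vector_derivative[symmetric] intro!: has_field_derivative_at_within B_diag_deriv\<close>)
  moreover have "((\<lambda>t. Z t t - D t) has_integral integral {t1..t2} (\<lambda>t. Z t t) - integral {t1..t2} D) {t1..t2}"
    by (intro has_integral_diff integrable_integral integrable_continuous_real cZ' cD')
  ultimately have "B t2 t2 - B t1 t1 = integral {t1..t2} (\<lambda>t. Z t t) - integral {t1..t2} D"
    by (rule has_integral_unique)
  then have "k * (B t2 t2 - B t1 t1) = k * (integral {t1..t2} (\<lambda>t. Z t t) - integral {t1..t2} D)"
    by simp
  then show ?thesis
    using energy_balance[OF t] t by (simp add: En_eq algebra_simps)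
qed

lemma En_deriv:
  assumes "T0 < t"
  shows "(En has_real_derivative - k * D t) (at t)"
proof -
  define s where "s = (T0 + t) / 2"
  have s: "T0 < s" "s < t" using assms by (auto simp: s_def)
  have "((\<lambda>x. En s + - k * integral {s..x} D) has_real_derivative 0 + - k * D t) (at t within {s..t+1})"
    by (intro DERIV_add DERIV_const DERIV_cmult integral_has_real_derivative continuous_on_subset[OF cD])
      (use s in auto)
  then have "((\<lambda>x. En s + - k * integral {s..x} D) has_real_derivative - k * D t) (at t)"
    using s by (simp add: at_within_Icc_at)
  then show ?thesis
    by (rule has_field_derivative_transform_within_open[of _ _ _ "{s<..}"])
      (use s En_diff[of s] in \<open>auto simp: algebra_simps\<close>)
qed

end

section \<open>Convergence to the stationary profile\<close>

lemma powr_inverse_iff: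
  fixes y s \<theta> :: real
  assumes "0 < \<theta>" "0 \<le> y" "y powr \<theta> = s"
  shows "y = s powr (1 / \<theta>)"
  using assms by (auto simp: powr_powr)

lemma uniformly_continuous_powr:
  fixes \<theta> :: real
  assumes "0 < \<theta>" "0 < e"
  obtains d where "0 < d" "\<And>x y. 0 \<le> x \<Longrightarrow> x \<le> b \<Longrightarrow> 0 \<le> y \<Longrightarrow> y \<le> b \<Longrightarrow> \<bar>x - y\<bar> < d \<Longrightarrow> \<bar>x powr \<theta> - y powr \<theta>\<bar> < e"
proof -
  have "continuous_on {0..b} (\<lambda>x::real. x powr \<theta>)"
    by (rule continuous_on_powr') (use assms in \<open>auto intro: continuous_intros\<close>)
  then have "uniformly_continuous_on {0..b} (\<lambda>x::real. x powr \<theta>)"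
    by (rule compact_uniformly_continuous) simp
  then show ?thesis
    using assms(2) that unfolding uniformly_continuous_on_def
    by (metis atLeastAtMost_iff dist_real_def)
qed

definition stationary :: "real \<Rightarrow> real \<Rightarrow> real \<Rightarrow> real \<Rightarrow> real" where
  "stationary \<theta> c r x = max 0 (r - c * x\<^sup>2) powr (1 / \<theta>)"

section \<open>Bounds, monotonicity of the energy and conservation of mass\<close>

context rescaled_flow
begin

definition "PF f = integral {-R..R} (\<lambda>x. f x powr (\<theta> + 1) / (\<theta> + 1) + c * x\<^sup>2 * f x)"

lemma Pot_eq: "Pot t = PF (\<lambda>x. \<mu> x t)"
  by (simp add: Pot_def PF_def)

text \<open>Continuity of the potential in the uniform norm, with a modulus depending only on the
  bounds. It serves both for the variation in time and for the passage to the limit profile.\<close>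

lemma PF_close:
  assumes "0 < e"
  obtains d where "0 < d" "\<And>f g. continuous_on {-R..R} f \<Longrightarrow> continuous_on {-R..R} g \<Longrightarrow>
    (\<And>x. x \<in> {-R..R} \<Longrightarrow> 0 \<le> f x \<and> f x \<le> Mb \<and> 0 \<le> g x \<and> g x \<le> Mb \<and> \<bar>f x - g x\<bar> < d) \<Longrightarrow> \<bar>PF f - PF g\<bar> \<le> e"
proof -
  define e' where "e' = e / (2 * R)"
  \<comment> \<open>Half of the allowed pointwise error each for the power term and for the
    quadratic term; integration over [-R, R] multiplies by 2 R.\<close>
  define q where "q = e' / 2"
  have q: "0 < q" using assms params by (simp add: q_def e'_def)
  obtain d where d: "0 < d" "\<And>x y. 0 \<le> x \<Longrightarrow> x \<le> Mb \<Longrightarrow> 0 \<le> y \<Longrightarrow> y \<le> Mb \<Longrightarrow> \<bar>x - y\<bar> < d \<Longrightarrow>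
     \<bar>x powr (\<theta> + 1) - y powr (\<theta> + 1)\<bar> < (\<theta> + 1) * q"
    using uniformly_continuous_powr[of "\<theta> + 1" "(\<theta> + 1) * q" Mb] params q by auto
  define d' where "d' = min d (q / (c * R\<^sup>2))"
  have d': "0 < d'" using d(1) q params by (simp add: d'_def)
  show ?thesis
  proof (rule that[OF d'])
    fix f g assume cf: "continuous_on {-R..R} f" and cg: "continuous_on {-R..R} g"
      and fg: "\<And>x. x \<in> {-R..R} \<Longrightarrow> 0 \<le> f x \<and> f x \<le> Mb \<and> 0 \<le> g x \<and> g x \<le> Mb \<and> \<bar>f x - g x\<bar> < d'"
    have I: "((\<lambda>x. h x powr (\<theta> + 1) / (\<theta> + 1) + c * x\<^sup>2 * h x) has_integral PF h) {-R..R}"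
      if "continuous_on {-R..R} h" "\<And>x. x \<in> {-R..R} \<Longrightarrow> 0 \<le> h x" for h
      unfolding PF_def
      by (intro integrable_integral integrable_continuous_real cont continuous_on_powr' that)
        (use that params in auto)
    have "norm (PF f - PF g) \<le> e' * measure lborel (cbox (-R) R)"
    proof (rule has_integral_bound)
      show "((\<lambda>x. (f x powr (\<theta> + 1) / (\<theta> + 1) + c * x\<^sup>2 * f x) - (g x powr (\<theta> + 1) / (\<theta> + 1) + c * x\<^sup>2 * g x))
        has_integral PF f - PF g) (cbox (-R) R)"
        using I[of f] I[of g] cf cg fg by (auto intro!: has_integral_diff)
      fix x assume x: "x \<in> cbox (-R) R"
      have "\<bar>f x powr (\<theta> + 1) - g x powr (\<theta> + 1)\<bar> < (\<theta> + 1) * q"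
        using fg[of x] x by (intro d) (auto simp: d'_def)
      then have 1: "\<bar>(f x powr (\<theta> + 1) - g x powr (\<theta> + 1)) / (\<theta> + 1)\<bar> \<le> q"
        using params by (simp add: field_simps)
      have "x\<^sup>2 \<le> R\<^sup>2" using x by (auto simp: abs_le_square_iff[symmetric])
      then have "c * x\<^sup>2 * \<bar>f x - g x\<bar> \<le> (c * R\<^sup>2) * (q / (c * R\<^sup>2))"
        using fg[of x] x params d' by (intro mult_mono) (auto simp: d'_def)
      then have 2: "\<bar>c * x\<^sup>2 * (f x - g x)\<bar> \<le> q"
        using params by (simp add: abs_mult)
      have "(f x powr (\<theta> + 1) / (\<theta> + 1) + c * x\<^sup>2 * f x) - (g x powr (\<theta> + 1) / (\<theta> + 1) + c * x\<^sup>2 * g x)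
        = (f x powr (\<theta> + 1) - g x powr (\<theta> + 1)) / (\<theta> + 1) + c * x\<^sup>2 * (f x - g x)"
        by (simp add: diff_divide_distrib algebra_simps)
      then show "norm ((f x powr (\<theta> + 1) / (\<theta> + 1) + c * x\<^sup>2 * f x) - (g x powr (\<theta> + 1) / (\<theta> + 1) + c * x\<^sup>2 * g x)) \<le> e'"
        using order_trans[OF abs_triangle_ineq add_mono[OF 1 2]] by (simp add: q_def)
    qed (use q in \<open>simp add: q_def\<close>)
    then show "\<bar>PF f - PF g\<bar> \<le> e" using params by (simp add: e'_def)
  qed
qed

lemma D_nonneg: "T0 < t \<Longrightarrow> 0 \<le> D t"
  unfolding D_def
  by (intro integral_nonneg integrable_continuous_real cont slices) (use mu_nonneg in auto)

lemma D_le: "T0 < t \<Longrightarrow> D t \<le> 2 * R * Mb * W\<^sup>2"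
proof -
  assume t: "T0 < t"
  have "D t \<le> integral {-R..R} (\<lambda>_. Mb * W\<^sup>2)"
    unfolding D_def
  proof (rule integral_le)
    fix x
    show "\<mu> x t * (p x t)\<^sup>2 \<le> Mb * W\<^sup>2"
    proof (cases "0 < \<mu> x t")
      case True
      then have "(p x t)\<^sup>2 \<le> W\<^sup>2" using p_bd[OF t True] by (metis abs_le_square_iff abs_of_nonneg params(5))
      then show ?thesis using mu_bd[of t x] True t by (intro mult_mono) auto
    next
      case False
      then have "\<mu> x t = 0" using mu_nonneg[of t x] t by simp
      moreover have "0 \<le> Mb" using mu_nonneg[of t x] mu_bd[of t x] t by simp
      ultimately show ?thesis by simp
    qed
  qed (use t in \<open>auto intro!: integrable_continuous_real cont slices\<close>)
  then show ?thesis using params by (simp add: mult.commute mult.left_commute)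
qed

lemma Pot_bounded: "\<exists>b. \<forall>t>T0. Pot t \<le> b"
proof (intro exI allI impI)
  fix t assume t: "T0 < t"
  have "Pot t \<le> integral {-R..R} (\<lambda>_. Mb powr (\<theta> + 1) / (\<theta> + 1) + c * R\<^sup>2 * Mb)"
    unfolding Pot_def
  proof (rule integral_le)
    fix x assume x: "x \<in> {-R..R}"
    have "x\<^sup>2 \<le> R\<^sup>2" using x by (auto simp: abs_le_square_iff[symmetric])
    then show "\<mu> x t powr (\<theta> + 1) / (\<theta> + 1) + c * x\<^sup>2 * \<mu> x t \<le> Mb powr (\<theta> + 1) / (\<theta> + 1) + c * R\<^sup>2 * Mb"
      using mu_bd[of t x] mu_nonneg[of t x] t params
      by (intro add_mono divide_right_mono powr_mono2 mult_mono) auto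
  qed (use t params in \<open>auto intro!: integrable_continuous_real cont slices\<close>)
  then show "Pot t \<le> integral {-R..R} (\<lambda>_. Mb powr (\<theta> + 1) / (\<theta> + 1) + c * R\<^sup>2 * Mb)" .
qed

lemma En_antimono:
  assumes "T0 < s" "s \<le> t"
  shows "En t \<le> En s"
proof (cases "s = t")
  case False
  have "0 \<le> integral {s..t} D"
    using assms by (intro integral_nonneg integrable_continuous_real continuous_on_subset[OF cD] D_nonneg) auto
  then have "0 \<le> k * integral {s..t} D" using params by simp
  then show ?thesis using En_diff[of s t] assms False by linarith
qed simp

lemma mass_const:
  assumes "T0 \<le> t"
  shows "N R t = N R T0"
proof (cases "t = T0")
  case False
  show ?thesis
  proof (rule DERIV_isconst_end[of T0 t "N R"])
    show "continuous_on {T0..t} (N R)"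
      unfolding N_def[abs_def]
      by (rule continuous_on_subset[OF continuous_on_integral_slice[OF cmu0]]) auto
    show "(N R has_real_derivative 0) (at x)" if "T0 < x" "x < t" for x
      using flux[OF that(1), of R] mu_supp[of x R] that params by (simp add: N_def[abs_def])
  qed (use False \<open>T0 \<le> t\<close> in auto)
qed simp

end

locale rescaled_flow_uc = rescaled_flow +
  assumes uc: "uniformly_continuous_on (UNIV \<times> {T0<..}) (\<lambda>(x, t). \<mu> x t)"
    and mass_pos: "0 < N R T0"
begin

lemma mu_equicont:
  assumes "0 < e"
  obtains d where "0 < d" "\<And>x y s t. T0 < s \<Longrightarrow> T0 < t \<Longrightarrow> \<bar>x - y\<bar> < d \<Longrightarrow> \<bar>s - t\<bar> < d \<Longrightarrow> \<bar>\<mu> x s - \<mu> y t\<bar> < e"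
proof -
  obtain d where d: "0 < d" "\<And>z z'. z \<in> UNIV \<times> {T0<..} \<Longrightarrow> z' \<in> UNIV \<times> {T0<..} \<Longrightarrow> dist z' z < d \<Longrightarrow>
     dist ((\<lambda>(x, t). \<mu> x t) z') ((\<lambda>(x, t). \<mu> x t) z) < e"
    using uc assms unfolding uniformly_continuous_on_def by metis
  show ?thesis
  proof (rule that[of "d / 2"])
    fix x y s t assume st: "T0 < s" "T0 < t" "\<bar>x - y\<bar> < d / 2" "\<bar>s - t\<bar> < d / 2"
    have "dist (x, s) (y, t) \<le> dist x y + dist s t"
      unfolding dist_Pair_Pair by (rule sqrt_sum_squares_le_sum) auto
    also have "\<dots> < d" using st by (simp add: dist_real_def)
    finally show "\<bar>\<mu> x s - \<mu> y t\<bar> < e"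
      using d(2)[of "(y, t)" "(x, s)"] st by (simp add: dist_real_def)
  qed (use d in simp)
qed

text \<open>A Barbalat argument. No modulus of continuity in time is known for \<open>p\<close>, but
  D = 2 (En + Pot), where \<open>Pot\<close> is uniformly continuous because \<open>\<mu>\<close>
  is, and \<open>En\<close> is Lipschitz because \<open>D\<close> is bounded. So a large value of
  \<open>D\<close> persists over a window of fixed length and costs a fixed amount of energy, which
  is impossible near the infimum.\<close>

lemma D_tendsto_0: "(D \<longlongrightarrow> 0) at_top"
proof (rule order_tendstoI)
  fix a :: real assume "a < 0"
  then show "\<forall>\<^sub>F t in at_top. a < D t"
    by (intro eventually_mono[OF eventually_gt_at_top[of T0]]) (use D_nonneg in force)
next
  fix e :: real assume e: "0 < e"
  obtain d1 where d1: "0 < d1" "\<And>f g. continuous_on {-R..R} f \<Longrightarrow> continuous_on {-R..R} g \<Longrightarrow>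
    (\<And>x. x \<in> {-R..R} \<Longrightarrow> 0 \<le> f x \<and> f x \<le> Mb \<and> 0 \<le> g x \<and> g x \<le> Mb \<and> \<bar>f x - g x\<bar> < d1) \<Longrightarrow> \<bar>PF f - PF g\<bar> \<le> e / 8"
    using PF_close[of "e / 8"] e by auto
  obtain d2 where d2: "0 < d2" "\<And>x y s t. T0 < s \<Longrightarrow> T0 < t \<Longrightarrow> \<bar>x - y\<bar> < d2 \<Longrightarrow> \<bar>s - t\<bar> < d2 \<Longrightarrow> \<bar>\<mu> x s - \<mu> y t\<bar> < d1"
    using mu_equicont[OF d1(1)] by blast
  have Pc: "\<bar>Pot t - Pot s\<bar> \<le> e / 8" if "T0 < s" "T0 < t" "\<bar>s - t\<bar> < d2" for s t
    unfolding Pot_eq using d2 that by (intro d1(2) slices) (auto intro: mu_nonneg mu_bd)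
  define Dm where "Dm = 2 * R * Mb * W\<^sup>2"
  have Dm: "0 \<le> Dm" using D_le[of "T0 + 1"] D_nonneg[of "T0 + 1"] unfolding Dm_def by linarith
  \<comment> \<open>Over a window of length \<open>d\<close> both \<open>Pot\<close> and
    \<open>En\<close> vary by at most e / 8, hence \<open>D\<close> drops by at most e / 2. The
    summand 1 guards against a vanishing bound \<open>Dm\<close>.\<close>
  define d where "d = min (d2 / 2) (e / (8 * k * (Dm + 1)))"
  have d: "0 < d" "d < d2" "k * Dm * d \<le> e / 8"
  proof -
    show "0 < d" "d < d2" using d2 e params Dm by (auto simp: d_def)
    have "k * Dm * d \<le> k * (Dm + 1) * (e / (8 * k * (Dm + 1)))"
      using params Dm \<open>0 < d\<close> by (intro mult_mono) (auto simp: d_def)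
    also have "\<dots> = (k * (Dm + 1)) * e / ((k * (Dm + 1)) * 8)" by (simp add: ac_simps)
    also have "\<dots> = e / 8" using params Dm by (intro mult_divide_mult_cancel_left) auto
    finally show "k * Dm * d \<le> e / 8" .
  qed
  define l where "l = Inf (En ` {T0<..})"
  have bdd: "bdd_below (En ` {T0<..})"
  proof -
    obtain b where b: "\<forall>t>T0. Pot t \<le> b" using Pot_bounded by blast
    show ?thesis by (rule bdd_belowI2[of _ "-b"]) (use b D_nonneg in \<open>force simp: En_def\<close>)
  qed
  have lb: "l \<le> En t" if "T0 < t" for t
    unfolding l_def by (rule cInf_lower) (use that bdd in auto)
  \<comment> \<open>From \<open>T1\<close> on the energy can lose less than k d e / 4, whereas D t
    \<ge> e would cost at least k d e / 2 over the window.\<close>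
  have "Inf (En ` {T0<..}) < l + k * d * e / 4" using d e params by (simp add: l_def)
  then obtain T1 where T1: "T0 < T1" "En T1 < l + k * d * e / 4"
    by (subst (asm) cInf_less_iff) (use bdd in auto)
  show "\<forall>\<^sub>F t in at_top. D t < e"
  proof (rule eventually_mono[OF eventually_ge_at_top[of T1]])
    fix t assume t: "T1 \<le> t"
    have ii: "D integrable_on {s..s'}" if "T0 < s" for s s'
      by (intro integrable_continuous_real continuous_on_subset[OF cD]) (use that in auto)
    have "D t - e / 2 \<le> D s" if s: "s \<in> {t..t+d}" for s
    proof -
      have "En t - En s \<le> k * Dm * d"
      proof (cases "t = s")
        case False
        have "integral {t..s} D \<le> integral {t..s} (\<lambda>_. Dm)"
          using s t T1 D_le by (intro integral_le ii) (auto simp: Dm_def)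
        also have "\<dots> \<le> Dm * d" using s Dm by (simp add: mult.commute mult_left_mono)
        finally have "k * integral {t..s} D \<le> k * (Dm * d)" using params by simp
        then show ?thesis using En_diff[of t s] False s t T1 by auto
      qed (use Dm params d in auto)
      moreover have "\<bar>Pot t - Pot s\<bar> \<le> e / 8" using s t T1 d by (intro Pc) auto
      ultimately show ?thesis using d(3) unfolding En_def by linarith
    qed
    then have "integral {t..t+d} (\<lambda>_. D t - e / 2) \<le> integral {t..t+d} D"
      using t T1 by (intro integral_le ii) auto
    then have "d * (D t - e / 2) \<le> integral {t..t+d} D" using d by simp
    then have "k * (d * (D t - e / 2)) \<le> k * integral {t..t+d} D" using params by simp
    also have "\<dots> = En t - En (t + d)" using En_diff[of t "t + d"] t T1 d by simp
    also have "\<dots> < k * d * e / 4" using lb[of "t + d"] En_antimono[of T1 t] T1 t d by simp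
    finally have "(k * d) * (D t - e / 2) < (k * d) * (e / 4)" by (simp add: algebra_simps)
    then have "D t - e / 2 < e / 4" using params d by (subst (asm) mult_less_cancel_left_pos) auto
    then show "D t < e" using e by simp
  qed
qed

section \<open>Limit profiles along sequences of times\<close>

lemma limit_exists:
  obtains M \<tau> where "filterlim \<tau> at_top sequentially" "continuous_on UNIV M"
    "\<And>x. 0 \<le> M x" "\<And>x. M x \<le> Mb" "\<And>x. R \<le> \<bar>x\<bar> \<Longrightarrow> M x = 0" "\<And>n. T0 < \<tau> n"
    "\<And>e. 0 < e \<Longrightarrow> \<forall>\<^sub>F n in sequentially. \<forall>x. \<bar>\<mu> x (\<tau> n) - M x\<bar> < e"
proof -
  define F where "F n x = \<mu> x (T0 + 1 + real n)" for n x
  obtain g r where g: "continuous_on {-R..R} g" "strict_mono (r :: nat \<Rightarrow> nat)"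
    "\<And>e. 0 < e \<Longrightarrow> \<exists>N. \<forall>n x. n \<ge> N \<and> x \<in> {-R..R} \<longrightarrow> norm (F (r n) x - g x) < e"
  proof (rule Arzela_Ascoli[of "{-R..R}" F Mb])
    show "norm (F n x) \<le> Mb" for n x
      using mu_bd[of "T0 + 1 + real n" x] mu_nonneg[of "T0 + 1 + real n" x] by (simp add: F_def)
    show "\<exists>d>0. \<forall>n y. y \<in> {-R..R} \<and> norm (x - y) < d \<longrightarrow> norm (F n x - F n y) < e"
      if "0 < e" for x e
      using mu_equicont[OF that] unfolding F_def real_norm_def
      by (metis abs_zero add_pos_nonneg diff_self less_add_same_cancel1 add.assoc of_nat_0_le_iff zero_less_one)
  qed auto
  \<comment> \<open>Extension by zero: all slices vanish beyond R, so uniform convergence on [-R, R]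
    is uniform convergence on the line.\<close>
  define M where "M x = (if \<bar>x\<bar> \<le> R then g x else 0)" for x
  define \<tau> where "\<tau> n = T0 + 1 + real (r n)" for n
  have t0: "T0 < \<tau> n" for n by (simp add: \<tau>_def)
  have conv: "\<forall>\<^sub>F n in sequentially. \<forall>x. \<bar>\<mu> x (\<tau> n) - M x\<bar> < e" if e: "0 < e" for e
  proof -
    obtain N where N: "\<forall>n x. n \<ge> N \<and> x \<in> {-R..R} \<longrightarrow> norm (F (r n) x - g x) < e" using g(3)[OF e] by blast
    show ?thesis
      unfolding eventually_sequentially
    proof (intro exI allI impI)
      fix n x assume "N \<le> n"
      then show "\<bar>\<mu> x (\<tau> n) - M x\<bar> < e"
        using N mu_supp[of "\<tau> n" x] t0[of n] e by (cases "\<bar>x\<bar> \<le> R") (auto simp: F_def M_def \<tau>_def abs_le_iff)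
    qed
  qed
  have lim: "(\<lambda>n. \<mu> x (\<tau> n)) \<longlonglongrightarrow> M x" for x
    unfolding tendsto_iff dist_real_def
  proof (intro allI impI)
    fix e :: real assume "0 < e"
    from conv[OF this] show "\<forall>\<^sub>F n in sequentially. \<bar>\<mu> x (\<tau> n) - M x\<bar> < e"
      by (rule eventually_mono) blast
  qed
  show ?thesis
  proof (rule that[of \<tau> M])
    show "filterlim \<tau> at_top sequentially"
      unfolding \<tau>_def
      by (intro filterlim_tendsto_add_at_top[OF tendsto_const] filterlim_compose[OF filterlim_real_sequentially]
          filterlim_subseq g)
    show "continuous_on UNIV M"
    proof (rule uniform_limit_theorem)
      show "uniform_limit UNIV (\<lambda>n x. \<mu> x (\<tau> n)) M sequentially"
        unfolding uniform_limit_iff dist_real_def using conv by auto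
    qed (use t0 in \<open>auto intro!: slices always_eventually\<close>)
    show "0 \<le> M x" for x
      by (rule tendsto_lowerbound[OF lim]) (use mu_nonneg[OF less_imp_le[OF t0]] in auto)
    show "M x \<le> Mb" for x
      by (rule tendsto_upperbound[OF lim]) (use mu_bd[OF less_imp_le[OF t0]] in auto)
    show "M x = 0" if "R \<le> \<bar>x\<bar>" for x
    proof -
      have "(\<lambda>n. \<mu> x (\<tau> n)) = (\<lambda>_. 0)" using that t0 by (auto intro!: ext mu_supp less_imp_le)
      then show ?thesis using lim[of x] by (simp add: LIMSEQ_const_iff)
    qed
  qed (use t0 conv in auto)
qed

text \<open>Either \<bar>p\<bar> \<le> e, or \<bar>p\<bar> \<le> p^2 / e \<le> \<mu> p^2 / (d' e)
  where \<mu> \<ge> d'. Integrating the sum of the two bounds controls the oscillation of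
  \<open>w\<close> by the length times e plus D / (d' e).\<close>

lemma w_osc:
  assumes t: "T0 < t" and d: "0 < d" "0 < e" and mu: "\<And>x. x \<in> {y - d..y + d} \<Longrightarrow> d' \<le> \<mu> x t" "0 < d'"
    and Dt: "D t \<le> d' * e * e'" "2 * d * e + e' \<le> q" and ab: "a \<in> {y - d..y + d}" "b \<in> {y - d..y + d}"
  shows "\<bar>w b t - w a t\<bar> \<le> q"
proof -
  have sub: "{y - d..y + d} \<subseteq> {-R..R}"
  proof
    fix x assume "x \<in> {y - d..y + d}"
    then have "\<mu> x t \<noteq> 0" using mu by force
    then show "x \<in> {-R..R}" using mu_supp[of t x] t by force
  qed
  have *: "w b t - w a t \<le> q \<and> w a t - w b t \<le> q" if ab: "a \<in> {y - d..y + d}" "b \<in> {y - d..y + d}" "a \<le> b" for a b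
  proof -
    have pt: "\<bar>p x t\<bar> \<le> e + \<mu> x t * (p x t)\<^sup>2 / (d' * e)" if "x \<in> {a..b}" for x
    proof (cases "\<bar>p x t\<bar> \<le> e")
      case True
      moreover have "0 \<le> \<mu> x t * (p x t)\<^sup>2 / (d' * e)"
        using mu_nonneg[of t x] t mu(2) d by simp
      ultimately show ?thesis by simp
    next
      case False
      have "d' * e * \<bar>p x t\<bar> \<le> \<mu> x t * (\<bar>p x t\<bar> * \<bar>p x t\<bar>)"
        unfolding mult.assoc using mu(1)[of x] mu(2) d False that ab
        by (intro mult_mono) auto
      then have "\<bar>p x t\<bar> \<le> \<mu> x t * (p x t)\<^sup>2 / (d' * e)"
        using mu(2) d by (simp add: pos_le_divide_eq power2_eq_square mult_ac)
      then show ?thesis using d by simp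
    qed
    have i1: "(\<lambda>x. e + \<mu> x t * (p x t)\<^sup>2 / (d' * e)) integrable_on {a..b}"
      using mu(2) d t by (intro integrable_continuous_real cont slices) auto
    have i2: "(\<lambda>x. \<mu> x t * (p x t)\<^sup>2) integrable_on S" if "S = {a..b} \<or> S = {-R..R}" for S
      using that t by (auto intro!: integrable_continuous_real cont slices)
    have "((\<lambda>x. p x t) has_integral (w b t - w a t)) {a..b}"
      by (rule fundamental_theorem_of_calculus)
        (use that t in \<open>auto simp: has_real_derivative_iff_has_vector_derivative[symmetric] intro!: has_field_derivative_at_within dw_x\<close>)
    then have eq: "integral {a..b} (\<lambda>x. p x t) = w b t - w a t" by (rule integral_unique)
    have "norm (integral {a..b} (\<lambda>x. p x t)) \<le> integral {a..b} (\<lambda>x. e + \<mu> x t * (p x t)\<^sup>2 / (d' * e))"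
      by (rule integral_norm_bound_integral) (use t pt i1 in \<open>auto intro!: integrable_continuous_real slices\<close>)
    also have "\<dots> = (b - a) * e + integral {a..b} (\<lambda>x. \<mu> x t * (p x t)\<^sup>2) / (d' * e)"
      using that i2[of "{a..b}"]
      by (subst Henstock_Kurzweil_Integration.integral_add) (auto intro: integrable_on_divide)
    also have "\<dots> \<le> 2 * d * e + D t / (d' * e)"
    proof (intro add_mono mult_right_mono divide_right_mono)
      show "integral {a..b} (\<lambda>x. \<mu> x t * (p x t)\<^sup>2) \<le> D t"
        unfolding D_def
      proof (rule integral_subset_le)
        show "{a..b} \<subseteq> {-R..R}" using sub that by auto
      qed (use i2 mu_nonneg t in auto)
    qed (use that d mu(2) in auto)
    also have "D t / (d' * e) \<le> e'"
      using Dt(1) d mu(2) by (simp add: divide_le_eq mult_ac)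
    finally have "\<bar>w b t - w a t\<bar> \<le> q" using Dt(2) eq by simp
    then show ?thesis by auto
  qed
  show ?thesis
    using *[of a b] *[of b a] ab by (cases "a \<le> b") auto
qed

text \<open>The pressure \<open>M\<^sup>\<theta> + c x\<^sup>2\<close> of a limit cannot differ at two nearby points: the difference would make the
  increment of \<open>w\<close> between them drift in time, whereas \<open>D \<longlongrightarrow> 0\<close> makes that increment small.\<close>

lemma pressure_locally_constant:
  assumes tau: "filterlim \<tau> at_top sequentially" "\<And>n. T0 < \<tau> n"
    and M: "continuous_on UNIV M" "\<And>x. 0 \<le> M x" "\<And>x. M x \<le> Mb"
    and conv: "\<And>e. 0 < e \<Longrightarrow> \<forall>\<^sub>F n in sequentially. \<forall>x. \<bar>\<mu> x (\<tau> n) - M x\<bar> < e"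
    and y: "0 < M y"
  shows "\<exists>d>0. \<forall>a\<in>{y - d..y + d}. \<forall>b\<in>{y - d..y + d}. M a powr \<theta> + c * a\<^sup>2 \<le> M b powr \<theta> + c * b\<^sup>2"
proof -
  define P where "P x = M x powr \<theta> + c * x\<^sup>2" for x
  have cP: "continuous_on UNIV P"
    unfolding P_def by (intro cont continuous_on_powr' M(1)) (use M params in auto)
  \<comment> \<open>Near y the limit exceeds 2 d', and densities closer than d' to it exceed d',
    which is the lower bound that \<open>w_osc\<close> asks for.\<close>
  define d' where "d' = M y / 4"
  have d': "0 < d'" using y by (simp add: d'_def)
  obtain d where d: "0 < d" "\<And>x. \<bar>x - y\<bar> < 3 * d \<Longrightarrow> \<bar>M x - M y\<bar> < 2 * d'"
  proof -
    obtain s where "s > 0" "\<And>x. \<bar>x - y\<bar> < s \<Longrightarrow> \<bar>M x - M y\<bar> < 2 * d'"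
      using M(1) d' unfolding continuous_on_iff dist_real_def
      by (metis UNIV_I mult_pos_pos zero_less_numeral)
    then show ?thesis by (intro that[of "s / 3"]) auto
  qed
  have Mge: "2 * d' \<le> M x" if "x \<in> {y - 2 * d..y + 2 * d}" for x
  proof -
    have "\<bar>x - y\<bar> < 3 * d" using that d(1) by auto
    from d(2)[OF this] show ?thesis unfolding d'_def by linarith
  qed
  have "P a \<le> P b" if ab: "a \<in> {y - d..y + d}" "b \<in> {y - d..y + d}" for a b
  proof (rule ccontr)
    assume "\<not> P a \<le> P b"
    define e where "e = (P a - P b) / 4"
    have e: "0 < e" using \<open>\<not> P a \<le> P b\<close> by (simp add: e_def)
    have "continuous_on UNIV (\<lambda>x. P (a + x) - P (b + x))"
      by (intro continuous_intros continuous_on_compose2[OF cP]) auto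
    then obtain l0 where l0: "0 < l0" "\<And>x. \<bar>x\<bar> < l0 \<Longrightarrow> \<bar>P (a + x) - P (b + x) - (P (a + 0) - P (b + 0))\<bar> < e"
      using e unfolding continuous_on_iff dist_real_def by (metis UNIV_I diff_0_right)
    \<comment> \<open>The bound by \<open>l0\<close> keeps the pressure gap above 3 e for all shifts
      in [0, l]; the bound by \<open>d\<close> keeps the shifted points within 2 d of y.\<close>
    define l where "l = min d (l0 / 2)"
    have l: "0 < l" "l \<le> d" "l < l0" using l0 d by (auto simp: l_def)
    have Pl: "3 * e \<le> P (a + x) - P (b + x)" if "x \<in> {0..l}" for x
    proof -
      have "\<bar>x\<bar> < l0" using that l by auto
      from l0(2)[OF this] have "\<bar>P (a + x) - P (b + x) - (P a - P b)\<bar> < e" by simp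
      moreover have "P a - P b = 4 * e" by (simp add: e_def)
      ultimately show ?thesis by linarith
    qed
    obtain \<kappa> where \<kappa>: "0 < \<kappa>" "\<And>x y. 0 \<le> x \<Longrightarrow> x \<le> Mb \<Longrightarrow> 0 \<le> y \<Longrightarrow> y \<le> Mb \<Longrightarrow> \<bar>x - y\<bar> < \<kappa> \<Longrightarrow> \<bar>x powr \<theta> - y powr \<theta>\<bar> < e"
      using uniformly_continuous_powr[of \<theta> e Mb] params e by auto
    \<comment> \<open>Half for the distance of the slice at the chosen time from \<open>M\<close>,
      half for the drift of the density during the window of length \<sigma>.\<close>
    define \<kappa>' where "\<kappa>' = min \<kappa> d' / 2"
    have k': "0 < \<kappa>'" using \<kappa> d' by (simp add: \<kappa>'_def)
    obtain \<sigma>0 where s0: "0 < \<sigma>0" "\<And>x y s t. T0 < s \<Longrightarrow> T0 < t \<Longrightarrow> \<bar>x - y\<bar> < \<sigma>0 \<Longrightarrow> \<bar>s - t\<bar> < \<sigma>0 \<Longrightarrow> \<bar>\<mu> x s - \<mu> y t\<bar> < \<kappa>'"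
      using mu_equicont[OF k'] by blast
    define \<sigma> where "\<sigma> = \<sigma>0 / 2"
    have s: "0 < \<sigma>" "\<sigma> < \<sigma>0" using s0 by (auto simp: \<sigma>_def)
    \<comment> \<open>The contradiction sought is \<sigma> (l e - k q l - q / 2) \<le> 2 q l: the
      drift over the window against twice the bound on the increment. Solving for q gives the
      denominator, and the factor 2 makes the inequality strict.\<close>
    define q where "q = \<sigma> * l * e / (2 * (2 * l + \<sigma> * l * k + \<sigma>))"
    have den: "0 < 2 * l + \<sigma> * l * k + \<sigma>" using l s params by (intro add_pos_pos mult_pos_pos) auto
    have q: "0 < q" "q * (2 * l + \<sigma> * l * k + \<sigma>) < \<sigma> * l * e"
    proof -
      have slE: "0 < \<sigma> * l * e" using s l e by (intro mult_pos_pos)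
      then show "0 < q" using den unfolding q_def by (intro divide_pos_pos[of "\<sigma> * l * e"]) auto
      have "S / (2 * E) * E = S / 2" if "0 < E" for S E :: real using that by simp
      from this[OF den] have "q * (2 * l + \<sigma> * l * k + \<sigma>) = \<sigma> * l * e / 2" unfolding q_def .
      then show "q * (2 * l + \<sigma> * l * k + \<sigma>) < \<sigma> * l * e" using slE by linarith
    qed
    define e1 where "e1 = q / (8 * d)"
    \<comment> \<open>Two requirements on the size of \<open>D\<close>: the first yields oscillation
      at most q through \<open>w_osc\<close>, the second bounds the integral of p^2 by q.\<close>
    define Db where "Db = min (d' * e1 * (q / 2)) (d' * q)"
    have e1: "0 < e1" "0 < Db" using q d d' by (auto simp: e1_def Db_def)
    have "\<forall>\<^sub>F t in at_top. D t < Db"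
      using order_tendstoD(2)[OF D_tendsto_0 e1(2)] .
    then obtain T where T: "\<And>t. T \<le> t \<Longrightarrow> D t < Db" unfolding eventually_at_top_linorder by blast
    have "\<forall>\<^sub>F n in sequentially. (\<forall>x. \<bar>\<mu> x (\<tau> n) - M x\<bar> < \<kappa>') \<and> T \<le> \<tau> n"
      using conv[OF k'] tau(1) unfolding filterlim_at_top by (auto intro: eventually_conj)
    from eventually_happens'[OF sequentially_bot this]
    obtain n where n: "\<And>x. \<bar>\<mu> x (\<tau> n) - M x\<bar> < \<kappa>'" "T \<le> \<tau> n" by blast
    define s1 where "s1 = \<tau> n"
    have s1: "T0 < s1" "T \<le> s1" using n tau(2) by (auto simp: s1_def)
    have close: "\<bar>\<mu> x t - M x\<bar> < min \<kappa> d'" if "t \<in> {s1..s1 + \<sigma>}" for x t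
    proof -
      have "\<bar>\<mu> x t - \<mu> x s1\<bar> < \<kappa>'" using that s s1 s0(1) by (intro s0(2)) auto
      moreover have "\<bar>\<mu> x s1 - M x\<bar> < \<kappa>'" using n(1)[of x] by (simp add: s1_def)
      moreover have "2 * \<kappa>' = min \<kappa> d'" by (simp add: \<kappa>'_def)
      ultimately show ?thesis by linarith
    qed
    have muge: "d' \<le> \<mu> x t" if "t \<in> {s1..s1 + \<sigma>}" "x \<in> {y - 2 * d..y + 2 * d}" for x t
      using close[OF that(1), of x] Mge[OF that(2)] by (auto simp: abs_less_iff)
    have osc: "\<bar>w x' t - w x t\<bar> \<le> q" if "t \<in> {s1..s1 + \<sigma>}" "x \<in> {y - 2 * d..y + 2 * d}" "x' \<in> {y - 2 * d..y + 2 * d}" for x x' t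
    proof (rule w_osc[where d = "2 * d" and e = e1 and d' = d' and e' = "q / 2"])
      show "D t \<le> d' * e1 * (q / 2)" using T[of t] that s1 by (auto simp: Db_def)
      show "2 * (2 * d) * e1 + q / 2 \<le> q" using d by (simp add: e1_def)
    qed (use that s1 d e1 d' muge in auto)
    have ablm: "a + x \<in> {y - 2 * d..y + 2 * d} \<and> b + x \<in> {y - 2 * d..y + 2 * d}" if "x \<in> {0..l}" for x
      using ab that l by auto
    \<comment> \<open>The increment is averaged over shifts in [0, l] because a small
      \<open>D\<close> controls p^2 only in the mean. By the Hamilton-Jacobi equation the average
      drifts upward at speed about l e, since the pressure at a + x exceeds that at b + x.\<close>
    define A where "A t = integral {0..l} (\<lambda>x. w (b + x) t - w (a + x) t)" for t
    define A' where "A' t = integral {0..l} (\<lambda>x. z (b + x) t - z (a + x) t)" for t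
    have cs: "continuous_on {0..l} (\<lambda>x. f (a + x) t)"
      if "T0 < t" "continuous_on (UNIV \<times> {T0<..}) (\<lambda>(x, t). f x t)" for f :: "real \<Rightarrow> real \<Rightarrow> real" and a t
      by (rule continuous_on_compose2[OF continuous_on_slice(1)[OF that(2), of t UNIV]])
        (use that in \<open>auto intro!: continuous_intros\<close>)
    have dA: "(A has_real_derivative A' t) (at t)" if "T0 < t" for t
    proof -
      have "((\<lambda>t. integral (cbox 0 l) (\<lambda>x. w (b + x) t - w (a + x) t)) has_real_derivative
         integral (cbox 0 l) (\<lambda>x. z (b + x) t - z (a + x) t)) (at t within {T0<..})"
      proof (rule leibniz_rule_field_derivative[where fx = "\<lambda>t x. z (b + x) t - z (a + x) t"])
        show "((\<lambda>t. w (b + x) t - w (a + x) t) has_real_derivative z (b + x) t - z (a + x) t) (at t within {T0<..})"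
          if "t \<in> {T0<..}" for x t
          using that by (intro DERIV_diff has_field_derivative_at_within[OF dw_t]) auto
        show "(\<lambda>x. w (b + x) t - w (a + x) t) integrable_on cbox 0 l" if "t \<in> {T0<..}" for t
          unfolding box_real using that by (intro integrable_continuous_real cont cs[of _ w] cw) auto
        have "continuous_on ({T0<..} \<times> cbox 0 l) (\<lambda>y. (\<lambda>(x, t). z x t) (b + snd y, fst y) - (\<lambda>(x, t). z x t) (a + snd y, fst y))"
          by (intro continuous_intros continuous_on_compose2[OF cz]) auto
        then show "continuous_on ({T0<..} \<times> cbox 0 l) (\<lambda>(t, x). z (b + x) t - z (a + x) t)"
          by (simp add: split_beta)
      qed (use that in auto)
      then show ?thesis using that by (simp add: A_def[abs_def] A'_def at_within_open[of _ "{T0<..}"])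
    qed
    have Ab: "\<bar>A t\<bar> \<le> q * l" if t: "t \<in> {s1..s1 + \<sigma>}" for t
    proof -
      have "norm (A t) \<le> q * (l - 0)"
        unfolding A_def
      proof (rule integral_bound)
        show "continuous_on {0..l} (\<lambda>x. w (b + x) t - w (a + x) t)"
          using t s1 by (intro cont cs[of _ w] cw) auto
        show "norm (w (b + x) t - w (a + x) t) \<le> q" if "x \<in> {0..l}" for x
          unfolding real_norm_def using ablm[OF that] by (intro osc[OF t]) auto
      qed (use l in auto)
      then show ?thesis by simp
    qed
    have sq: "integral {0..l} (\<lambda>x. (p (a + x) t)\<^sup>2) \<le> q" "(\<lambda>x. (p (a + x) t)\<^sup>2) integrable_on {0..l}"
      "integral {0..l} (\<lambda>x. (p (b + x) t)\<^sup>2) \<le> q" "(\<lambda>x. (p (b + x) t)\<^sup>2) integrable_on {0..l}"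
      if t: "t \<in> {s1..s1 + \<sigma>}" for t
    proof -
      have *: "integral {0..l} (\<lambda>x. (p (a + x) t)\<^sup>2) \<le> q \<and> (\<lambda>x. (p (a + x) t)\<^sup>2) integrable_on {0..l}"
        if a: "\<And>x. x \<in> {0..l} \<Longrightarrow> a + x \<in> {y - 2 * d..y + 2 * d}" for a
      proof
        have Rab: "{a..a + l} \<subseteq> {-R..R}"
        proof
          fix x assume "x \<in> {a..a + l}"
          then have "x \<in> {y - 2 * d..y + 2 * d}" using a[of "x - a"] by auto
          then have "\<mu> x t \<noteq> 0" using muge[OF t] d' by force
          then show "x \<in> {-R..R}" using mu_supp[of t x] t s1 by force
        qed
        have "((\<lambda>x. (p x t)\<^sup>2) has_integral integral {a..a+l} (\<lambda>x. (p x t)\<^sup>2)) (cbox a (a + l))"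
          unfolding box_real using t s1 by (intro integrable_integral integrable_continuous_real cont slices) auto
        from has_integral_affinity'[OF this, of 1 a]
        have h: "((\<lambda>x. (p (a + x) t)\<^sup>2) has_integral integral {a..a+l} (\<lambda>x. (p x t)\<^sup>2)) {0..l}"
          by (simp add: add.commute)
        then show "(\<lambda>x. (p (a + x) t)\<^sup>2) integrable_on {0..l}" by blast
        have "integral {a..a+l} (\<lambda>x. (p x t)\<^sup>2) \<le> integral {a..a+l} (\<lambda>x. \<mu> x t * (p x t)\<^sup>2 / d')"
        proof (rule integral_le)
          fix x assume "x \<in> {a..a+l}"
          then have "x \<in> {y - 2 * d..y + 2 * d}" using a[of "x - a"] by auto
          then have "d' * (p x t)\<^sup>2 \<le> \<mu> x t * (p x t)\<^sup>2" using muge[OF t] by (intro mult_right_mono) auto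
          then show "(p x t)\<^sup>2 \<le> \<mu> x t * (p x t)\<^sup>2 / d'" using d' by (simp add: pos_le_divide_eq mult.commute)
        qed (use t s1 d' in \<open>auto intro!: integrable_continuous_real cont slices\<close>)
        also have "\<dots> = integral {a..a+l} (\<lambda>x. \<mu> x t * (p x t)\<^sup>2) / d'" by simp
        also have "\<dots> \<le> D t / d'"
        proof (rule divide_right_mono)
          show "integral {a..a+l} (\<lambda>x. \<mu> x t * (p x t)\<^sup>2) \<le> D t"
            unfolding D_def
            by (rule integral_subset_le[OF Rab]) (use t s1 mu_nonneg in \<open>auto intro!: integrable_continuous_real cont slices\<close>)
        qed (use d' in auto)
        also have "\<dots> \<le> q"
          using T[of t] t s1 d' by (auto simp: Db_def divide_le_eq mult.commute)
        finally show "integral {0..l} (\<lambda>x. (p (a + x) t)\<^sup>2) \<le> q"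
          using integral_unique[OF h] by simp
      qed
      show "integral {0..l} (\<lambda>x. (p (a + x) t)\<^sup>2) \<le> q" "(\<lambda>x. (p (a + x) t)\<^sup>2) integrable_on {0..l}"
        "integral {0..l} (\<lambda>x. (p (b + x) t)\<^sup>2) \<le> q" "(\<lambda>x. (p (b + x) t)\<^sup>2) integrable_on {0..l}"
        using *[of a] *[of b] ablm by auto
    qed
    have A'b: "l * e - k * q * l - q / 2 \<le> A' t" if t: "t \<in> {s1..s1 + \<sigma>}" for t
    proof -
      have "((\<lambda>x. - k * q + e - (p (a + x) t)\<^sup>2 / 2) has_integral
        (l * (- k * q + e)) - integral {0..l} (\<lambda>x. (p (a + x) t)\<^sup>2) / 2) {0..l}"
        using sq(2)[OF t] has_integral_const_real[of "- k * q + e" 0 l] l(1)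
        by (intro has_integral_diff has_integral_divide integrable_integral) auto
      moreover have "((\<lambda>x. z (b + x) t - z (a + x) t) has_integral A' t) {0..l}"
        unfolding A'_def using t s1 by (intro integrable_integral integrable_continuous_real cont cs[of _ z] cz) auto
      moreover have "- k * q + e - (p (a + x) t)\<^sup>2 / 2 \<le> z (b + x) t - z (a + x) t" if x: "x \<in> {0..l}" for x
      proof -
        have T0t: "T0 < t" using t s1 by auto
        have pc: "\<bar>\<mu> x' t powr \<theta> - M x' powr \<theta>\<bar> < e" for x'
          using close[OF t, of x'] M mu_nonneg[of t x'] mu_bd[of t x'] T0t by (intro \<kappa>) auto
        have "k * \<bar>w (b + x) t - w (a + x) t\<bar> \<le> k * q"
          using ablm[OF x] params by (intro mult_left_mono osc[OF t]) auto
        moreover have "k * (w (b + x) t - w (a + x) t) \<le> k * \<bar>w (b + x) t - w (a + x) t\<bar>"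
          using params by (intro mult_left_mono) auto
        moreover have "0 \<le> (p (b + x) t)\<^sup>2" by simp
        ultimately show ?thesis
          using Pl[OF x] pc[of "a + x"] pc[of "b + x"] zero_le_power2[of "p (b + x) t"]
          unfolding HJ[OF T0t] P_def right_diff_distrib abs_less_iff by linarith
      qed
      ultimately have "(l * (- k * q + e)) - integral {0..l} (\<lambda>x. (p (a + x) t)\<^sup>2) / 2 \<le> A' t"
        by (rule has_integral_le)
      then show ?thesis using sq(1)[OF t] by (simp add: algebra_simps)
    qed
    obtain \<xi> where xi: "s1 < \<xi>" "\<xi> < s1 + \<sigma>" "A (s1 + \<sigma>) - A s1 = (s1 + \<sigma> - s1) * A' \<xi>"
      using MVT2[of s1 "s1 + \<sigma>" A A'] s dA s1 by auto
    have "\<sigma> * (l * e - k * q * l - q / 2) \<le> \<sigma> * A' \<xi>"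
      using A'b[of \<xi>] xi s by (intro mult_left_mono) auto
    also have "\<dots> = A (s1 + \<sigma>) - A s1" using xi(3) by simp
    also have "\<dots> \<le> 2 * (q * l)" using Ab[of s1] Ab[of "s1 + \<sigma>"] s by auto
    finally have "\<sigma> * l * e \<le> q * (2 * l + \<sigma> * l * k + \<sigma> / 2)" by (simp add: algebra_simps)
    also have "\<dots> \<le> q * (2 * l + \<sigma> * l * k + \<sigma>)" using q(1) s by (intro mult_left_mono) auto
    finally show False using q(2) by simp
  qed
  then show ?thesis using d(1) unfolding P_def by blast
qed

text \<open>Connectedness on the interval where c x^2 < P y: if P x = P y at such a point then M x >
  0, so \<open>loc\<close> keeps the equality nearby; if not, continuity keeps the inequality. Hence
  M^\<theta> follows one parabola until it reaches zero.\<close>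

lemma limit_profile:
  assumes M: "continuous_on UNIV M" "\<And>x. 0 \<le> M x" and pos: "0 < M x0"
    and loc: "\<And>y. 0 < M y \<Longrightarrow> \<exists>d>0. \<forall>a\<in>{y - d..y + d}. \<forall>b\<in>{y - d..y + d}. M a powr \<theta> + c * a\<^sup>2 \<le> M b powr \<theta> + c * b\<^sup>2"
  obtains r where "0 < r" "M = stationary \<theta> c r"
proof -
  define P where "P x = M x powr \<theta> + c * x\<^sup>2" for x
  have cP: "continuous_on UNIV P"
    unfolding P_def by (intro cont continuous_on_powr' M(1)) (use M params in auto)
  have main: "P x = P y" if y: "0 < M y" and x: "c * x\<^sup>2 < P y" for x y
  proof -
    define q where "q = sqrt (P y / c)"
    have Py: "0 < P y" using y params by (simp add: P_def add_pos_nonneg)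
    have inq: "x \<in> {-q<..<q} \<longleftrightarrow> c * x\<^sup>2 < P y" for x
    proof -
      have "c * x\<^sup>2 < P y \<longleftrightarrow> x\<^sup>2 < P y / c" using params by (simp add: field_simps)
      also have "\<dots> \<longleftrightarrow> \<bar>x\<bar> < q" unfolding q_def
        by (metis real_sqrt_abs real_sqrt_less_iff)
      finally show ?thesis by auto
    qed
    have "(P x = P y) = (P y = P y)"
    proof (rule connected_local_const[of "{-q<..<q}" x y "\<lambda>x. P x = P y"])
      show "x \<in> {-q<..<q}" using x inq by blast
      show "y \<in> {-q<..<q}" using y inq params by (simp add: P_def)
      show "\<forall>a\<in>{-q<..<q}. \<forall>\<^sub>F b in at a within {-q<..<q}. (P a = P y) = (P b = P y)"
      proof
        fix a assume a: "a \<in> {-q<..<q}"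
        have "\<forall>\<^sub>F b in nhds a. (P a = P y) = (P b = P y)"
        proof (cases "P a = P y")
          case True
          then have "M a powr \<theta> > 0" using a inq[of a] unfolding P_def by linarith
          then have "0 < M a" using M(2)[of a] by (cases "M a = 0") auto
          from loc[OF this] obtain d where d: "d > 0"
            "\<forall>x\<in>{a - d..a + d}. \<forall>y\<in>{a - d..a + d}. P x \<le> P y" unfolding P_def by blast
          have aa: "a \<in> {a - d..a + d}" using d(1) by simp
          have "P b = P a" if "b \<in> {a - d..a + d}" for b
            using bspec[OF bspec[OF d(2) aa] that] bspec[OF bspec[OF d(2) that] aa] by simp
          note d = d(1) this
          have "\<forall>\<^sub>F b in nhds a. b \<in> {a - d<..<a + d}"
            by (rule eventually_nhds_in_open) (use d in auto)
          then show ?thesis by (rule eventually_mono) (use d(2) True in auto)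
        next
          case False
          have "open {b. P b \<noteq> P y}"
            by (rule open_Collect_neq[OF cP continuous_on_const])
          then have "\<forall>\<^sub>F b in nhds a. b \<in> {b. P b \<noteq> P y}"
            by (rule eventually_nhds_in_open) (use False in auto)
          then show ?thesis by (rule eventually_mono) (use False in auto)
        qed
        then show "\<forall>\<^sub>F b in at a within {-q<..<q}. (P a = P y) = (P b = P y)"
          by (simp add: eventually_at_filter eventually_mono)
      qed
    qed auto
    then show ?thesis by simp
  qed
  have Ppos: "0 < P y" if "0 < M y" for y
    using that params by (simp add: P_def add_pos_nonneg)
  \<comment> \<open>The point 0 belongs to every such interval. All positive points therefore share
    the pressure at 0, and no two components with different heights can coexist.\<close>
  define r where "r = P 0"
  have Pr: "P y = r" if "0 < M y" for y
    using main[OF that, of 0] Ppos[OF that] by (simp add: r_def)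
  have r: "0 < r" using Pr[OF pos] Ppos[OF pos] by simp
  have "M x = stationary \<theta> c r x" for x
    unfolding stationary_def
  proof (rule powr_inverse_iff)
    show "M x powr \<theta> = max 0 (r - c * x\<^sup>2)"
    proof (cases "0 < M x")
      case True
      then have "0 < M x powr \<theta>" by simp
      moreover have "r - c * x\<^sup>2 = M x powr \<theta>" using Pr[OF True] by (simp add: P_def)
      ultimately show ?thesis by simp
    next
      case False
      then have "M x = 0" using M(2)[of x] by simp
      moreover have "r \<le> c * x\<^sup>2"
      proof (rule ccontr)
        assume "\<not> r \<le> c * x\<^sup>2"
        then have "P x = r" using main[OF pos, of x] Pr[OF pos] by simp
        then show False using \<open>M x = 0\<close> \<open>\<not> r \<le> c * x\<^sup>2\<close> by (simp add: P_def)
      qed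
      ultimately show ?thesis by (simp add: max_def)
    qed
  qed (use params M in auto)
  then show ?thesis using that[OF r] by blast
qed

text \<open>Monotonicity gives En t \<ge> En (\<tau> n) \<ge> - Pot (\<tau> n) for late n, and
  \<open>Pot\<close> converges along the sequence. The conserved positive mass passes to the limit,
  which excludes the zero profile and shows that a stationary profile of the prescribed mass
  exists.\<close>

theorem energy_lower_bound:
  obtains r where "0 < r" "integral {-R..R} (stationary \<theta> c r) = N R T0"
    "\<And>x. R \<le> \<bar>x\<bar> \<Longrightarrow> stationary \<theta> c r x = 0"
    "\<And>t. T0 < t \<Longrightarrow> - PF (stationary \<theta> c r) \<le> En t"
proof -
  obtain M \<tau> where M: "filterlim \<tau> at_top sequentially" "continuous_on UNIV M"
    "\<And>x. 0 \<le> M x" "\<And>x. M x \<le> Mb" "\<And>x. R \<le> \<bar>x\<bar> \<Longrightarrow> M x = 0" "\<And>n. T0 < \<tau> n"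
    "\<And>e. 0 < e \<Longrightarrow> \<forall>\<^sub>F n in sequentially. \<forall>x. \<bar>\<mu> x (\<tau> n) - M x\<bar> < e"
    by (rule limit_exists) (rule that)
  have cM: "continuous_on S M" for S using M(2) continuous_on_subset by blast
  have mass: "integral {-R..R} M = N R T0"
  proof -
    have "(\<lambda>n. integral {-R..R} (\<lambda>x. \<mu> x (\<tau> n))) \<longlonglongrightarrow> integral {-R..R} M"
      unfolding tendsto_iff dist_real_def
    proof (intro allI impI)
      fix e :: real assume e: "0 < e"
      have "\<forall>\<^sub>F n in sequentially. \<forall>x. \<bar>\<mu> x (\<tau> n) - M x\<bar> < e / (4 * R)"
        using M(7) e params by simp
      then show "\<forall>\<^sub>F n in sequentially. \<bar>integral {-R..R} (\<lambda>x. \<mu> x (\<tau> n)) - integral {-R..R} M\<bar> < e"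
      proof (rule eventually_mono)
        fix n assume n: "\<forall>x. \<bar>\<mu> x (\<tau> n) - M x\<bar> < e / (4 * R)"
        have "norm (integral {-R..R} (\<lambda>x. \<mu> x (\<tau> n) - M x)) \<le> e / (4 * R) * (R - (- R))"
          by (rule integral_bound) (use n params M(6) in \<open>auto intro!: cont slices cM less_imp_le\<close>)
        also have "\<dots> < e" using params e by simp
        also have "integral {-R..R} (\<lambda>x. \<mu> x (\<tau> n) - M x) = integral {-R..R} (\<lambda>x. \<mu> x (\<tau> n)) - integral {-R..R} M"
          using M(6) by (intro Henstock_Kurzweil_Integration.integral_diff integrable_continuous_real slices cM) auto
        finally show "\<bar>integral {-R..R} (\<lambda>x. \<mu> x (\<tau> n)) - integral {-R..R} M\<bar> < e"
          by simp
      qed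
    qed
    moreover have "integral {-R..R} (\<lambda>x. \<mu> x (\<tau> n)) = N R T0" for n
      using mass_const[of "\<tau> n"] M(6)[of n] by (simp add: N_def)
    ultimately show ?thesis by (simp add: LIMSEQ_const_iff)
  qed
  obtain x0 where x0: "0 < M x0"
  proof (rule ccontr)
    assume "\<not> thesis"
    then have "M = (\<lambda>_. 0)" using that M(3) by (metis ext less_eq_real_def)
    then show False using mass mass_pos by simp
  qed
  have loc: "\<exists>d>0. \<forall>a\<in>{y - d..y + d}. \<forall>b\<in>{y - d..y + d}. M a powr \<theta> + c * a\<^sup>2 \<le> M b powr \<theta> + c * b\<^sup>2"
    if "0 < M y" for y
    by (rule pressure_locally_constant[OF M(1,6,2,3,4,7) that])
  obtain r where r: "0 < r" "M = stationary \<theta> c r"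
    using limit_profile[OF M(2,3) x0 loc] by blast
  have "- PF M \<le> En t" if t: "T0 < t" for t
  proof (rule field_le_epsilon)
    fix e :: real assume e: "0 < e"
    obtain d where d: "0 < d" "\<And>f g. continuous_on {-R..R} f \<Longrightarrow> continuous_on {-R..R} g \<Longrightarrow>
      (\<And>x. x \<in> {-R..R} \<Longrightarrow> 0 \<le> f x \<and> f x \<le> Mb \<and> 0 \<le> g x \<and> g x \<le> Mb \<and> \<bar>f x - g x\<bar> < d) \<Longrightarrow> \<bar>PF f - PF g\<bar> \<le> e"
      using PF_close[OF e] by blast
    have "\<forall>\<^sub>F n in sequentially. (\<forall>x. \<bar>\<mu> x (\<tau> n) - M x\<bar> < d) \<and> t \<le> \<tau> n"
      using M(7)[OF d(1)] M(1) unfolding filterlim_at_top by (auto intro: eventually_conj)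
    from eventually_happens'[OF sequentially_bot this]
    obtain n where n: "\<And>x. \<bar>\<mu> x (\<tau> n) - M x\<bar> < d" "t \<le> \<tau> n" by blast
    have "\<bar>PF (\<lambda>x. \<mu> x (\<tau> n)) - PF M\<bar> \<le> e"
      using M(6)[of n] n by (intro d slices cM) (auto intro: M mu_nonneg mu_bd)
    then have "- PF M - e \<le> - Pot (\<tau> n)" by (simp add: Pot_eq)
    also have "\<dots> \<le> En (\<tau> n)" using D_nonneg[OF M(6)] by (simp add: En_def)
    also have "\<dots> \<le> En t" by (rule En_antimono[OF t n(2)])
    finally show "- PF M \<le> En t + e" by simp
  qed
  then show ?thesis using that[OF r(1)] mass M(5) r(2) by blast
qed

end

section \<open>Testing a weak gradient with functions of class \<open>C\<^sup>1\<close>\<close>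

text \<open>Sums of monomials, a form in which an antiderivative in the first variable can be
  written down and is visibly smooth. Polynomials enter through Stone-Weierstrass.\<close>

inductive poly2 :: "(real \<times> real \<Rightarrow> real) \<Rightarrow> bool" where
  monom: "poly2 (\<lambda>z. a * fst z ^ i * snd z ^ j)"
| add: "poly2 f \<Longrightarrow> poly2 g \<Longrightarrow> poly2 (\<lambda>z. f z + g z)"

lemma poly2_mult:
  assumes "poly2 f" "poly2 g"
  shows "poly2 (\<lambda>z. f z * g z)"
  using assms(1)
proof induction
  case (monom a i j)
  show ?case
    using assms(2)
  proof induction
    case (monom b i' j')
    have "(\<lambda>z::real \<times> real. a * fst z ^ i * snd z ^ j * (b * fst z ^ i' * snd z ^ j'))
      = (\<lambda>z. (a * b) * fst z ^ (i + i') * snd z ^ (j + j'))"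
      by (simp add: fun_eq_iff power_add)
    then show ?case by (simp only: poly2.monom)
  next
    case (add f g)
    from poly2.add[OF add.IH] show ?case by (simp add: distrib_left)
  qed
next
  case (add f g)
  from poly2.add[OF add.IH] show ?case by (simp add: distrib_right)
qed

lemma real_polynomial_function_poly2:
  fixes f :: "real \<times> real \<Rightarrow> real"
  assumes "real_polynomial_function f"
  shows "poly2 f"
  using assms
proof induction
  case (linear f)
  interpret bounded_linear f by fact
  have "f z = f (1, 0) * fst z ^ 1 * snd z ^ 0 + f (0, 1) * fst z ^ 0 * snd z ^ 1" for z
  proof -
    have "f z = f (fst z *\<^sub>R (1, 0) + snd z *\<^sub>R (0, 1))" by simp
    also have "\<dots> = fst z *\<^sub>R f (1, 0) + snd z *\<^sub>R f (0, 1)" by (simp only: add scale)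
    finally show ?thesis by (simp add: mult.commute)
  qed
  then have eq: "f = (\<lambda>z. f (1, 0) * fst z ^ 1 * snd z ^ 0 + f (0, 1) * fst z ^ 0 * snd z ^ 1)" by blast
  show ?case
    by (rule ssubst[where P = poly2, OF eq]) (intro poly2.add poly2.monom)
next
  case (const a)
  show ?case using poly2.monom[of a 0 0] by simp
qed (auto intro: poly2.add poly2_mult)

lemma poly2_antiderivative:
  assumes "poly2 p"
  shows "\<exists>Q. (\<forall>n. Ck_on n Q UNIV) \<and> (\<forall>x t. ((\<lambda>x. Q (x, t)) has_real_derivative p (x, t)) (at x))"
  using assms
proof induction
  case (monom a i j)
  have C: "Ck_on n (\<lambda>z::real \<times> real. fst z) UNIV" "Ck_on n (\<lambda>z::real \<times> real. snd z) UNIV" for n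
    using Ck_on_fst[of n "\<lambda>x. x"] Ck_on_snd[of n "\<lambda>x. x"]
      Ck_on_Suc_imp[OF Ck_on_Suc_real[OF DERIV_ident Ck_on_const]]
    by auto
  show ?case
  proof (intro exI[of _ "\<lambda>z. a / real (Suc i) * fst z ^ Suc i * snd z ^ j"] conjI allI)
    show "Ck_on n (\<lambda>z::real \<times> real. a / real (Suc i) * fst z ^ Suc i * snd z ^ j) UNIV" for n
      by (intro Ck_on_mult Ck_on_const Ck_on_power C)
    show "((\<lambda>x. a / real (Suc i) * fst (x, t) ^ Suc i * snd (x, t) ^ j) has_real_derivative a * fst (x, t) ^ i * snd (x, t) ^ j) (at x)" for x t :: real
      using DERIV_cmult_right[OF DERIV_cmult[OF DERIV_pow[of "Suc i" x UNIV], of "a / real (Suc i)"], of "t ^ j"]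
      by (simp del: of_nat_Suc)
  qed
next
  case (add f g)
  then obtain Q Q' where
    "\<forall>n. Ck_on n Q UNIV" "\<forall>x t. ((\<lambda>x. Q (x, t)) has_real_derivative f (x, t)) (at x)"
    "\<forall>n. Ck_on n Q' UNIV" "\<forall>x t. ((\<lambda>x. Q' (x, t)) has_real_derivative g (x, t)) (at x)"
    by blast
  then show ?case
    by (intro exI[of _ "\<lambda>z. Q z + Q' z"]) (auto intro: Ck_on_add DERIV_add)
qed

lemma L2_times_bounded_integrable:
  fixes G h :: "real \<times> real \<Rightarrow> real"
  assumes G: "G \<in> borel_measurable lborel" "integrable lborel (\<lambda>z. (G z)\<^sup>2)"
    and h: "h \<in> borel_measurable lborel" "\<And>z. \<bar>h z\<bar> \<le> b * indicator (cbox l u) z"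
  shows "integrable lborel (\<lambda>z. G z * h z)"
proof (rule Bochner_Integration.integrable_bound)
  have "integrable lborel (\<lambda>z. b\<^sup>2 * indicator (cbox l u) z :: real)"
    by (intro integrable_mult_right integrable_real_indicator emeasure_lborel_cbox_finite) simp
  then show "integrable lborel (\<lambda>z. (G z)\<^sup>2 + b\<^sup>2 * indicator (cbox l u) z)"
    using G(2) by (rule Bochner_Integration.integrable_add[rotated])
  have "\<bar>G z * h z\<bar> \<le> (G z)\<^sup>2 + b\<^sup>2 * indicator (cbox l u) z" for z
  proof -
    have "\<bar>G z * h z\<bar> \<le> (G z)\<^sup>2 + (h z)\<^sup>2"
    proof -
      have "2 * (\<bar>G z\<bar> * \<bar>h z\<bar>) \<le> \<bar>G z\<bar>\<^sup>2 + \<bar>h z\<bar>\<^sup>2" using sum_squares_bound[of "\<bar>G z\<bar>" "\<bar>h z\<bar>"] by simp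
      moreover have "0 \<le> \<bar>G z\<bar> * \<bar>h z\<bar>" by simp
      ultimately show ?thesis unfolding abs_mult power2_abs by linarith
    qed
    also have "\<bar>h z\<bar>\<^sup>2 \<le> (b * indicator (cbox l u) z)\<^sup>2" using h(2)[of z] by (intro power_mono) auto
    then have "(h z)\<^sup>2 \<le> b\<^sup>2 * indicator (cbox l u) z" by (auto simp: indicator_def)
    finally show ?thesis by simp
  qed
  then show "AE z in lborel. norm (G z * h z) \<le> norm ((G z)\<^sup>2 + b\<^sup>2 * indicator (cbox l u) z)"
    by (intro AE_I2) (force intro: order_trans)
qed (use G h in measurable)

text \<open>The function to be tested with, \<xi>(t) times the x-primitive of \<open>r\<close>, is
  only C^1 in x and continuous in t. It is approximated by replacing \<open>r\<close> with a
  polynomial, whose primitive is smooth; uniform closeness of the integrands and of the primitives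
  suffices because \<open>G\<close> is square integrable and everything sits in a fixed box. In the
  application \<open>r\<close> is a time increment of the density.\<close>

lemma weak_gradient_antiderivative:
  fixes f r :: "real \<Rightarrow> real \<Rightarrow> real" and g :: "real \<times> real \<Rightarrow> real \<times> real"
  assumes R: "0 < R" and s: "l < s1" "s1 \<le> s2" "s2 < u"
    and U: "U = UNIV \<times> {l<..<u}"
    and f: "continuous_on (UNIV \<times> {s1..s2}) (\<lambda>(x, t). f x t)"
      "\<And>x t. t \<in> {s1..s2} \<Longrightarrow> R \<le> \<bar>x\<bar> \<Longrightarrow> f x t = 0"
    and r: "continuous_on (UNIV \<times> {s1..s2}) (\<lambda>(x, t). r x t)"
      "\<And>x t. t \<in> {s1..s2} \<Longrightarrow> R \<le> \<bar>x\<bar> \<Longrightarrow> r x t = 0"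
      "\<And>t. t \<in> {s1..s2} \<Longrightarrow> integral {-R..R} (\<lambda>x. r x t) = 0"
    and \<xi>: "\<And>n. Ck_on n \<xi> UNIV" "\<And>t. t \<notin> {s1..s2} \<Longrightarrow> \<xi> t = 0"
    and g: "weak_gradient U (\<lambda>(x, t). f x t) g"
    and Gdef: "\<And>z. G z = indicator U z * fst (g z)"
    and G: "G \<in> borel_measurable lborel" "integrable lborel (\<lambda>z. (G z)\<^sup>2)"
  shows "integral {s1..s2} (\<lambda>t. \<xi> t * integral {-R..R} (\<lambda>x. f x t * r x t))
    = - (LINT z|lborel. G z * (indicator (cbox (-R, s1) (R, s2)) z * (\<xi> (snd z) * integral {-R..fst z} (\<lambda>x. r x (snd z)))))"
proof -
  define L where "L = R + 1"
  define bx where "bx = cbox (-L, s1) (L, s2)"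
  define Q where "Q x t = integral {-L..x} (\<lambda>x. r x t)" for x t
  define Y where "Y z = indicator bx z * (\<xi> (snd z) * Q (fst z) (snd z))" for z
  have rs: "continuous_on S (\<lambda>x. r x t)" if "t \<in> {s1..s2}" for t S
    by (rule continuous_on_slice(1)[OF r(1) that])
  \<comment> \<open>The zero mean of \<open>r\<close> makes its primitive vanish on both sides of
    [-R, R].\<close>
  have Qz: "Q x t = (if \<bar>x\<bar> < R then integral {-R..x} (\<lambda>x. r x t) else 0)" if t: "t \<in> {s1..s2}" and x: "x \<in> {-L..L}" for x t
  proof -
    have int: "(\<lambda>x. r x t) integrable_on {a..b}" for a b by (intro integrable_continuous_real rs t)
    have z: "integral {a..b} (\<lambda>x. r x t) = 0" if "b \<le> -R \<or> R \<le> a" for a b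
    proof -
      have "integral {a..b} (\<lambda>x. r x t) = integral {a..b} (\<lambda>_. 0::real)"
        by (rule integral_cong) (use r(2)[OF t] that in auto)
      then show ?thesis by simp
    qed
    have c: "integral {a..b} (\<lambda>x. r x t) + integral {b..c} (\<lambda>x. r x t) = integral {a..c} (\<lambda>x. r x t)" if "a \<le> b" "b \<le> c" for a b c
      by (rule Henstock_Kurzweil_Integration.integral_combine) (use that int in auto)
    consider "x \<le> -R" | "-R < x" "x < R" | "R \<le> x" by linarith
    then show ?thesis
    proof cases
      case 1
      then show ?thesis using z[of x "-L"] R by (auto simp: Q_def)
    next
      case 2
      then show ?thesis using z[of "-R" "-L"] c[of "-L" "-R" x] by (auto simp: Q_def L_def)
    next
      case 3
      then show ?thesis using z[of "-R" "-L"] c[of "-L" "-R" x] c[of "-R" R x] z[of x R] r(3)[OF t] R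
        by (auto simp: Q_def L_def)
    qed
  qed
  have Y_eq: "Y z = indicator (cbox (-R, s1) (R, s2)) z * (\<xi> (snd z) * integral {-R..fst z} (\<lambda>x. r x (snd z)))" for z
  proof -
    obtain x t where z: "z = (x, t)" by fastforce
    show ?thesis
    proof (cases "t \<in> {s1..s2} \<and> x \<in> {-L..L}")
      case True
      have "integral {-R..x} (\<lambda>x. r x t) = 0" if "\<bar>x\<bar> = R"
        using that r(3)[of t] True by (cases "x = R") auto
      then show ?thesis using True Qz[of t x] R
        by (auto simp: Y_def z bx_def cbox_Pair_iff L_def indicator_def)
    qed (auto simp: Y_def z bx_def cbox_Pair_iff L_def indicator_def)
  qed
  have "compact ((\<lambda>t. \<xi> t) ` {s1..s2})"
    using \<xi>(1)[of 0] by (intro compact_continuous_image) (auto intro: continuous_on_subset)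
  then obtain X0 where "\<forall>y\<in>\<xi> ` {s1..s2}. \<bar>y\<bar> \<le> X0"
    using compact_imp_bounded bounded_real by blast
  then have X: "\<bar>\<xi> t\<bar> \<le> max 0 X0" for t
    by (cases "t \<in> {s1..s2}") (auto simp: \<xi>(2) intro: max.coboundedI2)
  define X where "X = max 0 X0"
  \<comment> \<open>Joint continuity with a moving endpoint: rescaling [-L, x] to [0, 1] moves x
    into the integrand.\<close>
  have cQ: "continuous_on bx (\<lambda>z. Q (fst z) (snd z))"
  proof -
    have "continuous_on (({-L..L} \<times> {s1..s2}) \<times> cbox 0 1) (\<lambda>z. (fst (fst z) + L) * (\<lambda>(x, t). r x t) (- L + snd z * (fst (fst z) + L), snd (fst z)))"
      by (intro continuous_intros continuous_on_compose2[OF r(1)]) auto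
    then have "continuous_on (({-L..L} \<times> {s1..s2}) \<times> cbox 0 1) (\<lambda>(z, y). (fst z + L) * r (- L + y * (fst z + L)) (snd z))"
      by (simp add: split_beta)
    from integral_continuous_on_param[OF this]
    have "continuous_on ({-L..L} \<times> {s1..s2}) (\<lambda>z. integral (cbox 0 1) (\<lambda>y. (fst z + L) * r (- L + y * (fst z + L)) (snd z)))" .
    moreover have "bx = {-L..L} \<times> {s1..s2}" by (simp add: bx_def cbox_Pair_eq)
    ultimately show ?thesis
    proof (simp only:, elim continuous_on_eq)
      fix z assume "z \<in> {-L..L} \<times> {s1..s2}"
      then obtain x t where z: "z = (x, t)" "x \<in> {-L..L}" "t \<in> {s1..s2}" by auto
      show "integral (cbox 0 1) (\<lambda>y. (fst z + L) * r (- L + y * (fst z + L)) (snd z)) = Q (fst z) (snd z)"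
      proof (cases "x = -L")
        case False
        then have xL: "0 < x + L" using z by auto
        have "((\<lambda>x. r x t) has_integral Q x t) (cbox (-L) x)"
          unfolding Q_def box_real by (intro integrable_integral integrable_continuous_real rs z)
        from has_integral_affinity'[OF this xL, of "-L"]
        have "((\<lambda>y. r ((x + L) * y - L) t) has_integral Q x t / (x + L)) {0..1}"
          using xL by (simp add: divide_inverse mult.commute)
        from has_integral_mult_right[OF this, of "x + L"]
        have "((\<lambda>y. (x + L) * r (- L + y * (x + L)) t) has_integral Q x t) {0..1}"
          using xL by (simp add: mult.commute)
        from integral_unique[OF this] show ?thesis using z by simp
      qed (use z in \<open>simp add: Q_def\<close>)
    qed
  qed
  have cxi: "continuous_on S (\<lambda>z. \<xi> (snd z))" for S :: "(real \<times> real) set"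
    by (rule continuous_on_compose2[OF continuous_on_smooth[OF \<xi>(1)] continuous_on_snd[OF continuous_on_id]]) simp
  obtain q where q: "\<And>z. z \<in> bx \<Longrightarrow> \<bar>\<xi> (snd z) * Q (fst z) (snd z)\<bar> \<le> q"
  proof -
    have "compact ((\<lambda>z. \<xi> (snd z) * Q (fst z) (snd z)) ` bx)"
      by (intro compact_continuous_image continuous_intros cQ cxi) (simp add: bx_def)
    then obtain B where "\<forall>y\<in>(\<lambda>z. \<xi> (snd z) * Q (fst z) (snd z)) ` bx. \<bar>y\<bar> \<le> B"
      using compact_imp_bounded bounded_real by blast
    then show ?thesis by (intro that[of B]) auto
  qed
  have Ymeas: "Y \<in> borel_measurable lborel"
  proof -
    have "(\<lambda>z. indicator bx z *\<^sub>R (\<xi> (snd z) * Q (fst z) (snd z))) \<in> borel_measurable borel"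
      by (rule borel_measurable_continuous_on_indicator)
        (auto simp: bx_def intro!: continuous_intros cxi cQ[unfolded bx_def])
    then show ?thesis by (simp add: Y_def[abs_def])
  qed
  have Yb: "\<bar>Y z\<bar> \<le> q * indicator bx z" for z
    using q[of z] by (auto simp: Y_def indicator_def)
  have iY: "integrable lborel (\<lambda>z. G z * Y z)"
    by (rule L2_times_bounded_integrable[OF G Ymeas Yb[unfolded bx_def]])
  have i1: "integrable lborel (\<lambda>z. \<bar>G z\<bar> * indicator bx z)"
    using L2_times_bounded_integrable[of "\<lambda>z. \<bar>G z\<bar>" "indicator bx" 1 "(-L, s1)" "(L, s2)"] G
    by (auto simp: bx_def)
  define WG where "WG = (LINT z|lborel. \<bar>G z\<bar> * indicator bx z)"
  have WG: "0 \<le> WG" unfolding WG_def by (rule integral_nonneg_AE) auto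
  define fr where "fr z = (case z of (x, t) \<Rightarrow> \<xi> t * (f x t * r x t))" for z
  have sub: "cbox (-R, s1) (R, s2) \<subseteq> UNIV \<times> {s1..s2}" by (auto simp: cbox_Pair_iff)
  have cfr: "continuous_on (cbox (-R, s1) (R, s2)) fr"
    unfolding fr_def split_beta
    by (intro continuous_intros cxi continuous_on_subset[OF f(1)[unfolded split_beta] sub] continuous_on_subset[OF r(1)[unfolded split_beta] sub])
  obtain Fb where Fb: "0 < Fb" "\<And>x t. (x, t) \<in> cbox (-R, s1) (R, s2) \<Longrightarrow> \<bar>f x t\<bar> \<le> Fb"
  proof -
    have "compact ((\<lambda>(x, t). f x t) ` cbox (-R, s1) (R, s2))"
      by (intro compact_continuous_image continuous_on_subset[OF f(1) sub]) simp
    then obtain B where B: "\<forall>y\<in>(\<lambda>(x, t). f x t) ` cbox (-R, s1) (R, s2). \<bar>y\<bar> \<le> B"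
      using compact_imp_bounded bounded_real by blast
    show ?thesis
    proof (rule that[of "max 1 B"])
      show "\<bar>f x t\<bar> \<le> max 1 B" if "(x, t) \<in> cbox (-R, s1) (R, s2)" for x t
        using bspec[OF B imageI[OF that]] by simp
    qed simp
  qed
  \<comment> \<open>A cut-off equal to 1 on [-R, R] and 0 outside [-L, L]; it is needed because the
    primitive of the approximating polynomial does not vanish beyond R.\<close>
  define b where "b x = smooth_step ((x - (-L)) / 1) + (-1) * smooth_step ((x - R) / 1)" for x
  define b' where "b' x = smooth_bump ((x - (-L)) / 1) / 1 + (-1) * (smooth_bump ((x - R) / 1) / 1)" for x
  have Cb: "Ck_on n b UNIV" for n
    unfolding b_def by (intro Ck_on_add Ck_on_mult Ck_on_const Ck_on_scale_shift Ck_on_smooth_step)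
  have db: "(b has_real_derivative b' x) (at x)" for x
    unfolding b_def b'_def by (intro DERIV_add DERIV_cmult smooth_step_scaled_deriv)
  have b_in: "b x = 1" "b' x = 0" if "\<bar>x\<bar> \<le> R" for x
    using that by (auto simp: b_def b'_def L_def smooth_step_1 smooth_step_0 smooth_bump_0 abs_le_iff)
  have b_out: "b x = 0" if "x \<notin> {-L..L}" for x
  proof -
    have "x \<le> -L \<or> L \<le> x" using that by auto
    then show ?thesis using R by (auto simp: b_def L_def smooth_step_1 smooth_step_0)
  qed
  have b01: "\<bar>b x\<bar> \<le> 1" for x
    using smooth_step_bounds[of "(x - (-L)) / 1"] smooth_step_bounds[of "(x - R) / 1"] by (auto simp: b_def)
  have close: "\<bar>integral (cbox (-R, s1) (R, s2)) fr + (LINT z|lborel. G z * Y z)\<bar> \<le> e" if e: "0 < e" for e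
  proof -
    define V where "V = X * Fb * measure lborel (cbox (-R, s1) (R, s2))"
    \<comment> \<open>Sum of the two error factors: the left side changes by at most \<epsilon> V,
      the right side by at most \<epsilon> X (2 L) WG. The 1 makes the divisor positive.\<close>
    define C where "C = V + X * (2 * L) * WG + 1"
    have X0: "0 \<le> X" by (simp add: X_def)
    have V0: "0 \<le> V" using X0 Fb by (simp add: V_def)
    have C: "0 < C" unfolding C_def using V0 X0 WG R by (intro add_nonneg_pos add_nonneg_nonneg mult_nonneg_nonneg) (auto simp: L_def)
    define \<epsilon> where "\<epsilon> = e / C"
    have ep: "0 < \<epsilon>" using e C by (simp add: \<epsilon>_def)
    obtain P where P: "real_polynomial_function P" "\<And>z. z \<in> bx \<Longrightarrow> \<bar>(\<lambda>(x, t). r x t) z - P z\<bar> < \<epsilon>"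
    proof (rule Stone_Weierstrass_real_polynomial_function[of bx "\<lambda>(x, t). r x t" \<epsilon>])
      show "continuous_on bx (\<lambda>(x, t). r x t)"
        by (rule continuous_on_subset[OF r(1)]) (auto simp: bx_def cbox_Pair_iff)
    qed (use ep in \<open>auto simp: bx_def\<close>)
    obtain Q1 where Q1: "\<And>n. Ck_on n Q1 UNIV" "\<And>x t. ((\<lambda>x. Q1 (x, t)) has_real_derivative P (x, t)) (at x)"
      using poly2_antiderivative[OF real_polynomial_function_poly2[OF P(1)]] by blast
    \<comment> \<open>The primitive is normalised to vanish at x = -L, like \<open>Q\<close>, so
      that the two stay within 2 L \<epsilon> of each other.\<close>
    define Qp where "Qp z = Q1 z + (-1) * Q1 (-L, snd z)" for z
    have CQp: "Ck_on n Qp UNIV" for n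
    proof -
      have "bounded_linear (\<lambda>z::real \<times> real. (0::real, snd z))"
        by (intro bounded_linear_Pair bounded_linear_zero bounded_linear_snd)
      from Ck_on_affine[OF this Q1(1)[of n], of "(-L, 0)"]
      have "Ck_on n (\<lambda>z::real \<times> real. Q1 (-L, snd z)) UNIV" by simp
      then show ?thesis unfolding Qp_def by (intro Ck_on_add Ck_on_mult Ck_on_const Q1)
    qed
    have dQp: "((\<lambda>x. Qp (x, t)) has_real_derivative P (x, t)) (at x)" for x t
      unfolding Qp_def using DERIV_add[OF Q1(2) DERIV_const[of "(-1) * Q1 (-L, t)"]] by simp
    have QpQ: "\<bar>Qp (x, t) - Q x t\<bar> \<le> \<epsilon> * (2 * L)" if xt: "(x, t) \<in> bx" for x t
    proof -
      have t: "t \<in> {s1..s2}" and x: "x \<in> {-L..L}" using xt by (auto simp: bx_def cbox_Pair_iff)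
      have "((\<lambda>x. P (x, t)) has_integral Qp (x, t) - Qp (-L, t)) {-L..x}"
        by (rule fundamental_theorem_of_calculus)
          (use x dQp in \<open>auto simp: has_real_derivative_iff_has_vector_derivative[symmetric] intro: has_field_derivative_at_within\<close>)
      moreover have "((\<lambda>x. r x t) has_integral Q x t) {-L..x}"
        unfolding Q_def by (intro integrable_integral integrable_continuous_real rs t)
      ultimately have "((\<lambda>x. P (x, t) - r x t) has_integral Qp (x, t) - Qp (-L, t) - Q x t) {-L..x}"
        by (rule has_integral_diff)
      moreover have "Qp (-L, t) = 0" by (simp add: Qp_def)
      ultimately have h: "((\<lambda>x. P (x, t) - r x t) has_integral Qp (x, t) - Q x t) (cbox (-L) x)" by simp
      have "norm (Qp (x, t) - Q x t) \<le> \<epsilon> * measure lborel (cbox (-L) x)"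
      proof (rule has_integral_bound[OF _ h])
        fix x' assume "x' \<in> cbox (-L) x"
        then have "(x', t) \<in> bx" using x t by (auto simp: bx_def cbox_Pair_iff)
        from P(2)[OF this] show "norm (P (x', t) - r x' t) \<le> \<epsilon>" by (simp add: abs_minus_commute)
      qed (use ep in simp)
      also have "\<dots> \<le> \<epsilon> * (2 * L)" using x ep by (intro mult_left_mono) auto
      finally show ?thesis by simp
    qed
    define \<phi> where "\<phi> z = \<xi> (snd z) * (b (fst z) * Qp z)" for z
    have Cphi: "Ck_on n \<phi> UNIV" for n
      unfolding \<phi>_def by (intro Ck_on_mult Ck_on_snd Ck_on_fst \<xi> Cb CQp)
    have phi0: "\<phi> z = 0" if "z \<notin> bx" for z
    proof -
      have "snd z \<notin> {s1..s2} \<or> fst z \<notin> {-L..L}" using that by (cases z) (auto simp: bx_def cbox_Pair_iff)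
      then show ?thesis using \<xi>(2) b_out by (auto simp: \<phi>_def)
    qed
    have bxU: "bx \<subseteq> U" using s by (auto simp: bx_def U cbox_Pair_iff)
    have tf: "test_function U \<phi>"
      by (rule test_functionI[OF Cphi, of bx]) (use phi0 bxU in \<open>auto simp: bx_def\<close>)
    have fd: "frechet_derivative \<phi> (at (x, t)) (1, 0) = \<xi> t * (b' x * Qp (x, t) + P (x, t) * b x)" for x t
      by (rule frechet_derivative_slices(1)[OF Cphi]) (auto simp: \<phi>_def intro!: DERIV_cmult DERIV_mult db dQp)
    have "(1::real, 0::real) \<in> Basis" by (simp add: Basis_prod_def)
    with g tf have weak: "(LINT z:U|lborel. (\<lambda>(x, t). f x t) z * frechet_derivative \<phi> (at z) (1, 0)) =
        - (LINT z:U|lborel. (g z \<bullet> (1, 0)) * \<phi> z)"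
      unfolding weak_gradient_def by blast
    define fP where "fP z = (case z of (x, t) \<Rightarrow> \<xi> t * (f x t * P (x, t)))" for z
    have cfP: "continuous_on (cbox (-R, s1) (R, s2)) fP"
      unfolding fP_def split_beta using P(1)
      by (intro continuous_intros cxi continuous_on_subset[OF f(1)[unfolded split_beta] sub] continuous_on_polymonial_function)
        (auto simp: polynomial_function_iff_Basis_inner split_beta)
    \<comment> \<open>The derivative of the cut-off leaves no trace, since it is supported where
      \<open>f\<close> vanishes.\<close>
    have fPU: "(\<lambda>(x, t). f x t) z * frechet_derivative \<phi> (at z) (1, 0) = fP z" for z
    proof -
      obtain x t where z: "z = (x, t)" by fastforce
      show ?thesis
      proof (cases "t \<in> {s1..s2}")
        case True
        show ?thesis
        proof (cases "\<bar>x\<bar> \<le> R")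
          case True
          then show ?thesis by (simp add: z fd fP_def b_in)
        next
          case False
          then show ?thesis using f(2)[OF True, of x] by (simp add: z fP_def)
        qed
      next
        case False
        then show ?thesis using \<xi>(2)[of t] by (simp add: z fP_def fd)
      qed
    qed
    have "(LINT z:U|lborel. fP z) = integral (cbox (-R, s1) (R, s2)) fP"
    proof (rule set_lebesgue_integral_eq_integral_cbox[OF cfP])
      fix z assume "z \<notin> cbox (-R, s1) (R, s2)"
      then have "snd z \<notin> {s1..s2} \<or> snd z \<in> {s1..s2} \<and> R \<le> \<bar>fst z\<bar>" by (cases z) (auto simp: cbox_Pair_iff)
      then show "fP z = 0" using \<xi>(2) f(2) by (auto simp: fP_def split_beta)
    next
      show "cbox (-R, s1) (R, s2) \<subseteq> U" using s by (auto simp: U cbox_Pair_iff)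
    qed
    moreover have "(LINT z:U|lborel. (g z \<bullet> (1, 0)) * \<phi> z) = (LINT z|lborel. G z * \<phi> z)"
      unfolding set_lebesgue_integral_def
      by (rule Bochner_Integration.integral_cong) (auto simp: Gdef inner_prod_def split: prod.split)
    ultimately have main: "integral (cbox (-R, s1) (R, s2)) fP = - (LINT z|lborel. G z * \<phi> z)"
      using weak unfolding fPU by simp
    have d1: "\<bar>integral (cbox (-R, s1) (R, s2)) fr - integral (cbox (-R, s1) (R, s2)) fP\<bar> \<le> \<epsilon> * V"
    proof -
      have "((\<lambda>z. fr z - fP z) has_integral integral (cbox (-R, s1) (R, s2)) fr - integral (cbox (-R, s1) (R, s2)) fP) (cbox (-R, s1) (R, s2))"
        by (intro has_integral_diff integrable_integral integrable_continuous cfr cfP)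
      then have "norm (integral (cbox (-R, s1) (R, s2)) fr - integral (cbox (-R, s1) (R, s2)) fP)
        \<le> X * Fb * \<epsilon> * measure lborel (cbox (-R, s1) (R, s2))"
      proof (rule has_integral_bound[rotated])
        fix z assume z: "z \<in> cbox (-R, s1) (R, s2)"
        obtain x t where zx: "z = (x, t)" by fastforce
        have zb: "(x, t) \<in> bx" using z by (auto simp: zx bx_def cbox_Pair_iff L_def)
        have "norm (fr z - fP z) = \<bar>\<xi> t\<bar> * \<bar>f x t\<bar> * \<bar>r x t - P (x, t)\<bar>"
          by (simp add: fr_def fP_def zx abs_mult[symmetric] algebra_simps)
        also have "\<dots> \<le> X * Fb * \<epsilon>"
          using X[of t] Fb(2)[of x t] P(2)[OF zb] z Fb(1) X0 by (intro mult_mono) (auto simp: zx X_def)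
        finally show "norm (fr z - fP z) \<le> X * Fb * \<epsilon>" .
      qed (use X0 Fb ep in simp)
      then show ?thesis by (simp add: V_def mult_ac)
    qed
    have phiY: "\<bar>\<phi> z - Y z\<bar> \<le> X * (\<epsilon> * (2 * L)) * indicator bx z" for z
    proof (cases "z \<in> bx")
      case True
      obtain x t where z: "z = (x, t)" by fastforce
      have t: "t \<in> {s1..s2}" and x: "x \<in> {-L..L}" using True by (auto simp: z bx_def cbox_Pair_iff)
      have "b x * Q x t = Q x t" using Qz[OF t x] b_in[of x] by auto
      then have "\<phi> z - Y z = \<xi> t * (b x * (Qp (x, t) - Q x t))"
        using True by (simp add: \<phi>_def Y_def z right_diff_distrib)
      then have "\<bar>\<phi> z - Y z\<bar> = \<bar>\<xi> t\<bar> * (\<bar>b x\<bar> * \<bar>Qp (x, t) - Q x t\<bar>)" by (simp add: abs_mult)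
      also have "\<dots> \<le> X * (1 * (\<epsilon> * (2 * L)))"
        using X[of t] b01[of x] QpQ[of x t] True X0 ep R by (intro mult_mono) (auto simp: z X_def L_def)
      finally show ?thesis using True by simp
    qed (auto simp: phi0 Y_def)
    have phim: "\<phi> \<in> borel_measurable lborel"
      using Cphi[of 0] by (simp add: borel_measurable_continuous_onI)
    have iPY: "integrable lborel (\<lambda>z. G z * (\<phi> z - Y z))"
      by (rule L2_times_bounded_integrable[OF G _ phiY[unfolded bx_def]]) (use phim Ymeas in measurable)
    have "(LINT z|lborel. G z * \<phi> z) = (LINT z|lborel. G z * (\<phi> z - Y z) + G z * Y z)"
      by (simp add: algebra_simps)
    also have "\<dots> = (LINT z|lborel. G z * (\<phi> z - Y z)) + (LINT z|lborel. G z * Y z)"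
      by (rule Bochner_Integration.integral_add[OF iPY iY])
    finally have d2: "(LINT z|lborel. G z * \<phi> z) = (LINT z|lborel. G z * (\<phi> z - Y z)) + (LINT z|lborel. G z * Y z)" .
    have "\<bar>LINT z|lborel. G z * (\<phi> z - Y z)\<bar> \<le> (LINT z|lborel. X * (\<epsilon> * (2 * L)) * (\<bar>G z\<bar> * indicator bx z))"
    proof (rule order_trans[OF integral_abs_bound], rule integral_mono)
      show "\<bar>G z * (\<phi> z - Y z)\<bar> \<le> X * (\<epsilon> * (2 * L)) * (\<bar>G z\<bar> * indicator bx z)" for z
        using mult_left_mono[OF phiY[of z], of "\<bar>G z\<bar>"] by (simp add: abs_mult mult_ac)
    qed (use iPY i1 in auto)
    then have d3: "\<bar>LINT z|lborel. G z * (\<phi> z - Y z)\<bar> \<le> \<epsilon> * (X * (2 * L) * WG)"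
      unfolding Bochner_Integration.integral_mult_right_zero WG_def[symmetric] by (simp add: mult_ac)
    have "\<bar>integral (cbox (-R, s1) (R, s2)) fr + (LINT z|lborel. G z * Y z)\<bar> \<le> \<epsilon> * V + \<epsilon> * (X * (2 * L) * WG)"
      using d1 d3 main d2 by linarith
    also have "\<dots> \<le> \<epsilon> * C" using ep by (simp add: C_def algebra_simps)
    also have "\<dots> = e" using C by (simp add: \<epsilon>_def)
    finally show ?thesis .
  qed
  have "\<bar>integral (cbox (-R, s1) (R, s2)) fr + (LINT z|lborel. G z * Y z)\<bar> \<le> 0"
    by (rule field_le_epsilon) (simp only: add_0_left close)
  then have "integral (cbox (-R, s1) (R, s2)) fr + (LINT z|lborel. G z * Y z) = 0" by simp
  moreover have "integral (cbox (-R, s1) (R, s2)) fr = integral (cbox (-R) R) (\<lambda>x. integral (cbox s1 s2) (\<lambda>t. fr (x, t)))"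
    by (rule integral_prod_continuous[OF cfr])
  moreover have "\<dots> = integral (cbox s1 s2) (\<lambda>t. integral (cbox (-R) R) (\<lambda>x. fr (x, t)))"
    by (rule integral_swap_continuous[where f = "\<lambda>x t. fr (x, t)"]) (use cfr in simp)
  moreover have "\<dots> = integral {s1..s2} (\<lambda>t. \<xi> t * integral {-R..R} (\<lambda>x. f x t * r x t))"
    by (simp add: fr_def)
  ultimately show ?thesis by (simp add: Y_eq[symmetric])
qed

section \<open>Decay rates\<close>

context rescaled_flow
begin

lemma flux_bound: "T0 < t \<Longrightarrow> \<bar>\<mu> x t * p x t\<bar> \<le> Mb * W"
proof (cases "0 < \<mu> x t")
  case True
  assume t: "T0 < t"
  show ?thesis
    unfolding abs_mult using p_bd[OF t True] mu_bd[of t x] t True by (intro mult_mono) auto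
next
  case False
  assume t: "T0 < t"
  then have "\<mu> x t = 0" using False mu_nonneg[of t x] by simp
  moreover have "0 \<le> Mb" using mu_nonneg[of t x] mu_bd[of t x] t by simp
  ultimately show ?thesis using params by simp
qed

lemma N_deriv_t: "T0 < t \<Longrightarrow> -R \<le> y \<Longrightarrow> ((\<lambda>t. N y t) has_real_derivative \<mu> y t * p y t) (at t)"
  unfolding N_def by (rule flux)

lemma N_increment:
  assumes "T0 < t" "0 < h" "-R \<le> y"
  shows "\<bar>N y (t + h) - N y t\<bar> \<le> h * (Mb * W)"
proof -
  obtain s where s: "t < s" "s < t + h" "N y (t + h) - N y t = (t + h - t) * (\<mu> y s * p y s)"
    using MVT2[of t "t + h" "N y" "\<lambda>s. \<mu> y s * p y s"] N_deriv_t assms by auto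
  have "\<bar>h * (\<mu> y s * p y s)\<bar> \<le> h * (Mb * W)"
    unfolding abs_mult[of h] using assms flux_bound[of s y] s by (intro mult_mono) auto
  then show ?thesis using s(3) by simp
qed

text \<open>Convexity of F gives F(n) - F(\<mu>) \<ge> \<mu>^\<theta> (n - \<mu>) for the later
  density n; the quadratic weight is integrated by parts onto \<open>N\<close>, whose increments
  vanish at both ends by conservation of mass.\<close>

lemma Pot_increment:
  assumes t: "T0 < t" "0 < h"
  shows "integral {-R..R} (\<lambda>x. \<mu> x t powr \<theta> * (\<mu> x (t + h) - \<mu> x t))
    - integral {-R..R} (\<lambda>x. 2 * c * x * (N x (t + h) - N x t)) \<le> Pot (t + h) - Pot t"
proof -
  have th: "T0 < t + h" using t by simp
  have N0: "N R (t + h) - N R t = 0" "N (-R) (t + h) - N (-R) t = 0"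
    using mass_const[of t] mass_const[of "t + h"] t by (auto simp: N_def)
  have i: "((\<lambda>x. 2 * c * x * (N x (t + h) - N x t) + (\<mu> x (t + h) - \<mu> x t) * (c * x\<^sup>2)) has_integral
    c * R\<^sup>2 * (N R (t + h) - N R t) - c * (-R)\<^sup>2 * (N (-R) (t + h) - N (-R) t)) {-R..R}"
  proof (rule fundamental_theorem_of_calculus)
    fix x assume x: "x \<in> {-R..R}"
    have "((\<lambda>x. c * x\<^sup>2) has_real_derivative 2 * c * x) (at x within {-R..R})"
      by (auto intro!: derivative_eq_intros)
    from DERIV_mult[OF this DERIV_diff[OF N_deriv_x[OF th x] N_deriv_x[OF t(1) x]]]
    show "((\<lambda>x. c * x\<^sup>2 * (N x (t + h) - N x t)) has_vector_derivative
      2 * c * x * (N x (t + h) - N x t) + (\<mu> x (t + h) - \<mu> x t) * (c * x\<^sup>2)) (at x within {-R..R})"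
      by (simp add: has_real_derivative_iff_has_vector_derivative[symmetric])
  qed (use params in auto)
  have j: "((\<lambda>x. 2 * c * x * (N x (t + h) - N x t)) has_integral integral {-R..R} (\<lambda>x. 2 * c * x * (N x (t + h) - N x t))) {-R..R}"
    using t th by (intro integrable_integral integrable_continuous_real cont cN) auto
  have 1: "((\<lambda>x. (\<mu> x (t + h) - \<mu> x t) * (c * x\<^sup>2)) has_integral
    - integral {-R..R} (\<lambda>x. 2 * c * x * (N x (t + h) - N x t))) {-R..R}"
    using has_integral_diff[OF i j] N0 by simp
  have 2: "((\<lambda>x. \<mu> x t powr \<theta> * (\<mu> x (t + h) - \<mu> x t)) has_integral
    integral {-R..R} (\<lambda>x. \<mu> x t powr \<theta> * (\<mu> x (t + h) - \<mu> x t))) {-R..R}"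
    using t th by (intro integrable_integral integrable_continuous_real cont slices) auto
  have 3: "((\<lambda>x. (\<mu> x (t + h) powr (\<theta> + 1) / (\<theta> + 1) + c * x\<^sup>2 * \<mu> x (t + h))
      - (\<mu> x t powr (\<theta> + 1) / (\<theta> + 1) + c * x\<^sup>2 * \<mu> x t)) has_integral Pot (t + h) - Pot t) {-R..R}"
    unfolding Pot_def using t th params
    by (intro has_integral_diff integrable_integral integrable_continuous_real cont slices) auto
  show ?thesis
  proof (rule has_integral_le[OF has_integral_add[OF 2 1, simplified] 3])
    fix x
    have nn: "0 \<le> \<mu> x t" "0 \<le> \<mu> x (t + h)" using t mu_nonneg by auto
    have "\<mu> x (t + h) * \<mu> x t powr \<theta> \<le> \<mu> x (t + h) powr (\<theta> + 1) / (\<theta> + 1) + \<theta> / (\<theta> + 1) * \<mu> x t powr (\<theta> + 1)"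
      by (rule Young_powr) (use nn params in auto)
    moreover have "\<mu> x t powr (\<theta> + 1) / (\<theta> + 1) = \<mu> x t powr (\<theta> + 1) - \<theta> / (\<theta> + 1) * \<mu> x t powr (\<theta> + 1)"
      using params by (simp add: field_simps)
    moreover have "\<mu> x t powr (\<theta> + 1) = \<mu> x t * \<mu> x t powr \<theta>" using nn params by (intro powr_plus_one) auto
    ultimately show "\<mu> x t powr \<theta> * (\<mu> x (t + h) - \<mu> x t) + (\<mu> x (t + h) - \<mu> x t) * (c * x\<^sup>2)
      \<le> (\<mu> x (t + h) powr (\<theta> + 1) / (\<theta> + 1) + c * x\<^sup>2 * \<mu> x (t + h))
      - (\<mu> x t powr (\<theta> + 1) / (\<theta> + 1) + c * x\<^sup>2 * \<mu> x t)"
      by (simp add: algebra_simps)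
  qed
qed

lemma cN2: "continuous_on ({-R..R} \<times> {T0<..}) (\<lambda>(x, t). N x t)"
proof -
  have "continuous_on (({-R..R} \<times> {T0<..}) \<times> cbox 0 1) (\<lambda>z. (fst (fst z) + R) * (\<lambda>(x, t). \<mu> x t) (- R + snd z * (fst (fst z) + R), snd (fst z)))"
    by (intro continuous_intros continuous_on_compose2[OF cmu]) auto
  then have "continuous_on (({-R..R} \<times> {T0<..}) \<times> cbox 0 1) (\<lambda>(z, y). (fst z + R) * \<mu> (- R + y * (fst z + R)) (snd z))"
    by (simp add: split_beta)
  from integral_continuous_on_param[OF this]
  have "continuous_on ({-R..R} \<times> {T0<..}) (\<lambda>z. integral (cbox 0 1) (\<lambda>y. (fst z + R) * \<mu> (- R + y * (fst z + R)) (snd z)))" .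
  then show ?thesis
  proof (rule continuous_on_eq)
    fix z assume "z \<in> {-R..R} \<times> {T0<..}"
    then obtain x t where z: "z = (x, t)" "x \<in> {-R..R}" "T0 < t" by auto
    show "integral (cbox 0 1) (\<lambda>y. (fst z + R) * \<mu> (- R + y * (fst z + R)) (snd z)) = (\<lambda>(x, t). N x t) z"
    proof (cases "x = -R")
      case False
      then have xR: "0 < x + R" using z by auto
      have "((\<lambda>x. \<mu> x t) has_integral N x t) (cbox (-R) x)"
        unfolding N_def box_real using z by (intro integrable_integral integrable_continuous_real slices) auto
      from has_integral_affinity'[OF this xR, of "-R"]
      have "((\<lambda>y. \<mu> ((x + R) * y - R) t) has_integral N x t / (x + R)) {0..1}"
        using xR by (simp add: divide_inverse mult.commute)
      from has_integral_mult_right[OF this, of "x + R"]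
      have "((\<lambda>y. (x + R) * \<mu> (- R + y * (x + R)) t) has_integral N x t) {0..1}"
        using xR by (simp add: mult.commute)
      from integral_unique[OF this] show ?thesis using z by simp
    qed (use z in \<open>simp add: N_def\<close>)
  qed
qed

text \<open>Formally the derivative of \<open>Pot\<close> is minus the integral of (\<mu>^\<theta> +
  c x^2)_x times the flux. Only one inequality is claimed, as convexity bounds forward increments
  from below; this is the direction that limits how fast \<open>Pot\<close> can decrease.\<close>

lemma potential_weak_decrease:
  fixes g :: "real \<times> real \<Rightarrow> real \<times> real"
  assumes s: "T0 < s1" "l < s1" "s1 \<le> s2" "s2 < u"
    and U: "U = UNIV \<times> {l<..<u}"
    and \<xi>: "\<And>n. Ck_on n \<xi> UNIV" "\<And>t. (\<xi> has_real_derivative \<xi>' t) (at t)" "continuous_on UNIV \<xi>'"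
      "\<And>t. t \<notin> {s1<..<s2} \<Longrightarrow> \<xi> t = 0" "\<And>t. 0 \<le> \<xi> t"
    and g: "weak_gradient U (\<lambda>(x, t). \<mu> x t powr \<theta>) g"
    and Gdef: "\<And>z. Gx z = indicator U z * fst (g z)"
    and G: "Gx \<in> borel_measurable lborel" "integrable lborel (\<lambda>z. (Gx z)\<^sup>2)"
  defines "bx \<equiv> cbox (-R, s1) (R, s2)"
  shows "integral {s1..s2} (\<lambda>t. \<xi>' t * Pot t) \<le>
    (LINT z|lborel. (Gx z + 2 * c * fst z) * (indicator bx z * (\<xi> (snd z) * (\<mu> (fst z) (snd z) * p (fst z) (snd z)))))"
proof -
  have cxi: "continuous_on S \<xi>" for S using \<xi>(1)[of 0] continuous_on_subset by auto
  have cxi': "continuous_on S \<xi>'" for S using \<xi>(3) continuous_on_subset by blast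
  obtain X where X: "0 < X" "\<And>t. t \<in> {s1..s2} \<Longrightarrow> \<bar>\<xi> t\<bar> \<le> X"
  proof -
    have "compact (\<xi> ` {s1..s2})" by (intro compact_continuous_image cxi) auto
    then obtain X where "\<forall>y\<in>\<xi> ` {s1..s2}. \<bar>y\<bar> \<le> X" using compact_imp_bounded bounded_real by blast
    then show ?thesis by (intro that[of "max 1 X"]) (auto intro: max.coboundedI2)
  qed
  define H where "H z = Gx z + 2 * c * fst z" for z :: "real \<times> real"
  \<comment> \<open>\<open>N\<close> is the primitive of the density, so h Y is \<xi> times the
    primitive of the density increment, as \<open>weak_gradient_antiderivative\<close> requires.
    When h tends to 0 it becomes \<xi> times the flux, and \<open>N_increment\<close> dominates it
    uniformly in h.\<close>
  define Y where "Y h z = indicator bx z * (\<xi> (snd z) * ((N (fst z) (snd z + h) - N (fst z) (snd z)) / h))" for h z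
  define Y0 where "Y0 z = indicator bx z * (\<xi> (snd z) * (\<mu> (fst z) (snd z) * p (fst z) (snd z)))" for z
  have bxs: "bx = {-R..R} \<times> {s1..s2}" by (simp add: bx_def cbox_Pair_eq)
  have cNs: "continuous_on bx (\<lambda>z. N (fst z) (snd z + h))" if "0 \<le> h" for h
  proof -
    have "continuous_on bx (\<lambda>z. (\<lambda>(x, t). N x t) (fst z, snd z + h))"
      by (rule continuous_on_compose2[OF cN2]) (use that s in \<open>auto simp: bxs intro!: continuous_intros\<close>)
    then show ?thesis by simp
  qed
  have cxs: "continuous_on S (\<lambda>z. \<xi> (snd z))" for S :: "(real \<times> real) set"
    by (rule continuous_on_compose2[OF cxi continuous_on_snd[OF continuous_on_id] subset_UNIV])
  have bxb: "closed bx" "bx \<in> sets borel" by (auto simp: bx_def)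
  have Ym: "Y h \<in> borel_measurable borel" if "0 < h" for h
  proof -
    have "(\<lambda>z. indicator bx z *\<^sub>R (\<xi> (snd z) * ((N (fst z) (snd z + h) - N (fst z) (snd z + 0)) / h))) \<in> borel_measurable borel"
      by (rule borel_measurable_continuous_on_indicator[OF bxb(2)])
        (use that in \<open>auto intro!: continuous_intros cxs cNs simp del: add_0_right\<close>)
    then show ?thesis by (simp add: Y_def[abs_def])
  qed
  have subbx: "bx \<subseteq> UNIV \<times> {T0<..}" using s by (auto simp: bxs)
  have cJ: "continuous_on bx (\<lambda>z. \<mu> (fst z) (snd z) * p (fst z) (snd z))"
    using continuous_on_subset[OF cmu subbx] continuous_on_subset[OF cp subbx]
    by (auto simp: split_beta intro: continuous_intros)
  have Y0m: "Y0 \<in> borel_measurable borel"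
  proof -
    have "(\<lambda>z. indicator bx z *\<^sub>R (\<xi> (snd z) * (\<mu> (fst z) (snd z) * p (fst z) (snd z)))) \<in> borel_measurable borel"
      by (rule borel_measurable_continuous_on_indicator[OF bxb(2)]) (intro continuous_intros cxs cJ)
    then show ?thesis by (simp add: Y0_def[abs_def])
  qed
  have MW: "0 \<le> Mb * W" using flux_bound[of "T0 + 1" 0] by linarith
  define q where "q = X * (Mb * W)"
  have Yb: "\<bar>Y h z\<bar> \<le> q * indicator bx z" if "0 < h" for h z
  proof (cases "z \<in> bx")
    case True
    then have z: "fst z \<in> {-R..R}" "snd z \<in> {s1..s2}" by (auto simp: bxs)
    have "\<bar>(N (fst z) (snd z + h) - N (fst z) (snd z)) / h\<bar> \<le> Mb * W"
      using N_increment[of "snd z" h "fst z"] z s that by (simp add: abs_divide pos_divide_le_eq mult.commute)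
    then have "\<bar>\<xi> (snd z)\<bar> * \<bar>(N (fst z) (snd z + h) - N (fst z) (snd z)) / h\<bar> \<le> X * (Mb * W)"
      using X z by (intro mult_mono) auto
    then show ?thesis using True by (simp add: Y_def q_def abs_mult)
  qed (simp add: Y_def)
  have GY: "integrable lborel (\<lambda>z. Gx z * Y h z)" if "0 < h" for h
    using L2_times_bounded_integrable[OF G _ Yb[OF that, unfolded bx_def]] Ym[OF that] by simp
  have xY: "integrable lborel (\<lambda>z. 2 * c * fst z * Y h z)" and xYeq: "(LINT z|lborel. 2 * c * fst z * Y h z)
      = integral {s1..s2} (\<lambda>t. \<xi> t * (integral {-R..R} (\<lambda>x. 2 * c * x * (N x (t + h) - N x t)) / h))" if h: "0 < h" for h
  proof -
    define kk where "kk z = 2 * c * fst z * (\<xi> (snd z) * ((N (fst z) (snd z + h) - N (fst z) (snd z)) / h))" for z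
    have ck: "continuous_on bx kk" unfolding kk_def
      using cNs[of 0] cNs[of h] h by (auto intro!: continuous_intros cxs)
    have eq: "2 * c * fst z * Y h z = indicator bx z *\<^sub>R kk z" for z by (simp add: Y_def kk_def)
    show "integrable lborel (\<lambda>z. 2 * c * fst z * Y h z)"
      unfolding eq by (rule borel_integrable_compact) (use ck in \<open>auto simp: bx_def\<close>)
    have "(LINT z|lborel. 2 * c * fst z * Y h z) = (LINT z:UNIV|lborel. indicator bx z *\<^sub>R kk z)"
      unfolding eq set_lebesgue_integral_def by simp
    also have "\<dots> = integral bx (\<lambda>z. indicator bx z *\<^sub>R kk z)"
      unfolding bx_def
      by (rule set_lebesgue_integral_eq_integral_cbox) (auto intro: continuous_on_eq[OF ck[unfolded bx_def]])
    also have "\<dots> = integral bx kk" by (rule integral_cong) simp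
    also have "\<dots> = integral (cbox (-R) R) (\<lambda>x. integral (cbox s1 s2) (\<lambda>t. kk (x, t)))"
      unfolding bx_def by (rule integral_prod_continuous[OF ck[unfolded bx_def]])
    also have "\<dots> = integral (cbox s1 s2) (\<lambda>t. integral (cbox (-R) R) (\<lambda>x. kk (x, t)))"
      by (rule integral_swap_continuous[where f = "\<lambda>x t. kk (x, t)"]) (use ck[unfolded bx_def] in simp)
    also have "\<dots> = integral {s1..s2} (\<lambda>t. \<xi> t * (integral {-R..R} (\<lambda>x. 2 * c * x * (N x (t + h) - N x t)) / h))"
      unfolding box_real
    proof (rule integral_cong)
      fix t
      have "integral {-R..R} (\<lambda>x. kk (x, t)) = integral {-R..R} (\<lambda>x. \<xi> t / h * (2 * c * x * (N x (t + h) - N x t)))"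
        by (rule integral_cong) (simp add: kk_def)
      then show "integral {-R..R} (\<lambda>x. kk (x, t)) = \<xi> t * (integral {-R..R} (\<lambda>x. 2 * c * x * (N x (t + h) - N x t)) / h)"
        by simp
    qed
    finally show "(LINT z|lborel. 2 * c * fst z * Y h z)
      = integral {s1..s2} (\<lambda>t. \<xi> t * (integral {-R..R} (\<lambda>x. 2 * c * x * (N x (t + h) - N x t)) / h))" .
  qed
  define \<Psi> where "\<Psi> h = integral {s1..s2} (\<lambda>t. \<xi> t * Pot (t + h))" for h
  have cPs: "continuous_on {s1..s2} (\<lambda>t. Pot (t + h))" if "0 \<le> h" for h
    by (rule continuous_on_compose2[OF cPot]) (use that s in \<open>auto intro!: continuous_intros\<close>)
  have ineq: "- (LINT z|lborel. H z * Y h z) \<le> (\<Psi> h - \<Psi> 0) / h" if h: "0 < h" for h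
  proof -
    define P1 where "P1 t = integral {-R..R} (\<lambda>x. \<mu> x t powr \<theta> * (\<mu> x (t + h) - \<mu> x t))" for t
    define P2 where "P2 t = integral {-R..R} (\<lambda>x. 2 * c * x * (N x (t + h) - N x t))" for t
    have fc: "continuous_on (UNIV \<times> {s1..s2}) (\<lambda>(x, t). \<mu> x t powr \<theta>)"
      by (rule continuous_on_subset[OF cf]) (use s in auto)
    have rc: "continuous_on (UNIV \<times> {s1..s2}) (\<lambda>(x, t). \<mu> x (t + h) - \<mu> x t)"
    proof -
      have "continuous_on (UNIV \<times> {s1..s2}) (\<lambda>z. (\<lambda>(x, t). \<mu> x t) (fst z, snd z + h) - (\<lambda>(x, t). \<mu> x t) (fst z, snd z))"
        by (intro continuous_intros continuous_on_compose2[OF cmu]) (use s h in auto)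
      then show ?thesis by (simp add: split_beta)
    qed
    have rI: "integral {-R..y} (\<lambda>x. \<mu> x (t + h) - \<mu> x t) = N y (t + h) - N y t" if "t \<in> {s1..s2}" for t y
      unfolding N_def using that s h
      by (intro Henstock_Kurzweil_Integration.integral_diff integrable_continuous_real slices) auto
    have "integral {s1..s2} (\<lambda>t. \<xi> t * P1 t)
      = - (LINT z|lborel. Gx z * (indicator (cbox (-R, s1) (R, s2)) z * (\<xi> (snd z) * integral {-R..fst z} (\<lambda>x. \<mu> x (snd z + h) - \<mu> x (snd z)))))"
      unfolding P1_def
    proof (rule weak_gradient_antiderivative[OF params(1) s(2,3,4) U fc _ rc _ _ \<xi>(1) _ g Gdef G])
      show "integral {-R..R} (\<lambda>x. \<mu> x (t + h) - \<mu> x t) = 0" if "t \<in> {s1..s2}" for t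
        unfolding rI[OF that] using mass_const[of t] mass_const[of "t + h"] that s h by auto
      show "\<xi> t = 0" if "t \<notin> {s1..s2}" for t using \<xi>(4) that by auto
    qed (use s h mu_supp in auto)
    also have "\<dots> = - (LINT z|lborel. h * (Gx z * Y h z))"
    proof (intro arg_cong[where f = uminus] Bochner_Integration.integral_cong refl)
      fix z
      show "Gx z * (indicator (cbox (-R, s1) (R, s2)) z * (\<xi> (snd z) * integral {-R..fst z} (\<lambda>x. \<mu> x (snd z + h) - \<mu> x (snd z)))) = h * (Gx z * Y h z)"
        using rI[of "snd z" "fst z"] h by (cases "z \<in> bx") (auto simp: Y_def bx_def[symmetric] bxs)
    qed
    finally have e1: "integral {s1..s2} (\<lambda>t. \<xi> t * P1 t) = - h * (LINT z|lborel. Gx z * Y h z)" by simp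
    have cP1: "continuous_on {s1..s2} P1"
    proof -
      have "continuous_on (UNIV \<times> {s1..s2}) (\<lambda>(x, t). \<mu> x t powr \<theta> * (\<mu> x (t + h) - \<mu> x t))"
        using continuous_on_mult[OF fc rc] by (simp add: split_beta)
      then show ?thesis unfolding P1_def by (rule continuous_on_integral_slice)
    qed
    have cP2: "continuous_on {s1..s2} P2"
    proof -
      have "continuous_on ({s1..s2} \<times> cbox (-R) R) (\<lambda>y. 2 * c * snd y * ((\<lambda>(x, t). N x t) (snd y, fst y + h) - (\<lambda>(x, t). N x t) (snd y, fst y)))"
        by (intro continuous_intros continuous_on_compose2[OF cN2]) (use s h in auto)
      then have "continuous_on ({s1..s2} \<times> cbox (-R) R) (\<lambda>(t, x). 2 * c * x * (N x (t + h) - N x t))"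
        by (simp add: split_beta)
      from integral_continuous_on_param[OF this] show ?thesis by (simp add: P2_def)
    qed
    have "integral {s1..s2} (\<lambda>t. \<xi> t * P1 t - h * (\<xi> t * (P2 t / h))) \<le> integral {s1..s2} (\<lambda>t. \<xi> t * Pot (t + h) - \<xi> t * Pot (t + 0))"
    proof (rule integral_le)
      show "(\<lambda>t. \<xi> t * P1 t - h * (\<xi> t * (P2 t / h))) integrable_on {s1..s2}"
        using h by (intro integrable_continuous_real cont cxi cP1 cP2) auto
      show "(\<lambda>t. \<xi> t * Pot (t + h) - \<xi> t * Pot (t + 0)) integrable_on {s1..s2}"
        using h by (intro integrable_continuous_real cont cxi cPs) auto
      fix t assume "t \<in> {s1..s2}"
      then have "P1 t - P2 t \<le> Pot (t + h) - Pot t" unfolding P1_def P2_def using s h by (intro Pot_increment) auto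
      from mult_left_mono[OF this \<xi>(5)[of t]]
      show "\<xi> t * P1 t - h * (\<xi> t * (P2 t / h)) \<le> \<xi> t * Pot (t + h) - \<xi> t * Pot (t + 0)"
        using h by (simp add: right_diff_distrib)
    qed
    also have "\<dots> = \<Psi> h - \<Psi> 0"
      unfolding \<Psi>_def using h
      by (intro Henstock_Kurzweil_Integration.integral_diff integrable_continuous_real cont cxi cPs) auto
    also have "integral {s1..s2} (\<lambda>t. \<xi> t * P1 t - h * (\<xi> t * (P2 t / h)))
      = integral {s1..s2} (\<lambda>t. \<xi> t * P1 t) - integral {s1..s2} (\<lambda>t. h * (\<xi> t * (P2 t / h)))"
      using h by (intro Henstock_Kurzweil_Integration.integral_diff integrable_continuous_real cont cxi cP1 cP2) auto
    also have "\<dots> = - h * (LINT z|lborel. Gx z * Y h z) - h * (LINT z|lborel. 2 * c * fst z * Y h z)"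
      unfolding e1 xYeq[OF h] P2_def by simp
    also have "\<dots> = - h * (LINT z|lborel. Gx z * Y h z + 2 * c * fst z * Y h z)"
      using Bochner_Integration.integral_add[OF GY[OF h] xY[OF h]] by (simp add: algebra_simps)
    also have "\<dots> = - h * (LINT z|lborel. H z * Y h z)" by (simp add: H_def distrib_right)
    finally show ?thesis using h by (simp add: pos_le_divide_eq mult.commute)
  qed
  \<comment> \<open>\<open>Pot\<close> is merely continuous, so a primitive shifts the derivative in
    h onto it and, by parts, the derivative in t onto \<xi>.\<close>
  define \<Gamma> where "\<Gamma> x = integral {T0..x} Pot" for x
  have dGam: "(\<Gamma> has_real_derivative Pot x) (at x)" if "T0 < x" for x
  proof -
    have "(\<Gamma> has_real_derivative Pot x) (at x within {T0..x + 1})"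
      unfolding \<Gamma>_def by (rule integral_has_real_derivative[OF continuous_on_subset[OF cPot]]) (use that in auto)
    then show ?thesis using that by (simp add: at_within_Icc_at)
  qed
  have dGs: "((\<lambda>t. \<Gamma> (t + h)) has_real_derivative Pot (t + h)) (at t)" "((\<lambda>h. \<Gamma> (t + h)) has_real_derivative Pot (t + h)) (at h)"
    if "T0 < t + h" for t h
    using DERIV_shift[of \<Gamma> "Pot (t + h)" t h] DERIV_shift[of \<Gamma> "Pot (t + h)" h t] dGam[OF that] by (auto simp: add.commute)
  have Psi_eq: "\<Psi> h = - integral {s1..s2} (\<lambda>t. \<xi>' t * \<Gamma> (t + h))" if h: "0 \<le> h" for h
  proof -
    have cG: "continuous_on {s1..s2} (\<lambda>t. \<Gamma> (t + h))"
      using s h by (intro continuous_at_imp_continuous_on ballI DERIV_isCont[OF dGs(1)]) auto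
    have "((\<lambda>t. \<xi>' t * \<Gamma> (t + h) + Pot (t + h) * \<xi> t) has_integral \<xi> s2 * \<Gamma> (s2 + h) - \<xi> s1 * \<Gamma> (s1 + h)) {s1..s2}"
    proof (rule fundamental_theorem_of_calculus)
      show "((\<lambda>t. \<xi> t * \<Gamma> (t + h)) has_vector_derivative \<xi>' t * \<Gamma> (t + h) + Pot (t + h) * \<xi> t) (at t within {s1..s2})"
        if "t \<in> {s1..s2}" for t
        unfolding has_real_derivative_iff_has_vector_derivative[symmetric]
        by (rule has_field_derivative_at_within, rule DERIV_mult[OF \<xi>(2) dGs(1)]) (use that s h in auto)
    qed (use s in auto)
    moreover have "((\<lambda>t. \<xi>' t * \<Gamma> (t + h) + Pot (t + h) * \<xi> t) has_integral
      integral {s1..s2} (\<lambda>t. \<xi>' t * \<Gamma> (t + h)) + integral {s1..s2} (\<lambda>t. Pot (t + h) * \<xi> t)) {s1..s2}"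
      by (intro has_integral_add integrable_integral integrable_continuous_real cont cxi cxi' cG cPs h)
    ultimately have "\<xi> s2 * \<Gamma> (s2 + h) - \<xi> s1 * \<Gamma> (s1 + h)
      = integral {s1..s2} (\<lambda>t. \<xi>' t * \<Gamma> (t + h)) + integral {s1..s2} (\<lambda>t. Pot (t + h) * \<xi> t)"
      by (rule has_integral_unique)
    then have "integral {s1..s2} (\<lambda>t. \<xi>' t * \<Gamma> (t + h)) + integral {s1..s2} (\<lambda>t. Pot (t + h) * \<xi> t) = 0"
      by (simp add: \<xi>(4))
    then show ?thesis by (simp add: \<Psi>_def mult.commute)
  qed
  have dPsi: "((\<lambda>h. (\<Psi> h - \<Psi> 0) / h) \<longlongrightarrow> - integral {s1..s2} (\<lambda>t. \<xi>' t * Pot t)) (at_right 0)"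
  proof -
    have "((\<lambda>h. integral (cbox s1 s2) (\<lambda>t. \<xi>' t * \<Gamma> (t + h))) has_real_derivative
      integral (cbox s1 s2) (\<lambda>t. \<xi>' t * Pot (t + 0))) (at 0 within {0..1})"
    proof (rule leibniz_rule_field_derivative[where fx = "\<lambda>h t. \<xi>' t * Pot (t + h)"])
      show "((\<lambda>h. \<xi>' t * \<Gamma> (t + h)) has_real_derivative \<xi>' t * Pot (t + h)) (at h within {0..1})"
        if "h \<in> {0..1}" "t \<in> cbox s1 s2" for h t
        using that s by (intro has_field_derivative_at_within[OF DERIV_cmult[OF dGs(2)]]) auto
      show "(\<lambda>t. \<xi>' t * \<Gamma> (t + h)) integrable_on cbox s1 s2" if "h \<in> {0..1}" for h
        unfolding box_real
        by (intro integrable_continuous_real cont cxi' continuous_at_imp_continuous_on ballI DERIV_isCont[OF dGs(1)])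
          (use s that in auto)
      show "continuous_on ({0..1} \<times> cbox s1 s2) (\<lambda>(h, t). \<xi>' t * Pot (t + h))"
        unfolding split_beta
        by (intro continuous_intros continuous_on_compose2[OF cPot] continuous_on_compose2[OF cxi'[of UNIV]]) (use s in auto)
    qed auto
    then have "((\<lambda>h. - integral {s1..s2} (\<lambda>t. \<xi>' t * \<Gamma> (t + h))) has_real_derivative
      - integral {s1..s2} (\<lambda>t. \<xi>' t * Pot t)) (at 0 within {0..1})"
      by (simp add: DERIV_minus)
    then have "(\<Psi> has_real_derivative - integral {s1..s2} (\<lambda>t. \<xi>' t * Pot t)) (at 0 within {0..1})"
      by (rule has_field_derivative_transform_within[where d = 1]) (use Psi_eq in auto)
    then show ?thesis
      unfolding has_field_derivative_iff by (simp add: at_within_Icc_at_right)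
  qed
  define hn where "hn n = 1 / (real n + 1)" for n
  have hn: "0 < hn n" for n by (simp add: hn_def)
  have hn0: "filterlim hn (at_right 0) sequentially"
    unfolding filterlim_at
  proof (intro conjI always_eventually allI)
    show "hn \<longlonglongrightarrow> 0" using LIMSEQ_inverse_real_of_nat by (simp add: hn_def[abs_def] inverse_eq_divide add.commute)
    show "hn n \<in> {0<..}" "hn n \<noteq> 0" for n using hn[of n] by auto
  qed
  have "(\<lambda>n. (\<Psi> (hn n) - \<Psi> 0) / hn n) \<longlonglongrightarrow> - integral {s1..s2} (\<lambda>t. \<xi>' t * Pot t)"
    by (rule filterlim_compose[OF dPsi hn0])
  moreover have "(\<lambda>n. - (LINT z|lborel. H z * Y (hn n) z)) \<longlonglongrightarrow> - (LINT z|lborel. H z * Y0 z)"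
  proof (intro tendsto_minus integral_dominated_convergence[where w = "\<lambda>z. q * (\<bar>Gx z\<bar> * indicator bx z) + q * (2 * c * R) * indicator bx z"])
    have q0: "0 \<le> q" using X MW by (simp add: q_def)
    have "(\<lambda>z::real \<times> real. 2 * c * fst z) \<in> borel_measurable borel"
      by (intro borel_measurable_continuous_onI continuous_intros)
    then have Hm: "H \<in> borel_measurable lborel"
      unfolding H_def[abs_def] using G(1) by (intro borel_measurable_add) auto
    show "(\<lambda>z. H z * Y0 z) \<in> borel_measurable lborel"
      using Hm Y0m by (intro borel_measurable_times) auto
    show "(\<lambda>z. H z * Y (hn n) z) \<in> borel_measurable lborel" for n
      using Hm Ym[OF hn[of n]] by (intro borel_measurable_times) auto
    have "integrable lborel (\<lambda>z. \<bar>Gx z\<bar> * indicator bx z)"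
      using L2_times_bounded_integrable[of "\<lambda>z. \<bar>Gx z\<bar>" "indicator bx" 1 "(-R, s1)" "(R, s2)"] G
      by (auto simp: bx_def)
    moreover have "integrable lborel (indicator bx :: real \<times> real \<Rightarrow> real)"
      unfolding bx_def by (intro integrable_real_indicator emeasure_lborel_cbox_finite) simp
    ultimately show "integrable lborel (\<lambda>z. q * (\<bar>Gx z\<bar> * indicator bx z) + q * (2 * c * R) * indicator bx z)"
      by (intro Bochner_Integration.integrable_add integrable_mult_right)
    show "AE z in lborel. norm (H z * Y (hn n) z) \<le> q * (\<bar>Gx z\<bar> * indicator bx z) + q * (2 * c * R) * indicator bx z" for n
    proof (rule AE_I2)
      fix z :: "real \<times> real"
      show "norm (H z * Y (hn n) z) \<le> q * (\<bar>Gx z\<bar> * indicator bx z) + q * (2 * c * R) * indicator bx z"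
      proof (cases "z \<in> bx")
        case True
        have "\<bar>fst z\<bar> \<le> R" using True by (auto simp: bxs abs_le_iff)
        then have "2 * c * \<bar>fst z\<bar> \<le> 2 * c * R" using params by (intro mult_left_mono) auto
        have "\<bar>H z\<bar> \<le> \<bar>Gx z\<bar> + 2 * c * R"
        proof -
          have "\<bar>2 * c * fst z\<bar> = 2 * c * \<bar>fst z\<bar>" using params by (simp add: abs_mult)
          then show ?thesis
            unfolding H_def using abs_triangle_ineq[of "Gx z" "2 * c * fst z"] \<open>2 * c * \<bar>fst z\<bar> \<le> 2 * c * R\<close> by linarith
        qed
        then have "\<bar>H z\<bar> * \<bar>Y (hn n) z\<bar> \<le> (\<bar>Gx z\<bar> + 2 * c * R) * q"
          using Yb[OF hn[of n], of z] True by (intro mult_mono) auto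
        then show ?thesis using True by (simp add: abs_mult algebra_simps)
      qed (simp add: Y_def)
    qed
    show "AE z in lborel. (\<lambda>n. H z * Y (hn n) z) \<longlonglongrightarrow> H z * Y0 z"
    proof (rule AE_I2)
      fix z
      show "(\<lambda>n. H z * Y (hn n) z) \<longlonglongrightarrow> H z * Y0 z"
      proof (cases "z \<in> bx")
        case True
        then have "T0 < snd z" "- R \<le> fst z" using s by (auto simp: bxs)
        from N_deriv_t[OF this]
        have "((\<lambda>h. (N (fst z) (snd z + h) - N (fst z) (snd z)) / h) \<longlongrightarrow> \<mu> (fst z) (snd z) * p (fst z) (snd z)) (at 0)"
          by (simp add: DERIV_def)
        then have "((\<lambda>h. (N (fst z) (snd z + h) - N (fst z) (snd z)) / h) \<longlongrightarrow> \<mu> (fst z) (snd z) * p (fst z) (snd z)) (at_right 0)"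
          by (rule filterlim_mono) (auto simp: at_le)
        from filterlim_compose[OF this hn0] show ?thesis
          unfolding Y_def Y0_def by (intro tendsto_intros)
      qed (simp add: Y_def Y0_def)
    qed
  qed
  ultimately have "- (LINT z|lborel. H z * Y0 z) \<le> - integral {s1..s2} (\<lambda>t. \<xi>' t * Pot t)"
    by (intro LIMSEQ_le[of _ _ "\<lambda>n. (\<Psi> (hn n) - \<Psi> 0) / hn n"]) (use ineq hn in auto)
  then show ?thesis by (simp add: H_def Y0_def)
qed

text \<open>\<open>X\<close> stands for the square root of the energy decay factor. A weighted
  average of Pot - \<kappa> over the window is small because Pot - \<kappa> \<le> D / 2; the value
  at \<tau> exceeds the average by at most the integral of pressure gradient times flux. Young with
  weight \<open>X\<close> splits that integral into X K^2 and (integral of D) / X, both of order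
  \<open>X\<close>.\<close>

lemma potential_rate:
  assumes rho: "0 < \<rho>" "T0 + \<rho> < \<tau>"
    and H1: "H1_norm_le (UNIV \<times> {\<tau> - \<rho><..<\<tau> + \<rho>}) (\<lambda>(x, t). \<mu> x t powr \<theta>) K"
    and kap: "\<And>t. T0 < t \<Longrightarrow> \<kappa> \<le> Pot t" "\<And>t. T0 < t \<Longrightarrow> 0 \<le> En t + \<kappa>"
    and X: "0 < X" "En \<tau> + \<kappa> \<le> X\<^sup>2 * E0" "X \<le> 1" "0 \<le> E0"
    and Bb: "\<And>x. smooth_bump x \<le> Bb"
  shows "Pot \<tau> - \<kappa> \<le> X * (K\<^sup>2 + 4 * c\<^sup>2 * R ^ 3 * \<rho> + Mb * E0 / (2 * k) + Bb * E0 / (k * \<rho>))"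
proof -
  define U :: "(real \<times> real) set" where "U = UNIV \<times> {\<tau> - \<rho><..<\<tau> + \<rho>}"
  obtain g where g: "set_borel_measurable lborel U g" "set_integrable lborel U (\<lambda>z. (norm (g z))\<^sup>2)"
    "weak_gradient U (\<lambda>(x, t). \<mu> x t powr \<theta>) g"
    "sqrt ((LINT z:U|lborel. ((\<lambda>(x, t). \<mu> x t powr \<theta>) z)\<^sup>2) + (LINT z:U|lborel. (norm (g z))\<^sup>2)) \<le> K"
    using H1 unfolding H1_norm_le_def L2_on_def U_def by blast
  define Gx where "Gx z = indicator U z * fst (g z)" for z
  have Gm: "Gx \<in> borel_measurable lborel"
  proof -
    have "(\<lambda>z. fst (indicator U z *\<^sub>R g z)) \<in> borel_measurable lborel"
      using borel_measurable_continuous_onI[OF continuous_on_fst[OF continuous_on_id]] g(1)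
      unfolding set_borel_measurable_def by (rule measurable_compose[rotated])
    then show ?thesis by (simp add: Gx_def[abs_def])
  qed
  have Gle: "(Gx z)\<^sup>2 \<le> indicator U z *\<^sub>R (norm (g z))\<^sup>2" for z
  proof -
    have "(fst (g z))\<^sup>2 \<le> (norm (g z))\<^sup>2"
      by (cases "g z") (simp add: norm_Pair)
    then show ?thesis by (auto simp: Gx_def indicator_def)
  qed
  have gi: "integrable lborel (\<lambda>z. indicator U z *\<^sub>R (norm (g z))\<^sup>2)"
    using g(2) by (simp add: set_integrable_def)
  have Gi: "integrable lborel (\<lambda>z. (Gx z)\<^sup>2)"
    by (rule Bochner_Integration.integrable_bound[OF gi]) (use Gle Gm in auto)
  have GK: "(LINT z|lborel. (Gx z)\<^sup>2) \<le> K\<^sup>2"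
  proof -
    have "(LINT z|lborel. (Gx z)\<^sup>2) \<le> (LINT z:U|lborel. (norm (g z))\<^sup>2)"
      unfolding set_lebesgue_integral_def by (rule integral_mono[OF Gi gi Gle])
    moreover have "0 \<le> (LINT z:U|lborel. ((\<lambda>(x, t). \<mu> x t powr \<theta>) z)\<^sup>2)"
      unfolding set_lebesgue_integral_def by (rule integral_nonneg_AE) (auto simp: indicator_def)
    moreover have "0 \<le> (LINT z:U|lborel. (norm (g z))\<^sup>2)"
      unfolding set_lebesgue_integral_def by (rule integral_nonneg_AE) (auto simp: indicator_def)
    moreover note sqrt_le_D[OF g(4)]
    ultimately show ?thesis by linarith
  qed
  \<comment> \<open>Half of the window, so that the closed box lies inside the open slab on which
    the weak gradient is given.\<close>
  define s2 where "s2 = \<tau> + \<rho> / 2"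
  have s: "T0 < \<tau>" "\<tau> - \<rho> < \<tau>" "\<tau> \<le> s2" "s2 < \<tau> + \<rho>" "\<tau> < s2" using rho by (auto simp: s2_def)
  define bx where "bx = cbox (-R, \<tau>) (R, s2)"
  have Mb: "0 \<le> Mb" using mu_nonneg[of "T0 + 1" 0] mu_bd[of "T0 + 1" 0] by simp
  define ID where "ID = integral {\<tau>..s2} D"
  have "En s2 - En \<tau> = - k * ID" unfolding ID_def by (rule En_diff) (use s in auto)
  then have "k * ID \<le> X\<^sup>2 * E0" using kap(2)[of s2] X(2) s by linarith
  then have ID: "ID \<le> X\<^sup>2 * E0 / k" using params by (simp add: pos_le_divide_eq mult.commute)
  have iD: "D integrable_on {\<tau>..s2}"
    by (intro integrable_continuous_real continuous_on_subset[OF cD]) (use s in auto)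
  define J where "J z = \<mu> (fst z) (snd z) * p (fst z) (snd z)" for z
  have subbx: "bx \<subseteq> UNIV \<times> {T0<..}" using s by (auto simp: bx_def cbox_Pair_iff)
  have cJ: "continuous_on bx J"
    unfolding J_def
    using continuous_on_subset[OF cmu subbx] continuous_on_subset[OF cp subbx]
    by (auto simp: split_beta intro: continuous_intros)
  have cJ2: "continuous_on bx (\<lambda>z. (J z)\<^sup>2)" by (intro continuous_on_power cJ)
  have iJ: "integrable lborel (\<lambda>z. indicator bx z *\<^sub>R (J z)\<^sup>2)"
    by (rule borel_integrable_compact) (use cJ2 in \<open>auto simp: bx_def\<close>)
  have J2: "(LINT z|lborel. indicator bx z *\<^sub>R (J z)\<^sup>2) \<le> Mb * ID"
  proof -
    have "(LINT z|lborel. indicator bx z *\<^sub>R (J z)\<^sup>2) = integral bx (\<lambda>z. (J z)\<^sup>2)"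
      using set_borel_integral_eq_integral(2)[of bx "\<lambda>z. (J z)\<^sup>2"] iJ
      by (simp add: set_integrable_def set_lebesgue_integral_def)
    also have "\<dots> = integral (cbox (-R) R) (\<lambda>x. integral (cbox \<tau> s2) (\<lambda>t. (J (x, t))\<^sup>2))"
      unfolding bx_def by (rule integral_prod_continuous[OF cJ2[unfolded bx_def]])
    also have "\<dots> = integral (cbox \<tau> s2) (\<lambda>t. integral (cbox (-R) R) (\<lambda>x. (J (x, t))\<^sup>2))"
      by (rule integral_swap_continuous[where f = "\<lambda>x t. (J (x, t))\<^sup>2"]) (use cJ2[unfolded bx_def] in simp)
    also have "\<dots> \<le> integral {\<tau>..s2} (\<lambda>t. Mb * D t)"
      unfolding box_real
    proof (rule integral_le)
      have "continuous_on (UNIV \<times> {T0<..}) (\<lambda>(x, t). (J (x, t))\<^sup>2)"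
        using cmu cp by (auto simp: J_def split_beta intro!: continuous_intros)
      from continuous_on_integral_slice[OF this]
      show "(\<lambda>t. integral {-R..R} (\<lambda>x. (J (x, t))\<^sup>2)) integrable_on {\<tau>..s2}"
        by (intro integrable_continuous_real) (rule continuous_on_subset, use s in auto)
      show "(\<lambda>t. Mb * D t) integrable_on {\<tau>..s2}" using iD by (rule integrable_on_mult_right)
      fix t assume "t \<in> {\<tau>..s2}"
      then have t: "T0 < t" using s by auto
      have "integral {-R..R} (\<lambda>x. (J (x, t))\<^sup>2) \<le> integral {-R..R} (\<lambda>x. Mb * (\<mu> x t * (p x t)\<^sup>2))"
      proof (rule integral_le)
        fix x
        have "\<mu> x t * (\<mu> x t * (p x t)\<^sup>2) \<le> Mb * (\<mu> x t * (p x t)\<^sup>2)"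
          using mu_bd[of t x] mu_nonneg[of t x] t by (intro mult_right_mono) auto
        then show "(J (x, t))\<^sup>2 \<le> Mb * (\<mu> x t * (p x t)\<^sup>2)"
          by (simp add: J_def power2_eq_square mult_ac)
      qed (use t in \<open>auto simp: J_def intro!: integrable_continuous_real cont slices\<close>)
      then show "integral {-R..R} (\<lambda>x. (J (x, t))\<^sup>2) \<le> Mb * D t" by (simp add: D_def)
    qed
    finally show ?thesis by (simp add: ID_def)
  qed
  define Bd where "Bd = X * K\<^sup>2 + 4 * X * c\<^sup>2 * R ^ 3 * \<rho> + Mb * ID / (2 * X)"
  have bump_int: "continuous_on S (\<lambda>t. smooth_bump ((t - \<tau>) / \<epsilon>))" if "0 < \<epsilon>" for \<epsilon> S
    by (intro continuous_intros continuous_on_compose2[OF continuous_on_smooth_bump[of UNIV]]) (use that in auto)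
  have cP: "continuous_on {\<tau>..s2} Pot" by (rule continuous_on_subset[OF cPot]) (use s in auto)
  define \<delta> where "\<delta> = \<rho> / 2"
  have de: "0 < \<delta>" "s2 = \<tau> + \<delta>" using rho by (auto simp: \<delta>_def s2_def)
  define PB where "PB = integral {\<tau>..s2} (\<lambda>t. smooth_bump ((t - \<tau>) / \<delta>) / \<delta> * Pot t)"
  have step: "integral {\<tau>..s2} (\<lambda>t. smooth_bump ((t - \<tau>) / \<epsilon>) / \<epsilon> * Pot t) \<le> PB + Bd" if e: "\<epsilon> \<in> {0<..<\<delta>}" for \<epsilon>
  proof -
    \<comment> \<open>Its derivative is a bump of width \<epsilon> minus the fixed bump of width
      \<delta>, both starting at \<tau>. As \<epsilon> tends to 0 the first reads off Pot \<tau>,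
      the second keeps the average \<open>PB\<close>. The steeper step is the larger one, so \<xi>
      is nonnegative.\<close>
    define \<xi> where "\<xi> t = smooth_step ((t - \<tau>) / \<epsilon>) + (-1) * smooth_step ((t - \<tau>) / \<delta>)" for t
    define \<xi>' where "\<xi>' t = smooth_bump ((t - \<tau>) / \<epsilon>) / \<epsilon> + (-1) * (smooth_bump ((t - \<tau>) / \<delta>) / \<delta>)" for t
    have Cx: "Ck_on n \<xi> UNIV" for n
      unfolding \<xi>_def by (intro Ck_on_add Ck_on_mult Ck_on_const Ck_on_scale_shift Ck_on_smooth_step)
    have dx: "(\<xi> has_real_derivative \<xi>' x) (at x)" for x
      unfolding \<xi>_def \<xi>'_def by (intro DERIV_add DERIV_cmult smooth_step_scaled_deriv)
    have cx: "continuous_on UNIV \<xi>'"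
      unfolding \<xi>'_def using e de by (intro cont bump_int) auto
    have x0: "\<xi> t = 0" if "t \<notin> {\<tau><..<s2}" for t
    proof -
      have "t \<le> \<tau> \<or> \<tau> + \<delta> \<le> t" using that de by auto
      then show ?thesis
      proof
        assume "t \<le> \<tau>"
        then have "(t - \<tau>) / \<epsilon> \<le> 0" "(t - \<tau>) / \<delta> \<le> 0" using e de by (auto simp: divide_le_0_iff)
        then show ?thesis by (simp add: \<xi>_def smooth_step_0)
      next
        assume "\<tau> + \<delta> \<le> t"
        then have "1 \<le> (t - \<tau>) / \<epsilon>" "1 \<le> (t - \<tau>) / \<delta>" using e de by (auto simp: field_simps)
        then show ?thesis by (simp add: \<xi>_def smooth_step_1)
      qed
    qed
    have xpos: "0 \<le> \<xi> t" for t
    proof (cases "t \<le> \<tau>")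
      case False
      then have "(t - \<tau>) / \<delta> \<le> (t - \<tau>) / \<epsilon>" using e by (intro divide_left_mono) auto
      then show ?thesis using smooth_step_mono by (simp add: \<xi>_def)
    qed (simp add: x0)
    have x1: "\<xi> t \<le> 1" for t
      using smooth_step_bounds[of "(t - \<tau>) / \<epsilon>"] smooth_step_bounds[of "(t - \<tau>) / \<delta>"] by (simp add: \<xi>_def)
    have cxi: "continuous_on bx (\<lambda>z. \<xi> (snd z))"
      by (rule continuous_on_compose2[OF continuous_on_smooth[OF Cx] continuous_on_snd[OF continuous_on_id] subset_UNIV])
    define Y where "Y z = indicator bx z * (\<xi> (snd z) * J z)" for z
    have Ym: "Y \<in> borel_measurable borel"
    proof -
      have "(\<lambda>z. indicator bx z *\<^sub>R (\<xi> (snd z) * J z)) \<in> borel_measurable borel"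
        by (rule borel_measurable_continuous_on_indicator) (auto simp: bx_def intro!: cont cxi[unfolded bx_def] cJ[unfolded bx_def])
      then show ?thesis by (simp add: Y_def[abs_def])
    qed
    have Y2: "(Y z)\<^sup>2 \<le> indicator bx z *\<^sub>R (J z)\<^sup>2" for z
    proof -
      have "(\<xi> (snd z) * J z)\<^sup>2 \<le> 1 * (J z)\<^sup>2"
        unfolding power_mult_distrib using xpos x1 by (intro mult_right_mono) (auto simp: power_le_one_iff abs_square_le_1)
      then show ?thesis by (auto simp: Y_def indicator_def)
    qed
    have pw: "(Gx z + 2 * c * fst z) * Y z \<le> X * (Gx z)\<^sup>2 + 4 * X * c\<^sup>2 * R\<^sup>2 * indicator bx z + 1 / (2 * X) * (indicator bx z *\<^sub>R (J z)\<^sup>2)" for z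
    proof (cases "z \<in> bx")
      case True
      define h where "h = Gx z + 2 * c * fst z"
      \<comment> \<open>The weight \<open>X\<close> balances the bounded factor h, which gets X,
        against the small factor, whose square is of order X^2.\<close>
      have am: "h * Y z \<le> X / 2 * h\<^sup>2 + 1 / (2 * X) * (Y z)\<^sup>2"
      proof -
        have "0 \<le> (X * h - Y z)\<^sup>2" by simp
        then have "2 * X * (h * Y z) \<le> X\<^sup>2 * h\<^sup>2 + (Y z)\<^sup>2" by (simp add: power2_eq_square algebra_simps)
        then have "h * Y z \<le> (X\<^sup>2 * h\<^sup>2 + (Y z)\<^sup>2) / (2 * X)" using X(1) by (simp add: pos_le_divide_eq mult.commute)
        also have "\<dots> = X / 2 * h\<^sup>2 + 1 / (2 * X) * (Y z)\<^sup>2" using X(1) by (simp add: add_divide_distrib power2_eq_square)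
        finally show ?thesis .
      qed
      have h2: "h\<^sup>2 \<le> 2 * (Gx z)\<^sup>2 + 8 * c\<^sup>2 * R\<^sup>2"
      proof -
        have "0 \<le> (Gx z - 2 * c * fst z)\<^sup>2" by simp
        then have "h\<^sup>2 \<le> 2 * (Gx z)\<^sup>2 + 8 * c\<^sup>2 * (fst z)\<^sup>2" by (simp add: h_def power2_eq_square algebra_simps)
        also have "(fst z)\<^sup>2 \<le> R\<^sup>2"
          using True by (cases z) (auto simp: bx_def cbox_Pair_iff abs_le_square_iff[symmetric])
        then have "8 * c\<^sup>2 * (fst z)\<^sup>2 \<le> 8 * c\<^sup>2 * R\<^sup>2" by (intro mult_left_mono) auto
        finally show ?thesis by simp
      qed
      have "h * Y z \<le> X / 2 * (2 * (Gx z)\<^sup>2 + 8 * c\<^sup>2 * R\<^sup>2) + 1 / (2 * X) * (indicator bx z *\<^sub>R (J z)\<^sup>2)"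
        by (rule order_trans[OF am]) (intro add_mono mult_left_mono h2 Y2, use X(1) in auto)
      then show ?thesis using True by (simp add: h_def algebra_simps)
    next
      case False
      then show ?thesis using X(1) by (simp add: Y_def)
    qed
    have iB: "integrable lborel (indicator bx :: real \<times> real \<Rightarrow> real)"
      unfolding bx_def by (intro integrable_real_indicator emeasure_lborel_cbox_finite) simp
    have iR: "integrable lborel (\<lambda>z. X * (Gx z)\<^sup>2 + 4 * X * c\<^sup>2 * R\<^sup>2 * indicator bx z + 1 / (2 * X) * (indicator bx z *\<^sub>R (J z)\<^sup>2))"
      by (intro Bochner_Integration.integrable_add integrable_mult_right Gi iB iJ)
    have R0: "0 \<le> X * (Gx z)\<^sup>2 + 4 * X * c\<^sup>2 * R\<^sup>2 * indicator bx z + 1 / (2 * X) * (indicator bx z *\<^sub>R (J z)\<^sup>2)" for z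
      using X(1) by (intro add_nonneg_nonneg mult_nonneg_nonneg) auto
    have "integral {\<tau>..s2} (\<lambda>t. \<xi>' t * Pot t) \<le> (LINT z|lborel. (Gx z + 2 * c * fst z) * Y z)"
      using potential_weak_decrease[OF s(1,2,3,4) U_def Cx dx cx x0 xpos g(3) Gx_def Gm Gi]
      by (simp add: Y_def J_def bx_def)
    also have "\<dots> \<le> (LINT z|lborel. X * (Gx z)\<^sup>2 + 4 * X * c\<^sup>2 * R\<^sup>2 * indicator bx z + 1 / (2 * X) * (indicator bx z *\<^sub>R (J z)\<^sup>2))"
      by (rule integral_mono_AE') (use iR pw R0 in auto)
    also have "\<dots> = X * (LINT z|lborel. (Gx z)\<^sup>2) + 4 * X * c\<^sup>2 * R\<^sup>2 * measure lborel bx + 1 / (2 * X) * (LINT z|lborel. indicator bx z *\<^sub>R (J z)\<^sup>2)"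
    proof -
      have a: "integrable lborel (\<lambda>z. X * (Gx z)\<^sup>2)"
        and b: "integrable lborel (\<lambda>z. 4 * X * c\<^sup>2 * R\<^sup>2 * indicator bx z)"
        and d: "integrable lborel (\<lambda>z. 1 / (2 * X) * (indicator bx z *\<^sub>R (J z)\<^sup>2))"
        by (intro integrable_mult_right Gi iB iJ)+
      show ?thesis
        unfolding Bochner_Integration.integral_add[OF Bochner_Integration.integrable_add[OF a b] d]
          Bochner_Integration.integral_add[OF a b]
        by simp
    qed
    also have "measure lborel bx = 2 * R * \<delta>"
      using params de by (simp add: bx_def content_Pair)
    also have "X * (LINT z|lborel. (Gx z)\<^sup>2) + 4 * X * c\<^sup>2 * R\<^sup>2 * (2 * R * \<delta>) + 1 / (2 * X) * (LINT z|lborel. indicator bx z *\<^sub>R (J z)\<^sup>2)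
      \<le> X * K\<^sup>2 + 4 * X * c\<^sup>2 * R\<^sup>2 * (2 * R * \<delta>) + 1 / (2 * X) * (Mb * ID)"
      by (intro add_mono mult_left_mono GK J2 order_refl) (use X(1) in auto)
    also have "\<dots> = Bd" by (simp add: Bd_def \<delta>_def power2_eq_square power3_eq_cube)
    finally have 1: "integral {\<tau>..s2} (\<lambda>t. \<xi>' t * Pot t) \<le> Bd" .
    have "integral {\<tau>..s2} (\<lambda>t. smooth_bump ((t - \<tau>) / \<epsilon>) / \<epsilon> * Pot t - smooth_bump ((t - \<tau>) / \<delta>) / \<delta> * Pot t)
      = integral {\<tau>..s2} (\<lambda>t. smooth_bump ((t - \<tau>) / \<epsilon>) / \<epsilon> * Pot t) - PB"
      unfolding PB_def using e de
      by (intro Henstock_Kurzweil_Integration.integral_diff integrable_continuous_real cont bump_int cP) auto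
    moreover have "(\<lambda>t. smooth_bump ((t - \<tau>) / \<epsilon>) / \<epsilon> * Pot t - smooth_bump ((t - \<tau>) / \<delta>) / \<delta> * Pot t) = (\<lambda>t. \<xi>' t * Pot t)"
      by (simp add: \<xi>'_def fun_eq_iff algebra_simps)
    ultimately show ?thesis using 1 by simp
  qed
  have "Pot \<tau> \<le> PB + Bd"
  proof (rule tendsto_upperbound)
    show "((\<lambda>e. integral {\<tau>..s2} (\<lambda>t. smooth_bump ((t - \<tau>) / e) / e * Pot t)) \<longlongrightarrow> Pot \<tau>) (at_right 0)"
      by (rule bump_concentrates[OF cP]) (use s in auto)
    show "\<forall>\<^sub>F e in at_right 0. integral {\<tau>..s2} (\<lambda>t. smooth_bump ((t - \<tau>) / e) / e * Pot t) \<le> PB + Bd"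
      by (rule eventually_mono[OF eventually_at_right_real[OF de(1)]]) (use step in auto)
  qed simp
  \<comment> \<open>The bump of width \<delta> has mass one, so \<kappa> may be subtracted inside
    the average; its height is at most Bb / \<delta> = 2 Bb / \<rho>, and Pot - \<kappa> \<le> D /
    2.\<close>
  moreover have "PB - \<kappa> \<le> Bb * ID / \<rho>"
  proof -
    have h1: "((\<lambda>t. smooth_bump ((t - \<tau>) / \<delta>) / \<delta> * Pot t) has_integral PB) {\<tau>..s2}"
      unfolding PB_def using de by (intro integrable_integral integrable_continuous_real cont bump_int cP) auto
    have "integral {\<tau>..s2} (\<lambda>t. smooth_bump ((t - \<tau>) / \<delta>) / \<delta> * \<kappa>) = integral {0..1} (\<lambda>x. smooth_bump x * \<kappa>)"
      by (rule integral_bump_scaled) (use de in auto)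
    also have "\<dots> = \<kappa>" by (simp add: integral_smooth_bump)
    finally have eq: "integral {\<tau>..s2} (\<lambda>t. smooth_bump ((t - \<tau>) / \<delta>) / \<delta> * \<kappa>) = \<kappa>" .
    have "(\<lambda>t. smooth_bump ((t - \<tau>) / \<delta>) / \<delta> * \<kappa>) integrable_on {\<tau>..s2}"
      using de by (intro integrable_continuous_real cont bump_int) auto
    from integrable_integral[OF this, unfolded eq]
    have h2: "((\<lambda>t. smooth_bump ((t - \<tau>) / \<delta>) / \<delta> * \<kappa>) has_integral \<kappa>) {\<tau>..s2}" .
    have h3: "((\<lambda>t. Bb / \<delta> * (D t / 2)) has_integral Bb / \<delta> * (ID / 2)) {\<tau>..s2}"
      unfolding ID_def using iD by (intro has_integral_mult_right has_integral_divide integrable_integral)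
    have "PB - \<kappa> \<le> Bb / \<delta> * (ID / 2)"
    proof (rule has_integral_le[OF has_integral_diff[OF h1 h2] h3])
      fix t assume "t \<in> {\<tau>..s2}"
      then have t: "T0 < t" using s by auto
      have "Pot t - \<kappa> \<le> D t / 2" using kap(2)[OF t] by (simp add: En_def)
      moreover have "0 \<le> Bb" using Bb[of 0] smooth_bump_nonneg[of 0] by simp
      ultimately have "smooth_bump ((t - \<tau>) / \<delta>) / \<delta> * (Pot t - \<kappa>) \<le> Bb / \<delta> * (D t / 2)"
        using Bb kap(1)[OF t] de by (intro mult_mono divide_right_mono) auto
      then show "smooth_bump ((t - \<tau>) / \<delta>) / \<delta> * Pot t - smooth_bump ((t - \<tau>) / \<delta>) / \<delta> * \<kappa> \<le> Bb / \<delta> * (D t / 2)"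
        by (simp add: right_diff_distrib)
    qed
    then show ?thesis by (simp add: \<delta>_def)
  qed
  ultimately have main: "Pot \<tau> - \<kappa> \<le> X * K\<^sup>2 + 4 * X * c\<^sup>2 * R ^ 3 * \<rho> + Mb * ID / (2 * X) + Bb * ID / \<rho>"
    by (simp add: Bd_def)
  have 1: "Mb * ID / (2 * X) \<le> X * (Mb * E0 / (2 * k))"
  proof -
    have "Mb * ID / (2 * X) \<le> Mb * (X\<^sup>2 * E0 / k) / (2 * X)"
      using Mb X(1) ID by (intro divide_right_mono mult_left_mono) auto
    also have "\<dots> = X * (Mb * E0 / (2 * k))" using X(1) params by (simp add: power2_eq_square field_simps)
    finally show ?thesis .
  qed
  \<comment> \<open>This term is really of order X^2; it is weakened by X \<le> 1 to match the
    others.\<close>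
  have 2: "Bb * ID / \<rho> \<le> X * (Bb * E0 / (k * \<rho>))"
  proof -
    have B0: "0 \<le> Bb" using Bb[of 0] smooth_bump_nonneg[of 0] by simp
    have "X\<^sup>2 * E0 / k \<le> X * E0 / k"
      using X params by (intro divide_right_mono mult_right_mono) (auto simp: power2_eq_square)
    then have "Bb * ID / \<rho> \<le> Bb * (X * E0 / k) / \<rho>"
      using B0 rho ID by (intro divide_right_mono mult_left_mono) auto
    then show ?thesis by (simp add: mult_ac)
  qed
  show ?thesis using main 1 2 by (simp add: distrib_left mult_ac)
qed

end

section \<open>Essential suprema of continuous functions\<close>

lemma AE_le_imp_le_on_open:
  fixes f :: "'a::euclidean_space \<Rightarrow> 'b::real_normed_vector"
  assumes U: "open U" "continuous_on U f" and ae: "AE z in lborel. z \<in> U \<longrightarrow> ereal (norm (f z)) \<le> V"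
    and z: "z \<in> U"
  shows "ereal (norm (f z)) \<le> V"
proof (rule ccontr)
  assume n: "\<not> ereal (norm (f z)) \<le> V"
  define W where "W = U \<inter> (\<lambda>y. ereal (norm (f y))) -` {V<..}"
  have "open W"
    unfolding W_def using U
    by (intro continuous_open_preimage continuous_on_ereal continuous_intros) auto
  moreover have "z \<in> W" using n z by (simp add: W_def)
  ultimately have "\<not> negligible W" using open_not_negligible by blast
  moreover have "W \<in> null_sets lborel"
  proof (rule AE_iff_null_sets[THEN iffD2])
    show "W \<in> sets lborel" using \<open>open W\<close> by simp
    show "AE x in lborel. x \<notin> W" using ae by (rule eventually_mono) (auto simp: W_def)
  qed
  then have "negligible W" by (simp add: negligible_iff_null_sets null_sets_completionI)
  ultimately show False by simp
qed

lemma Linf_norm_AE: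
  assumes "S \<in> sets borel"
  shows "AE z in lborel. z \<in> S \<longrightarrow> ereal (norm (f z)) \<le> Linf_norm S f"
  using esssup_AE[where M = "restrict_space lborel S" and f = "\<lambda>z. ereal (norm (f z))"] assms
  by (simp add: Linf_norm_def AE_restrict_space_iff)

text \<open>An almost everywhere bound on \<open>S\<close> becomes pointwise on an open part of it,
  because a nonempty open set is not null. \<open>S\<close> itself may contain boundary points, such
  as those at the initial time.\<close>

lemma Linf_norm_pointwise:
  fixes f :: "'a::euclidean_space \<Rightarrow> 'b::real_normed_vector"
  assumes "S \<in> sets borel" "open U" "U \<subseteq> S" "continuous_on U f" "Linf_norm S f < \<infinity>" "z \<in> U"
  shows "norm (f z) \<le> real_of_ereal (Linf_norm S f)"
proof -
  have "AE z in lborel. z \<in> U \<longrightarrow> ereal (norm (f z)) \<le> Linf_norm S f"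
    using Linf_norm_AE[OF assms(1), of f] by (rule eventually_mono) (use assms(3) in auto)
  from AE_le_imp_le_on_open[OF assms(2,4) this assms(6)]
  show ?thesis using assms(5) by (cases "Linf_norm S f") auto
qed

lemma Linf_norm_finite:
  fixes f :: "'a::euclidean_space \<Rightarrow> 'b::real_normed_vector"
  assumes "continuous_on S f" "\<And>z. z \<in> S \<Longrightarrow> norm (f z) \<le> b"
  shows "Linf_norm S f < \<infinity>"
proof -
  have "continuous_on S (\<lambda>z. ereal (norm (f z)))" using assms(1) by (intro continuous_on_ereal continuous_intros)
  then have "(\<lambda>z. ereal (norm (f z))) \<in> borel_measurable (restrict_space borel S)"
    by (rule borel_measurable_continuous_on_restrict)
  then have "(\<lambda>z. ereal (norm (f z))) \<in> borel_measurable (restrict_space lborel S)"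
    by (simp add: measurable_cong_sets[OF sets_restrict_space_cong[OF sets_lborel] refl])
  then have "Linf_norm S f \<le> ereal b"
    unfolding Linf_norm_def by (intro esssup_I AE_I2) (auto simp: space_restrict_space assms(2))
  then show ?thesis using order_le_less_trans by fastforce
qed

section \<open>The rescaled solution\<close>

text \<open>The profiles increase pointwise with the height, so equal masses force equality almost
  everywhere, hence at 0 by continuity, where the value is r^(1/\<theta>).\<close>

lemma stationary_mass_unique:
  assumes c: "0 < c" "0 < \<theta>" and r: "0 < r" "(LINT x|lborel. stationary \<theta> c r x) = b"
    and s: "0 < s" "(LINT x|lborel. stationary \<theta> c s x) = b"
  shows "r = s"
proof -
  have supp: "stationary \<theta> c r x = 0" if "x \<notin> {- sqrt (r / c)..sqrt (r / c)}" for r x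
  proof -
    have "sqrt (r / c) < \<bar>x\<bar>" using that by auto
    then have "r / c < x\<^sup>2" by (metis real_sqrt_abs real_sqrt_less_iff)
    then have "r - c * x\<^sup>2 < 0" using c by (simp add: field_simps)
    then show ?thesis by (simp add: stationary_def max_def)
  qed
  have cont: "continuous_on S (stationary \<theta> c r)" for S r
    unfolding stationary_def[abs_def]
    by (intro continuous_on_powr' continuous_intros) (use c in auto)
  have int: "integrable lborel (stationary \<theta> c r)" for r
  proof -
    have "integrable lborel (\<lambda>x. indicator {- sqrt (r / c)..sqrt (r / c)} x *\<^sub>R stationary \<theta> c r x)"
      by (rule borel_integrable_compact) (use cont in auto)
    moreover have "(\<lambda>x. indicator {- sqrt (r / c)..sqrt (r / c)} x *\<^sub>R stationary \<theta> c r x) = stationary \<theta> c r"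
      using supp by (auto simp: fun_eq_iff indicator_def)
    ultimately show ?thesis by simp
  qed
  have *: False if "0 < r" "r < s" "(LINT x|lborel. stationary \<theta> c r x) = (LINT x|lborel. stationary \<theta> c s x)" for r s
  proof -
    have mono: "stationary \<theta> c r x \<le> stationary \<theta> c s x" for x
      unfolding stationary_def using that c by (intro powr_mono2) auto
    have "(LINT x|lborel. stationary \<theta> c s x - stationary \<theta> c r x) = 0"
      using that int by simp
    then have "AE x in lborel. stationary \<theta> c s x - stationary \<theta> c r x = 0"
      by (subst (asm) integral_nonneg_eq_0_iff_AE) (use int mono in auto)
    then have "AE x in lborel. x \<in> UNIV \<longrightarrow> ereal (norm (stationary \<theta> c s x - stationary \<theta> c r x)) \<le> 0"
      by (rule eventually_mono) simp
    then have "ereal (norm (stationary \<theta> c s 0 - stationary \<theta> c r 0)) \<le> 0"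
      by (rule AE_le_imp_le_on_open[rotated 2]) (auto intro!: continuous_intros cont)
    then have "s powr (1 / \<theta>) = r powr (1 / \<theta>)" using that by (simp add: stationary_def zero_ereal_def)
    moreover have "r powr (1 / \<theta>) < s powr (1 / \<theta>)" using that c by (intro powr_less_mono2) auto
    ultimately show False by simp
  qed
  show ?thesis using *[of r s] *[of s r] r s by (cases r s rule: linorder_cases) auto
qed

locale mfg_solution =
  fixes \<theta> \<alpha> k t0 \<tau>0 a R :: real and u m :: "real \<Rightarrow> real \<Rightarrow> real"
  assumes theta: "0 < \<theta>" "\<theta> < 2" and alpha: "\<alpha> = 2 / (2 + \<theta>)" and k_eq: "k = (2 - \<theta>) / (2 + \<theta>)"
    and t0: "0 < t0" "\<tau>0 = ln t0"
    and Cu: "Ck_on 1 (\<lambda>(x, t). u x t) (UNIV \<times> {t0<..})"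
    and cm: "continuous_on (UNIV \<times> {t0..}) (\<lambda>(x, t). m x t)"
    and m_nonneg: "\<And>x t. t0 \<le> t \<Longrightarrow> 0 \<le> m x t"
    and HJu: "HJ_classical \<theta> t0 u m"
    and weak: "continuity_distributional t0 u m"
    and mass: "a = (LINT x|lborel. m x t0)" "0 < a"
    and bdd: "bounded ((\<lambda>(\<eta>, \<tau>). rescaled_density \<alpha> m \<eta> \<tau>) ` (UNIV \<times> {\<tau>0<..}))"
    and uc0: "uniformly_continuous_on (UNIV \<times> {\<tau>0<..}) (\<lambda>(\<eta>, \<tau>). rescaled_density \<alpha> m \<eta> \<tau>)"
    and supp: "closure {(\<eta>, \<tau>). \<tau>0 \<le> \<tau> \<and> rescaled_density \<alpha> m \<eta> \<tau> \<noteq> 0} \<subseteq> {- R..R} \<times> {\<tau>0..}"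
    and Cv: "Ck_on 1 (grad_upto \<tau>0 (rescaled_value \<alpha> u)) {(\<eta>, \<tau>). \<tau>0 \<le> \<tau> \<and> 0 < rescaled_density \<alpha> m \<eta> \<tau>}"
    and Lv: "Linf_on ({- R<..<R} \<times> {\<tau>0<..}) (grad_upto \<tau>0 (rescaled_value \<alpha> u))"
begin

section \<open>The rescaled functions and the equations they satisfy\<close>

definition "\<mu> = rescaled_density \<alpha> m"
definition "v = rescaled_value \<alpha> u"
definition "w \<eta> \<tau> = v \<eta> \<tau> + \<alpha> / 2 * \<eta>\<^sup>2"
definition "c = \<alpha> * (1 - \<alpha>) / 2"
definition "ux x t = deriv (\<lambda>y. u y t) x"
definition "ut x t = deriv (\<lambda>s. u x s) t"
text \<open>The factor combines t^(1 - 2 \<alpha>) from the rescaled value with t^\<alpha> from the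
  chain rule; \<alpha> \<eta> is the derivative of the quadratic shift in \<open>w\<close>.\<close>

definition "p \<eta> \<tau> = exp ((1 - \<alpha>) * \<tau>) * ux (exp (\<alpha> * \<tau>) * \<eta>) (exp \<tau>) + \<alpha> * \<eta>"
definition "z \<eta> \<tau> = (1 - 2 * \<alpha>) * v \<eta> \<tau> + exp ((1 - 2 * \<alpha>) * \<tau>) *
  (ux (exp (\<alpha> * \<tau>) * \<eta>) (exp \<tau>) * (\<alpha> * exp (\<alpha> * \<tau>) * \<eta>) + ut (exp (\<alpha> * \<tau>) * \<eta>) (exp \<tau>) * exp \<tau>)"

lemma params: "1 / 2 < \<alpha>" "\<alpha> < 1" "0 < c" "0 < k" "k = 2 * \<alpha> - 1" "\<alpha> * \<theta> = 2 - 2 * \<alpha>"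
proof -
  show "1 / 2 < \<alpha>" "\<alpha> < 1" "0 < k" "k = 2 * \<alpha> - 1" "\<alpha> * \<theta> = 2 - 2 * \<alpha>"
    using theta by (auto simp: alpha k_eq field_simps)
  then show "0 < c" by (simp add: c_def)
qed

lemma exp_gt: "\<tau>0 < \<tau> \<Longrightarrow> t0 < exp \<tau>" "\<tau>0 \<le> \<tau> \<Longrightarrow> t0 \<le> exp \<tau>"
  using t0 by (metis exp_less_mono exp_ln, metis exp_le_cancel_iff exp_ln)

lemma mu_eq: "\<mu> \<eta> \<tau> = exp (\<alpha> * \<tau>) * m (exp (\<alpha> * \<tau>) * \<eta>) (exp \<tau>)"
  by (simp add: \<mu>_def rescaled_density_def powr_def)

lemma v_eq: "v \<eta> \<tau> = exp ((1 - 2 * \<alpha>) * \<tau>) * u (exp (\<alpha> * \<tau>) * \<eta>) (exp \<tau>)"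
  by (simp add: v_def rescaled_value_def powr_def)

lemma
  shows u_deriv: "\<And>x t. t0 < t \<Longrightarrow> ((\<lambda>(x, t). u x t) has_derivative (\<lambda>h. ux x t * fst h + ut x t * snd h)) (at (x, t))"
    and u_deriv_x: "\<And>x t. t0 < t \<Longrightarrow> ((\<lambda>y. u y t) has_real_derivative ux x t) (at x)"
    and cux: "continuous_on (UNIV \<times> {t0<..}) (\<lambda>(x, t). ux x t)"
    and cut: "continuous_on (UNIV \<times> {t0<..}) (\<lambda>(x, t). ut x t)"
proof -
  have op: "open (UNIV \<times> {t0<..} :: (real \<times> real) set)" by (intro open_Times) auto
  from Cu obtain u' where u': "\<And>z. z \<in> UNIV \<times> {t0<..} \<Longrightarrow> ((\<lambda>(x, t). u x t) has_derivative u' z) (at z within UNIV \<times> {t0<..})"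
    "\<And>h. continuous_on (UNIV \<times> {t0<..}) (\<lambda>z. u' z h)"
    by auto
  have D: "((\<lambda>(x, t). u x t) has_derivative u' (x, t)) (at (x, t))" if "t0 < t" for x t
    using u'(1)[of "(x, t)"] that at_within_open[OF _ op, of "(x, t)"] by auto
  have x: "((\<lambda>y. u y t) has_real_derivative u' (x, t) (1, 0)) (at x)" if "t0 < t" for x t
  proof -
    interpret bounded_linear "u' (x, t)" using D[OF that] by (rule has_derivative_bounded_linear)
    have "((\<lambda>y. (\<lambda>(x, t). u x t) (y, t)) has_derivative (\<lambda>h. u' (x, t) (h, 0))) (at x)"
      by (rule has_derivative_compose[of "\<lambda>y. (y, t)", OF _ D[OF that]]) (auto intro!: derivative_eq_intros)
    moreover have "(\<lambda>h. u' (x, t) (h, 0)) = (\<lambda>h. u' (x, t) (1, 0) * h)"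
    proof
      show "u' (x, t) (h, 0) = u' (x, t) (1, 0) * h" for h
        using scale[of h "(1, 0)"] by (simp add: mult.commute)
    qed
    ultimately show ?thesis by (simp add: has_field_derivative_def)
  qed
  have t: "((\<lambda>s. u x s) has_real_derivative u' (x, t) (0, 1)) (at t)" if "t0 < t" for x t
  proof -
    interpret bounded_linear "u' (x, t)" using D[OF that] by (rule has_derivative_bounded_linear)
    have "((\<lambda>s. (\<lambda>(x, t). u x t) (x, s)) has_derivative (\<lambda>h. u' (x, t) (0, h))) (at t)"
      by (rule has_derivative_compose[of "\<lambda>s. (x, s)", OF _ D[OF that]]) (auto intro!: derivative_eq_intros)
    moreover have "(\<lambda>h. u' (x, t) (0, h)) = (\<lambda>h. u' (x, t) (0, 1) * h)"
    proof
      show "u' (x, t) (0, h) = u' (x, t) (0, 1) * h" for h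
        using scale[of h "(0, 1)"] by (simp add: mult.commute)
    qed
    ultimately show ?thesis by (simp add: has_field_derivative_def)
  qed
  have uxt: "ux x t = u' (x, t) (1, 0)" "ut x t = u' (x, t) (0, 1)" if "t0 < t" for x t
    using x[OF that] t[OF that] by (auto simp: ux_def ut_def DERIV_imp_deriv)
  have split: "u' (x, t) h = ux x t * fst h + ut x t * snd h" if "t0 < t" for x t h
  proof -
    interpret bounded_linear "u' (x, t)" using D[OF that] by (rule has_derivative_bounded_linear)
    have "u' (x, t) h = u' (x, t) (fst h *\<^sub>R (1, 0) + snd h *\<^sub>R (0, 1))" by simp
    also have "\<dots> = fst h *\<^sub>R u' (x, t) (1, 0) + snd h *\<^sub>R u' (x, t) (0, 1)" by (simp only: add scale)
    finally show ?thesis by (simp add: uxt[OF that] mult.commute)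
  qed
  show "((\<lambda>(x, t). u x t) has_derivative (\<lambda>h. ux x t * fst h + ut x t * snd h)) (at (x, t))" if "t0 < t" for x t
  proof -
    have "u' (x, t) = (\<lambda>h. ux x t * fst h + ut x t * snd h)" by (rule ext) (rule split[OF that])
    with D[OF that, of x] show ?thesis by simp
  qed
  show "((\<lambda>y. u y t) has_real_derivative ux x t) (at x)" if "t0 < t" for x t
    using x[OF that] uxt(1)[OF that] by simp
  show "continuous_on (UNIV \<times> {t0<..}) (\<lambda>(x, t). ux x t)"
    by (rule continuous_on_eq[OF u'(2)[of "(1, 0)"]]) (auto simp: uxt)
  show "continuous_on (UNIV \<times> {t0<..}) (\<lambda>(x, t). ut x t)"
    by (rule continuous_on_eq[OF u'(2)[of "(0, 1)"]]) (auto simp: uxt)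
qed

lemma continuous_rescaled:
  assumes "continuous_on (UNIV \<times> {t0<..}) (\<lambda>(x, t). f x t)"
  shows "continuous_on (UNIV \<times> {\<tau>0<..}) (\<lambda>(\<eta>, \<tau>). f (exp (\<alpha> * \<tau>) * \<eta>) (exp \<tau>) :: real)"
proof -
  have "continuous_on (UNIV \<times> {\<tau>0<..}) (\<lambda>y. (\<lambda>(x, t). f x t) (exp (\<alpha> * snd y) * fst y, exp (snd y)))"
    by (rule continuous_on_compose2[OF assms]) (use exp_gt in \<open>auto intro!: continuous_intros\<close>)
  then show ?thesis by (simp add: split_beta)
qed

lemma cmu: "continuous_on (UNIV \<times> {\<tau>0..}) (\<lambda>(\<eta>, \<tau>). \<mu> \<eta> \<tau>)"
proof -
  have "continuous_on (UNIV \<times> {\<tau>0..}) (\<lambda>y. exp (\<alpha> * snd y) * (\<lambda>(x, t). m x t) (exp (\<alpha> * snd y) * fst y, exp (snd y)))"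
    by (intro continuous_intros continuous_on_compose2[OF cm]) (use exp_gt in auto)
  then show ?thesis by (simp add: split_beta mu_eq)
qed

lemma cu: "continuous_on (UNIV \<times> {t0<..}) (\<lambda>(x, t). u x t)"
  using Ck_on_Suc_imp[OF Cu[unfolded One_nat_def]] by (simp only: Ck_on.simps(1))

lemma cv: "continuous_on (UNIV \<times> {\<tau>0<..}) (\<lambda>(\<eta>, \<tau>). v \<eta> \<tau>)"
  using continuous_rescaled[OF cu] by (auto simp: v_eq split_beta intro!: continuous_intros)

lemma cp: "continuous_on (UNIV \<times> {\<tau>0<..}) (\<lambda>(\<eta>, \<tau>). p \<eta> \<tau>)"
  using continuous_rescaled[OF cux] by (auto simp: p_def split_beta intro!: continuous_intros)

lemma cz: "continuous_on (UNIV \<times> {\<tau>0<..}) (\<lambda>(\<eta>, \<tau>). z \<eta> \<tau>)"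
  using continuous_rescaled[OF cux] continuous_rescaled[OF cut] cv
  by (auto simp: z_def split_beta intro!: continuous_intros)

lemma cw: "continuous_on (UNIV \<times> {\<tau>0<..}) (\<lambda>(\<eta>, \<tau>). w \<eta> \<tau>)"
  using cv by (auto simp: w_def split_beta intro!: continuous_intros)

lemma dv_x: "\<tau>0 < \<tau> \<Longrightarrow> ((\<lambda>\<eta>. v \<eta> \<tau>) has_real_derivative p \<eta> \<tau> - \<alpha> * \<eta>) (at \<eta>)"
proof -
  assume t: "\<tau>0 < \<tau>"
  have 1: "((\<lambda>y. u y (exp \<tau>)) has_real_derivative ux (exp (\<alpha> * \<tau>) * \<eta>) (exp \<tau>)) (at (exp (\<alpha> * \<tau>) * \<eta>))"
    by (rule u_deriv_x[OF exp_gt(1)[OF t]])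
  have "((\<lambda>\<eta>. exp (\<alpha> * \<tau>) * \<eta>) has_real_derivative exp (\<alpha> * \<tau>)) (at \<eta>)"
    by (auto intro!: derivative_eq_intros)
  from DERIV_cmult[OF DERIV_chain2[OF 1 this], of "exp ((1 - 2 * \<alpha>) * \<tau>)"]
  have "((\<lambda>\<eta>. v \<eta> \<tau>) has_real_derivative exp ((1 - 2 * \<alpha>) * \<tau>) * (ux (exp (\<alpha> * \<tau>) * \<eta>) (exp \<tau>) * exp (\<alpha> * \<tau>))) (at \<eta>)"
    by (simp add: v_eq)
  moreover have "exp ((1 - 2 * \<alpha>) * \<tau>) * exp (\<alpha> * \<tau>) = exp ((1 - \<alpha>) * \<tau>)"
    by (simp add: exp_add[symmetric] algebra_simps)
  then have "exp ((1 - 2 * \<alpha>) * \<tau>) * (ux (exp (\<alpha> * \<tau>) * \<eta>) (exp \<tau>) * exp (\<alpha> * \<tau>)) = p \<eta> \<tau> - \<alpha> * \<eta>"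
    by (simp add: p_def)
  ultimately show ?thesis by simp
qed

lemma dw_x: "\<tau>0 < \<tau> \<Longrightarrow> ((\<lambda>\<eta>. w \<eta> \<tau>) has_real_derivative p \<eta> \<tau>) (at \<eta>)"
proof -
  assume t: "\<tau>0 < \<tau>"
  have "((\<lambda>\<eta>. \<alpha> / 2 * \<eta>\<^sup>2) has_real_derivative \<alpha> * \<eta>) (at \<eta>)"
    by (auto intro!: derivative_eq_intros)
  from DERIV_add[OF dv_x[OF t] this] show ?thesis by (simp add: w_def)
qed

lemma dv_t: "\<tau>0 < \<tau> \<Longrightarrow> ((\<lambda>\<tau>. v \<eta> \<tau>) has_real_derivative z \<eta> \<tau>) (at \<tau>)"
proof -
  assume t: "\<tau>0 < \<tau>"
  have D: "((\<lambda>(x, t). u x t) has_derivative (\<lambda>h. ux (exp (\<alpha> * \<tau>) * \<eta>) (exp \<tau>) * fst h + ut (exp (\<alpha> * \<tau>) * \<eta>) (exp \<tau>) * snd h)) (at (exp (\<alpha> * \<tau>) * \<eta>, exp \<tau>))"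
    by (rule u_deriv[OF exp_gt(1)[OF t]])
  have "((\<lambda>\<tau>. (exp (\<alpha> * \<tau>) * \<eta>, exp \<tau>)) has_derivative (\<lambda>h. (\<alpha> * exp (\<alpha> * \<tau>) * \<eta> * h, exp \<tau> * h))) (at \<tau>)"
    by (auto intro!: derivative_eq_intros)
  from has_derivative_compose[OF this D]
  have "((\<lambda>\<tau>. u (exp (\<alpha> * \<tau>) * \<eta>) (exp \<tau>)) has_derivative
    (\<lambda>h. (ux (exp (\<alpha> * \<tau>) * \<eta>) (exp \<tau>) * (\<alpha> * exp (\<alpha> * \<tau>) * \<eta>) + ut (exp (\<alpha> * \<tau>) * \<eta>) (exp \<tau>) * exp \<tau>) * h)) (at \<tau>)"
    by (simp add: algebra_simps)
  then have 1: "((\<lambda>\<tau>. u (exp (\<alpha> * \<tau>) * \<eta>) (exp \<tau>)) has_real_derivative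
    ux (exp (\<alpha> * \<tau>) * \<eta>) (exp \<tau>) * (\<alpha> * exp (\<alpha> * \<tau>) * \<eta>) + ut (exp (\<alpha> * \<tau>) * \<eta>) (exp \<tau>) * exp \<tau>) (at \<tau>)"
    by (simp add: has_field_derivative_def)
  have 2: "((\<lambda>\<tau>. exp ((1 - 2 * \<alpha>) * \<tau>)) has_real_derivative (1 - 2 * \<alpha>) * exp ((1 - 2 * \<alpha>) * \<tau>)) (at \<tau>)"
    by (auto intro!: derivative_eq_intros)
  from DERIV_mult[OF 2 1] show ?thesis
    by (simp add: v_eq z_def mult_ac)
qed

lemma dw_t: "\<tau>0 < \<tau> \<Longrightarrow> ((\<lambda>\<tau>. w \<eta> \<tau>) has_real_derivative z \<eta> \<tau>) (at \<tau>)"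
  using DERIV_add[OF dv_t DERIV_const[of "\<alpha> / 2 * \<eta>\<^sup>2"]] by (simp add: w_def)

lemma mu_nonneg: "\<tau>0 \<le> \<tau> \<Longrightarrow> 0 \<le> \<mu> \<eta> \<tau>"
  using m_nonneg exp_gt by (simp add: mu_eq)

text \<open>Since \<alpha> \<theta> = 2 - 2 \<alpha>, u_x^2 and m^\<theta> carry the same power of
  t, and no explicit time dependence survives. The shift by \<alpha> \<eta>^2 / 2 completes the
  square of the drift term; what is left is (k \<alpha> - \<alpha>^2) \<eta>^2 / 2 = - c
  \<eta>^2.\<close>

lemma HJ_rescaled:
  assumes "\<tau>0 < \<tau>"
  shows "z \<eta> \<tau> = - k * w \<eta> \<tau> + (p \<eta> \<tau>)\<^sup>2 / 2 - \<mu> \<eta> \<tau> powr \<theta> - c * \<eta>\<^sup>2"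
proof -
  define x where "x = exp (\<alpha> * \<tau>) * \<eta>"
  define A where "A = exp ((1 - \<alpha>) * \<tau>) * ux x (exp \<tau>)"
  have ut: "ut x (exp \<tau>) = (ux x (exp \<tau>))\<^sup>2 / 2 - m x (exp \<tau>) powr \<theta>"
    using HJu exp_gt(1)[OF assms] by (simp add: HJ_classical_def ux_def ut_def algebra_simps)
  have ex: "exp ((1 - 2 * \<alpha>) * \<tau>) * exp \<tau> = exp ((1 - \<alpha>) * \<tau>) * exp ((1 - \<alpha>) * \<tau>)"
    "exp ((1 - 2 * \<alpha>) * \<tau>) * exp (\<alpha> * \<tau>) = exp ((1 - \<alpha>) * \<tau>)"
    by (simp_all add: exp_add[symmetric] algebra_simps)
  have mu: "\<mu> \<eta> \<tau> powr \<theta> = exp ((1 - \<alpha>) * \<tau>) * exp ((1 - \<alpha>) * \<tau>) * m x (exp \<tau>) powr \<theta>"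
  proof -
    have "\<alpha> * \<tau> * \<theta> = (1 - \<alpha>) * \<tau> + (1 - \<alpha>) * \<tau>"
    proof -
      have "\<alpha> * \<tau> * \<theta> = \<tau> * (\<alpha> * \<theta>)" by simp
      then show ?thesis unfolding params(6) by (simp add: algebra_simps)
    qed
    then have "exp (\<alpha> * \<tau> * \<theta>) = exp ((1 - \<alpha>) * \<tau>) * exp ((1 - \<alpha>) * \<tau>)"
      by (simp only: exp_add)
    then show ?thesis
      using m_nonneg exp_gt(1)[OF assms]
      by (simp add: mu_eq x_def[symmetric] powr_mult exp_powr_real exp_add)
  qed
  have "exp ((1 - 2 * \<alpha>) * \<tau>) * (ut x (exp \<tau>) * exp \<tau>) = (exp ((1 - 2 * \<alpha>) * \<tau>) * exp \<tau>) * ut x (exp \<tau>)"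
    "exp ((1 - 2 * \<alpha>) * \<tau>) * (ux x (exp \<tau>) * (\<alpha> * exp (\<alpha> * \<tau>) * \<eta>))
      = \<alpha> * \<eta> * ((exp ((1 - 2 * \<alpha>) * \<tau>) * exp (\<alpha> * \<tau>)) * ux x (exp \<tau>))"
    by simp_all
  then have "exp ((1 - 2 * \<alpha>) * \<tau>) * (ut x (exp \<tau>) * exp \<tau>) = A\<^sup>2 / 2 - \<mu> \<eta> \<tau> powr \<theta>"
    "exp ((1 - 2 * \<alpha>) * \<tau>) * (ux x (exp \<tau>) * (\<alpha> * exp (\<alpha> * \<tau>) * \<eta>)) = \<alpha> * \<eta> * A"
    unfolding ex ut mu A_def by (simp_all add: power2_eq_square right_diff_distrib)
  then have "z \<eta> \<tau> = - k * v \<eta> \<tau> + \<alpha> * \<eta> * A + A\<^sup>2 / 2 - \<mu> \<eta> \<tau> powr \<theta>"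
    by (simp only: z_def x_def[symmetric] distrib_left params(5)) simp
  moreover have "p \<eta> \<tau> = A + \<alpha> * \<eta>" by (simp add: p_def A_def x_def)
  ultimately show ?thesis
    by (simp add: w_def c_def params(5) power2_eq_square field_simps)
qed

text \<open>The support hypothesis allows the closed interval; at its endpoints the density vanishes
  as a limit of zeros from outside.\<close>

lemma mu_supp:
  assumes t: "\<tau>0 \<le> \<tau>" and R: "R \<le> \<bar>\<eta>\<bar>"
  shows "\<mu> \<eta> \<tau> = 0"
proof -
  have out: "\<mu> \<eta> \<tau> = 0" if "R < \<bar>\<eta>\<bar>" for \<eta>
  proof (rule ccontr)
    assume "\<mu> \<eta> \<tau> \<noteq> 0"
    then have "(\<eta>, \<tau>) \<in> {(\<eta>, \<tau>). \<tau>0 \<le> \<tau> \<and> rescaled_density \<alpha> m \<eta> \<tau> \<noteq> 0}"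
      using t by (simp add: \<mu>_def)
    then have "(\<eta>, \<tau>) \<in> {- R..R} \<times> {\<tau>0..}" by (rule subsetD[OF supp subsetD[OF closure_subset]])
    then show False using that by auto
  qed
  show ?thesis
  proof (cases "R < \<bar>\<eta>\<bar>")
    case False
    have c: "continuous_on UNIV (\<lambda>\<eta>. \<mu> \<eta> \<tau>)" by (rule continuous_on_slice(1)[OF cmu]) (use t in simp)
    define e where "e n = \<eta> + (if 0 \<le> \<eta> then 1 else -1) * (1 / real (Suc n))" for n
    have "e \<longlonglongrightarrow> \<eta> + (if 0 \<le> \<eta> then 1 else -1) * 0"
      unfolding e_def using LIMSEQ_inverse_real_of_nat by (intro tendsto_intros) (simp add: inverse_eq_divide)
    then have "(\<lambda>n. \<mu> (e n) \<tau>) \<longlonglongrightarrow> \<mu> \<eta> \<tau>"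
      using continuous_on_tendsto_compose[OF c, of e \<eta>] by simp
    moreover have "\<mu> (e n) \<tau> = 0" for n
    proof -
      define r where "r = 1 / real (Suc n)"
      have r: "0 < r" by (simp add: r_def)
      have "\<bar>e n\<bar> = \<bar>\<eta>\<bar> + r"
      proof (cases "0 \<le> \<eta>")
        case True
        then have "e n = \<eta> + r" by (simp add: e_def r_def)
        then show ?thesis using True r by linarith
      next
        case False
        then have "e n = \<eta> - r" by (simp add: e_def r_def)
        then show ?thesis using False r by linarith
      qed
      then have "R < \<bar>e n\<bar>" using R r by linarith
      then show ?thesis by (rule out)
    qed
    ultimately show ?thesis by (simp add: LIMSEQ_const_iff)
  qed (rule out)
qed

lemma m_supp:
  assumes "t0 \<le> t" "R * t powr \<alpha> \<le> \<bar>x\<bar>"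
  shows "m x t = 0"
proof -
  have tp: "0 < t" using assms t0 by simp
  define \<eta> where "\<eta> = x / t powr \<alpha>"
  have "\<mu> \<eta> (ln t) = 0"
  proof (rule mu_supp)
    show "\<tau>0 \<le> ln t" using assms t0 tp by simp
    show "R \<le> \<bar>\<eta>\<bar>" using assms tp by (simp add: \<eta>_def abs_divide pos_le_divide_eq)
  qed
  moreover have "exp (\<alpha> * ln t) = t powr \<alpha>" using tp by (simp add: powr_def)
  ultimately show ?thesis using tp by (simp add: mu_eq \<eta>_def)
qed

lemma R_pos: "0 < R"
proof (rule ccontr)
  assume "\<not> 0 < R"
  then have "m x t0 = 0" for x
    using m_supp[of t0 x] t0 mult_nonpos_nonneg[of R "t0 powr \<alpha>"] by auto
  then show False using mass by simp
qed

text \<open>Mass is invariant under the rescaling, so the rescaled cumulative mass is the original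
  one along the curve (e^(\<alpha> \<tau>) \<eta>, e^\<tau>). The moving endpoint contributes
  \<alpha> \<eta> \<mu>, which together with the flux of \<open>u\<close> makes up \<mu> p.\<close>

lemma flux_rescaled:
  assumes t: "\<tau>0 < \<tau>" and y: "- R \<le> \<eta>"
  shows "((\<lambda>\<tau>. integral {-R..\<eta>} (\<lambda>x. \<mu> x \<tau>)) has_real_derivative \<mu> \<eta> \<tau> * p \<eta> \<tau>) (at \<tau>)"
proof -
  \<comment> \<open>A time horizon just beyond the current time; up to it the support of
    \<open>m\<close> stays in [-L, L].\<close>
  define T where "T = exp (\<tau> + 1)"
  define L where "L = R * T powr \<alpha>"
  define U where "U = {\<tau>0<..<\<tau> + 1}"
  define J where "J x t = m x t * deriv (\<lambda>y. u y t) x" for x t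
  have U: "open U" "convex U" "\<tau> \<in> U" using t by (auto simp: U_def)
  have eU: "t0 < exp s" "exp s < T" if "s \<in> U" for s using that exp_gt(1) by (auto simp: U_def T_def)
  have L: "0 < L" using R_pos by (simp add: L_def T_def)
  have sub: "UNIV \<times> {t0<..<T} \<subseteq> UNIV \<times> {t0..}" "UNIV \<times> {t0<..<T} \<subseteq> UNIV \<times> {t0<..}" by auto
  have cm': "continuous_on (UNIV \<times> {t0<..<T}) (\<lambda>(x, t). m x t)"
    by (rule continuous_on_subset[OF cm sub(1)])
  have cJ: "continuous_on (UNIV \<times> {t0<..<T}) (\<lambda>(x, t). J x t)"
    using cm' continuous_on_subset[OF cux sub(2)]
    by (auto simp: J_def ux_def split_beta intro!: continuous_intros)
  have z: "m x t = 0" if "t0 < t" "t < T" "L \<le> \<bar>x\<bar>" for x t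
  proof (rule m_supp)
    have "t powr \<alpha> \<le> T powr \<alpha>" using that t0 params by (intro powr_mono2) auto
    then have "R * t powr \<alpha> \<le> L" unfolding L_def using R_pos by (intro mult_left_mono) auto
    then show "R * t powr \<alpha> \<le> \<bar>x\<bar>" using that by simp
  qed (use that in simp)
  have zJ: "J x t = 0" if "t0 < t" "t < T" "L \<le> \<bar>x\<bar>" for x t
    using z[OF that] by (simp add: J_def)
  define n where "n y t = integral {-L..y} (\<lambda>x. m x t)" for y t
  have nt: "((\<lambda>t. n y t) has_real_derivative J y t) (at t)" if "t0 < t" "t < T" "-L \<le> y" for y t
    unfolding n_def
  proof (rule weak_continuity_flux_deriv[OF cm' cJ _ z zJ that L])
    show "(LINT z:UNIV \<times> {t0<..}|lborel. (case z of (x, t) \<Rightarrow> - m x t * frechet_derivative \<phi> (at (x, t)) (0, 1)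
        + J x t * frechet_derivative \<phi> (at (x, t)) (1, 0))) = 0"
      if "test_function (UNIV \<times> {t0<..}) \<phi>" for \<phi>
      using weak that unfolding continuity_distributional_def J_def by blast
  qed
  have expa: "exp (\<alpha> * s) = exp s powr \<alpha>" for s :: real by (simp add: powr_def)
  have yL: "- L < exp (\<alpha> * s) * \<eta>" if "s \<in> U" for s
  proof -
    have "exp (\<alpha> * s) < T powr \<alpha>"
      unfolding expa using eU[OF that] params by (intro powr_less_mono2) auto
    then have "exp (\<alpha> * s) * R < L" unfolding L_def using R_pos by (simp add: mult.commute)
    moreover have "exp (\<alpha> * s) * (- R) \<le> exp (\<alpha> * s) * \<eta>" using y by (intro mult_left_mono) auto
    ultimately show ?thesis by simp
  qed
  have cms: "continuous_on S (\<lambda>x. m x t)" if "t0 \<le> t" for S t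
    by (rule continuous_on_slice(1)[OF cm]) (use that in simp)
  have N: "integral {-R..\<eta>} (\<lambda>x. \<mu> x s) = n (exp (\<alpha> * s) * \<eta>) (exp s)" if s: "s \<in> U" for s
  proof -
    define E where "E = exp (\<alpha> * s)"
    have E: "0 < E" by (simp add: E_def)
    have Ey: "E * (-R) \<le> E * \<eta>" using y E by (intro mult_left_mono) auto
    have "((\<lambda>x. m x (exp s)) has_integral integral {E * (-R)..E * \<eta>} (\<lambda>x. m x (exp s))) (cbox (E * (-R)) (E * \<eta>))"
      unfolding box_real using eU[OF s] by (intro integrable_integral integrable_continuous_real cms) simp
    from has_integral_mult_right[OF has_integral_affinity'[OF this E, of 0], of E]
    have "((\<lambda>x. E * m (E * x) (exp s)) has_integral integral {E * (-R)..E * \<eta>} (\<lambda>x. m x (exp s))) {-R..\<eta>}"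
      using E by (simp add: field_simps)
    then have "integral {-R..\<eta>} (\<lambda>x. \<mu> x s) = integral {E * (-R)..E * \<eta>} (\<lambda>x. m x (exp s))"
      unfolding mu_eq E_def[symmetric] by (rule integral_unique)
    also have "\<dots> = n (E * \<eta>) (exp s)"
    proof -
      have le: "- L \<le> E * (-R)"
      proof -
        have "exp (\<alpha> * s) \<le> T powr \<alpha>"
          unfolding expa using eU[OF s] params by (intro powr_mono2) auto
        then show ?thesis unfolding L_def E_def using R_pos by (simp add: mult.commute)
      qed
      have "integral {-L..E * (-R)} (\<lambda>x. m x (exp s)) = integral {-L..E * (-R)} (\<lambda>_. 0::real)"
      proof (rule integral_cong)
        fix x assume "x \<in> {-L..E * (-R)}"
        then have "R * exp s powr \<alpha> \<le> - x" by (simp add: E_def expa[symmetric] mult.commute)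
        then have "R * exp s powr \<alpha> \<le> \<bar>x\<bar>" by linarith
        then show "m x (exp s) = 0" using eU[OF s] by (intro m_supp) auto
      qed
      moreover have "integral {-L..E * (-R)} (\<lambda>x. m x (exp s)) + integral {E * (-R)..E * \<eta>} (\<lambda>x. m x (exp s)) = n (E * \<eta>) (exp s)"
        unfolding n_def
        by (rule Henstock_Kurzweil_Integration.integral_combine)
          (use le Ey eU[OF s] in \<open>auto intro!: integrable_continuous_real cms\<close>)
      ultimately show ?thesis by simp
    qed
    finally show ?thesis by (simp add: E_def)
  qed
  define E where "E = exp (\<alpha> * \<tau>)"
  have d1: "((\<lambda>s. n (exp (\<alpha> * s) * \<eta>) (exp \<tau>)) has_real_derivative m (E * \<eta>) (exp \<tau>) * (\<alpha> * E * \<eta>)) (at \<tau>)"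
  proof (rule DERIV_chain2[where f = "\<lambda>y. n y (exp \<tau>)" and g = "\<lambda>s. exp (\<alpha> * s) * \<eta>"])
    show "((\<lambda>s. exp (\<alpha> * s) * \<eta>) has_real_derivative \<alpha> * E * \<eta>) (at \<tau>)"
      by (auto intro!: derivative_eq_intros simp: E_def)
    have "((\<lambda>y. n y (exp \<tau>)) has_real_derivative m (E * \<eta>) (exp \<tau>)) (at (E * \<eta>) within {-L..E * \<eta> + 1})"
      unfolding n_def using yL[OF U(3)] eU[OF U(3)] by (intro integral_has_real_derivative cms) (auto simp: E_def)
    then show "((\<lambda>y. n y (exp \<tau>)) has_real_derivative m (E * \<eta>) (exp \<tau>)) (at (exp (\<alpha> * \<tau>) * \<eta>))"
      using yL[OF U(3)] by (simp add: at_within_Icc_at E_def)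
  qed
  have d2: "((\<lambda>r. n (exp (\<alpha> * s) * \<eta>) (exp r)) has_real_derivative J (exp (\<alpha> * s) * \<eta>) (exp r) * exp r) (at r)"
    if "s \<in> U" "r \<in> U" for s r
    by (rule DERIV_chain2[OF nt DERIV_exp]) (use eU[OF that(2)] yL[OF that(1)] in auto)
  have c2: "continuous_on (U \<times> U) (\<lambda>(s, r). J (exp (\<alpha> * s) * \<eta>) (exp r) * exp r)"
  proof -
    have "continuous_on (U \<times> U) (\<lambda>y. (\<lambda>(x, t). J x t) (exp (\<alpha> * fst y) * \<eta>, exp (snd y)) * exp (snd y))"
      by (intro continuous_intros continuous_on_compose2[OF cJ]) (use eU in auto)
    then show ?thesis by (simp add: split_beta)
  qed
  have "((\<lambda>s. n (exp (\<alpha> * s) * \<eta>) (exp s)) has_real_derivative m (E * \<eta>) (exp \<tau>) * (\<alpha> * E * \<eta>) + J (E * \<eta>) (exp \<tau>) * exp \<tau>) (at \<tau>)"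
    using has_real_derivative_diagonal[where f = "\<lambda>s r. n (exp (\<alpha> * s) * \<eta>) (exp r)" and g = "\<lambda>s r. J (exp (\<alpha> * s) * \<eta>) (exp r) * exp r", OF U d1 d2 c2]
    by (simp add: E_def)
  then have "((\<lambda>s. integral {-R..\<eta>} (\<lambda>x. \<mu> x s)) has_real_derivative m (E * \<eta>) (exp \<tau>) * (\<alpha> * E * \<eta>) + J (E * \<eta>) (exp \<tau>) * exp \<tau>) (at \<tau>)"
    by (rule has_field_derivative_transform_within_open[OF _ U(1,3)]) (simp add: N)
  moreover have "m (E * \<eta>) (exp \<tau>) * (\<alpha> * E * \<eta>) + J (E * \<eta>) (exp \<tau>) * exp \<tau> = \<mu> \<eta> \<tau> * p \<eta> \<tau>"
  proof -
    have "E * exp ((1 - \<alpha>) * \<tau>) = exp \<tau>" by (simp add: E_def exp_add[symmetric] algebra_simps)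
    moreover have "\<mu> \<eta> \<tau> * p \<eta> \<tau> = m (E * \<eta>) (exp \<tau>) * (\<alpha> * E * \<eta>) + m (E * \<eta>) (exp \<tau>) * ux (E * \<eta>) (exp \<tau>) * (E * exp ((1 - \<alpha>) * \<tau>))"
      by (simp add: mu_eq p_def E_def algebra_simps)
    ultimately show ?thesis by (simp add: J_def ux_def)
  qed
  ultimately show ?thesis by simp
qed

section \<open>Gradients on the positivity set and their values at the initial time\<close>

definition "S = {(\<eta>, \<tau>). \<tau>0 \<le> \<tau> \<and> 0 < \<mu> \<eta> \<tau>}"
definition "S' = {(\<eta>, \<tau>). \<tau>0 < \<tau> \<and> 0 < \<mu> \<eta> \<tau>}"
definition "Dv = (\<lambda>(\<eta>, \<tau>). (p \<eta> \<tau> - \<alpha> * \<eta>, z \<eta> \<tau>))"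
definition "Dw = (\<lambda>(\<eta>, \<tau>). (p \<eta> \<tau>, z \<eta> \<tau>))"

lemma grad_v: "\<tau>0 < snd y \<Longrightarrow> grad_upto \<tau>0 v y = Dv y"
  using DERIV_imp_deriv[OF dv_x] DERIV_imp_deriv[OF dv_t] by (cases y) (simp add: grad_upto_def Dv_def)

lemma grad_w: "\<tau>0 < snd y \<Longrightarrow> grad_upto \<tau>0 w y = Dw y"
  using DERIV_imp_deriv[OF dw_x] DERIV_imp_deriv[OF dw_t] by (cases y) (simp add: grad_upto_def Dw_def)

lemma cDv: "continuous_on (UNIV \<times> {\<tau>0<..}) Dv"
  using cp cz by (auto simp: Dv_def split_beta intro!: continuous_intros)

lemma S_openin: "openin (top_of_set (UNIV \<times> {\<tau>0..})) S"
proof -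
  have "S = (UNIV \<times> {\<tau>0..}) \<inter> (\<lambda>(\<eta>, \<tau>). \<mu> \<eta> \<tau>) -` {0<..}" by (auto simp: S_def)
  then show ?thesis using continuous_openin_preimage_gen[OF cmu, of "{0<..}"] by simp
qed

lemma S'_open: "open S'"
proof -
  obtain T where T: "open T" "S = (UNIV \<times> {\<tau>0..}) \<inter> T" using S_openin by (auto simp: openin_open)
  have "S' = S \<inter> (UNIV \<times> {\<tau>0<..})" by (auto simp: S_def S'_def)
  also have "\<dots> = T \<inter> (UNIV \<times> {\<tau>0<..})" unfolding T(2) by auto
  finally show ?thesis using T(1) by (auto intro!: open_Int open_Times)
qed

lemma S_borel: "S \<in> sets borel"
proof -
  obtain T where T: "open T" "S = (UNIV \<times> {\<tau>0..}) \<inter> T" using S_openin by (auto simp: openin_open)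
  show ?thesis unfolding T(2)
    by (intro sets.Int borel_closed borel_open closed_Times T(1)) auto
qed

lemma at_initial_nontrivial: "at (\<eta>::real, \<tau>0) within UNIV \<times> {\<tau>0<..} \<noteq> bot"
proof -
  have "UNIV \<times> {\<tau>0<..} - {(\<eta>, \<tau>0)} = (UNIV \<times> {\<tau>0<..} :: (real \<times> real) set)" by auto
  then have "(\<eta>, \<tau>0) islimpt UNIV \<times> {\<tau>0<..}"
    by (simp add: islimpt_in_closure closure_Times)
  then show ?thesis by (simp add: trivial_limit_within)
qed

lemma cgrad_v: "continuous_on S (grad_upto \<tau>0 v)"
  using Ck_on_Suc_imp[OF Cv[unfolded One_nat_def]] by (simp only: Ck_on.simps(1) S_def \<mu>_def v_def)

text \<open>\<open>grad_upto\<close> at the initial time is a \<open>Lim\<close>, which means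
  something only if the limit exists. Continuity on \<open>S\<close> gives the limit from within
  \<open>S\<close>, and \<open>S\<close> is relatively open in the closed half plane, so near the
  point approach within \<open>S\<close> and within the open half plane coincide.\<close>

lemma Dv_limit:
  assumes "0 < \<mu> \<eta> \<tau>0"
  shows "(Dv \<longlongrightarrow> grad_upto \<tau>0 v (\<eta>, \<tau>0)) (at (\<eta>, \<tau>0) within UNIV \<times> {\<tau>0<..})"
proof -
  have zS: "(\<eta>, \<tau>0) \<in> S" using assms by (simp add: S_def)
  obtain T where T: "open T" "S = (UNIV \<times> {\<tau>0..}) \<inter> T" using S_openin by (auto simp: openin_open)
  have "(grad_upto \<tau>0 v \<longlongrightarrow> grad_upto \<tau>0 v (\<eta>, \<tau>0)) (at (\<eta>, \<tau>0) within S)"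
    using cgrad_v zS by (simp add: continuous_on_def)
  then have "(grad_upto \<tau>0 v \<longlongrightarrow> grad_upto \<tau>0 v (\<eta>, \<tau>0)) (at (\<eta>, \<tau>0) within S \<inter> (UNIV \<times> {\<tau>0<..}))"
    by (rule tendsto_within_subset) auto
  moreover have "at (\<eta>, \<tau>0) within S \<inter> (UNIV \<times> {\<tau>0<..}) = at (\<eta>, \<tau>0) within UNIV \<times> {\<tau>0<..}"
  proof (rule at_within_nhd[OF _ T(1)])
    show "(\<eta>, \<tau>0) \<in> T" using zS unfolding T(2) by blast
    have "S \<inter> (UNIV \<times> {\<tau>0<..}) \<inter> T = (UNIV \<times> {\<tau>0<..}) \<inter> T" unfolding T(2) by auto
    then show "S \<inter> (UNIV \<times> {\<tau>0<..}) \<inter> T - {(\<eta>, \<tau>0)} = (UNIV \<times> {\<tau>0<..}) \<inter> T - {(\<eta>, \<tau>0)}" by simp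
  qed
  ultimately have 1: "(grad_upto \<tau>0 v \<longlongrightarrow> grad_upto \<tau>0 v (\<eta>, \<tau>0)) (at (\<eta>, \<tau>0) within UNIV \<times> {\<tau>0<..})" by simp
  show ?thesis
  proof (rule Lim_transform_eventually[OF 1])
    show "\<forall>\<^sub>F y in at (\<eta>, \<tau>0) within UNIV \<times> {\<tau>0<..}. grad_upto \<tau>0 v y = Dv y"
      unfolding eventually_at_filter by (rule always_eventually) (simp add: grad_v mem_Times_iff)
  qed
qed

lemma grad_w_S:
  assumes "y \<in> S"
  shows "grad_upto \<tau>0 w y = grad_upto \<tau>0 v y + (\<alpha> * fst y, 0)"
proof (cases "\<tau>0 < snd y")
  case True
  then show ?thesis by (cases y) (simp add: grad_v grad_w Dv_def Dw_def)
next
  case False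
  obtain \<eta> where y: "y = (\<eta>, \<tau>0)" "0 < \<mu> \<eta> \<tau>0" using assms False by (cases y) (auto simp: S_def)
  have "((\<lambda>y. Dv y + (\<alpha> * fst y, 0)) \<longlongrightarrow> grad_upto \<tau>0 v (\<eta>, \<tau>0) + (\<alpha> * fst (\<eta>, \<tau>0), 0)) (at (\<eta>, \<tau>0) within UNIV \<times> {\<tau>0<..})"
    by (intro tendsto_intros Dv_limit y)
  then have 1: "((\<lambda>(\<eta>, \<tau>). (deriv (\<lambda>y. w y \<tau>) \<eta>, deriv (\<lambda>s. w \<eta> s) \<tau>)) \<longlongrightarrow> grad_upto \<tau>0 v (\<eta>, \<tau>0) + (\<alpha> * fst (\<eta>, \<tau>0), 0)) (at (\<eta>, \<tau>0) within UNIV \<times> {\<tau>0<..})"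
  proof (rule Lim_transform_eventually)
    show "\<forall>\<^sub>F y in at (\<eta>, \<tau>0) within UNIV \<times> {\<tau>0<..}. Dv y + (\<alpha> * fst y, 0)
      = (\<lambda>(\<eta>, \<tau>). (deriv (\<lambda>y. w y \<tau>) \<eta>, deriv (\<lambda>s. w \<eta> s) \<tau>)) y"
      unfolding eventually_at_filter
      by (rule always_eventually) (simp add: Dv_def split_beta mem_Times_iff DERIV_imp_deriv[OF dw_x] DERIV_imp_deriv[OF dw_t])
  qed
  from tendsto_Lim[OF at_initial_nontrivial 1] show ?thesis using y by (simp add: grad_upto_def)
qed

lemma cgrad_w: "continuous_on S (grad_upto \<tau>0 w)"
proof (rule continuous_on_eq)
  show "continuous_on S (\<lambda>y. grad_upto \<tau>0 v y + (\<alpha> * fst y, 0))"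
    by (intro continuous_intros cgrad_v)
qed (simp add: grad_w_S)

text \<open>These are the norms on which the constant may depend. Since \<open>real_of_ereal\<close>
  sends infinity to 0, finiteness of the essential suprema has to be proved before they can serve as
  bounds.\<close>

definition "W = real_of_ereal (Linf_norm S (grad_upto \<tau>0 w))"
definition "Mb = real_of_ereal (Linf_norm (UNIV \<times> {\<tau>0<..}) (\<lambda>(\<eta>, \<tau>). \<mu> \<eta> \<tau>))"

lemma mu_bd: "\<tau>0 \<le> \<tau> \<Longrightarrow> \<mu> \<eta> \<tau> \<le> Mb"
proof -
  have op: "open (UNIV \<times> {\<tau>0<..} :: (real \<times> real) set)" by (intro open_Times) auto
  have c: "continuous_on (UNIV \<times> {\<tau>0<..}) (\<lambda>(\<eta>, \<tau>). \<mu> \<eta> \<tau>)" by (rule continuous_on_subset[OF cmu]) auto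
  obtain b where "\<And>y. y \<in> UNIV \<times> {\<tau>0<..} \<Longrightarrow> norm ((\<lambda>(\<eta>, \<tau>). \<mu> \<eta> \<tau>) y) \<le> b"
    using bdd unfolding bounded_iff \<mu>_def by blast
  then have fin: "Linf_norm (UNIV \<times> {\<tau>0<..}) (\<lambda>(\<eta>, \<tau>). \<mu> \<eta> \<tau>) < \<infinity>" by (rule Linf_norm_finite[OF c])
  have 1: "\<mu> \<eta> \<tau> \<le> Mb" if "\<tau>0 < \<tau>" for \<tau>
    using Linf_norm_pointwise[OF _ op order_refl c fin, of "(\<eta>, \<tau>)"] that op by (auto simp: Mb_def)
  assume "\<tau>0 \<le> \<tau>"
  show ?thesis
  proof (cases "\<tau> = \<tau>0")
    case True
    have "((\<lambda>s. \<mu> \<eta> s) \<longlongrightarrow> \<mu> \<eta> \<tau>0) (at \<tau>0 within {\<tau>0..})"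
      using continuous_on_slice(2)[OF cmu, of "{\<tau>0..}" \<eta>] by (simp add: continuous_on_def)
    then have "((\<lambda>s. \<mu> \<eta> s) \<longlongrightarrow> \<mu> \<eta> \<tau>0) (at_right \<tau>0)" by (rule tendsto_within_subset) auto
    then show ?thesis unfolding True
    proof (rule tendsto_upperbound)
      show "\<forall>\<^sub>F s in at_right \<tau>0. \<mu> \<eta> s \<le> Mb"
        unfolding eventually_at_filter by (rule always_eventually) (simp add: 1)
    qed simp
  qed (use 1 \<open>\<tau>0 \<le> \<tau>\<close> in auto)
qed

text \<open>Finiteness first: the gradient of \<open>v\<close> is continuous on the open strip, so
  its essential bound is pointwise there; it extends to initial points of \<open>S\<close> as a
  limit, and \<alpha> \<eta> adds at most \<alpha> R. Then the essential supremum of the gradient of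
  \<open>w\<close> is a pointwise bound on the open part of \<open>S\<close>.\<close>

lemma p_bd: "\<tau>0 < \<tau> \<Longrightarrow> 0 < \<mu> \<eta> \<tau> \<Longrightarrow> \<bar>p \<eta> \<tau>\<bar> \<le> W"
proof -
  define O' where "O' = {-R<..<R} \<times> {\<tau>0<..}"
  have op: "open O'" unfolding O'_def by (intro open_Times) auto
  have "Linf_norm O' (grad_upto \<tau>0 v) < \<infinity>" using Lv by (simp add: Linf_on_def O'_def v_def)
  moreover have "continuous_on O' (grad_upto \<tau>0 v)"
    by (rule continuous_on_eq[OF continuous_on_subset[OF cDv, of O']]) (auto simp: O'_def grad_v)
  ultimately have b: "norm (grad_upto \<tau>0 v y) \<le> real_of_ereal (Linf_norm O' (grad_upto \<tau>0 v))" if "y \<in> O'" for y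
    using Linf_norm_pointwise[OF _ op order_refl _ _ that] op by auto
  define B where "B = real_of_ereal (Linf_norm O' (grad_upto \<tau>0 v))"
  have S'O: "y \<in> O'" if "y \<in> S'" for y
    using that mu_supp[of "snd y" "fst y"] by (cases y) (force simp: S'_def O'_def)
  have bS: "norm (grad_upto \<tau>0 v y) \<le> B" if y: "y \<in> S" for y
  proof (cases "\<tau>0 < snd y")
    case True
    then have "y \<in> S'" using y by (auto simp: S_def S'_def)
    then show ?thesis using b[OF S'O] by (simp add: B_def)
  next
    case False
    obtain \<eta> where e: "y = (\<eta>, \<tau>0)" "0 < \<mu> \<eta> \<tau>0" using y False by (cases y) (auto simp: S_def)
    have ne: "\<bar>\<eta>\<bar> < R" using mu_supp[of \<tau>0 \<eta>] e by force
    show ?thesis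
      unfolding e(1)
    proof (rule tendsto_upperbound[OF tendsto_norm[OF Dv_limit[OF e(2)]] _ at_initial_nontrivial])
      have "\<forall>\<^sub>F y in nhds (\<eta>, \<tau>0). y \<in> {-R<..<R} \<times> UNIV"
        by (rule eventually_nhds_in_open) (use ne in \<open>auto intro: open_Times\<close>)
      then show "\<forall>\<^sub>F y in at (\<eta>, \<tau>0) within UNIV \<times> {\<tau>0<..}. norm (Dv y) \<le> B"
        unfolding eventually_at_filter
      proof (rule eventually_mono, intro impI)
        fix y :: "real \<times> real" assume "y \<in> {-R<..<R} \<times> UNIV" "y \<in> UNIV \<times> {\<tau>0<..}"
        then have "y \<in> O'" "\<tau>0 < snd y" by (auto simp: O'_def)
        then show "norm (Dv y) \<le> B" using b[of y] grad_v[of y] by (simp add: B_def)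
      qed
    qed
  qed
  have "norm (grad_upto \<tau>0 w y) \<le> B + \<alpha> * R" if y: "y \<in> S" for y
  proof -
    have "\<bar>fst y\<bar> \<le> R" using y mu_supp[of "snd y" "fst y"] by (cases y) (force simp: S_def)
    then have "norm (\<alpha> * fst y, 0::real) \<le> \<alpha> * R"
      using params by (simp add: norm_Pair abs_mult)
    then show ?thesis
      unfolding grad_w_S[OF y] using norm_triangle_ineq[of "grad_upto \<tau>0 v y" "(\<alpha> * fst y, 0)"] bS[OF y] by linarith
  qed
  then have fin: "Linf_norm S (grad_upto \<tau>0 w) < \<infinity>" by (rule Linf_norm_finite[OF cgrad_w])
  assume t: "\<tau>0 < \<tau>" "0 < \<mu> \<eta> \<tau>"
  have "(\<eta>, \<tau>) \<in> S'" "S' \<subseteq> S" using t by (auto simp: S'_def S_def)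
  then have "norm (grad_upto \<tau>0 w (\<eta>, \<tau>)) \<le> W"
    unfolding W_def using Linf_norm_pointwise[OF S_borel S'_open _ _ fin] continuous_on_subset[OF cgrad_w] by blast
  moreover have "grad_upto \<tau>0 w (\<eta>, \<tau>) = (p \<eta> \<tau>, z \<eta> \<tau>)" using t by (simp add: grad_w Dw_def)
  moreover have "\<bar>p \<eta> \<tau>\<bar> \<le> norm (p \<eta> \<tau>, z \<eta> \<tau>)" using norm_fst_le[of "p \<eta> \<tau>" "z \<eta> \<tau>"] by simp
  ultimately show ?thesis by simp
qed

lemma mu_initial_mass: "integral {-R..R} (\<lambda>x. \<mu> x \<tau>0) = a"
proof -
  define E where "E = exp (\<alpha> * \<tau>0)"
  have E: "0 < E" "exp \<tau>0 = t0" "E = t0 powr \<alpha>" using t0 by (auto simp: E_def powr_def)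
  have c: "continuous_on T (\<lambda>x. m x t0)" for T by (rule continuous_on_slice(1)[OF cm]) simp
  have "((\<lambda>x. m x t0) has_integral integral {E * (-R)..E * R} (\<lambda>x. m x t0)) (cbox (E * (-R)) (E * R))"
    unfolding box_real by (intro integrable_integral integrable_continuous_real c)
  from has_integral_mult_right[OF has_integral_affinity'[OF this E(1), of 0], of E]
  have "((\<lambda>x. E * m (E * x) t0) has_integral integral {E * (-R)..E * R} (\<lambda>x. m x t0)) {-R..R}"
    using E(1) by (simp add: field_simps)
  then have "integral {-R..R} (\<lambda>x. \<mu> x \<tau>0) = integral (cbox (E * (-R)) (E * R)) (\<lambda>x. m x t0)"
    unfolding mu_eq E_def[symmetric] E(2) box_real by (rule integral_unique)
  also have "\<dots> = (LINT x:UNIV|lborel. m x t0)"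
  proof (rule set_lebesgue_integral_eq_integral_cbox[symmetric, OF c])
    fix x assume "x \<notin> cbox (E * (-R)) (E * R)"
    then have "R * t0 powr \<alpha> \<le> \<bar>x\<bar>" by (auto simp: E(3)[symmetric] mult.commute)
    then show "m x t0 = 0" by (intro m_supp) auto
  qed simp
  finally show ?thesis by (simp add: mass set_lebesgue_integral_def)
qed

lemma W_nonneg: "0 \<le> W"
proof -
  obtain \<eta> where "0 < \<mu> \<eta> \<tau>0"
  proof (rule ccontr)
    assume n: "\<not> thesis"
    have "\<mu> x \<tau>0 = 0" for x using mu_nonneg[of \<tau>0 x] n that[of x] by force
    then show False using mu_initial_mass mass by simp
  qed
  then have "\<forall>\<^sub>F s in at_right \<tau>0. 0 < \<mu> \<eta> s"
  proof -
    have "((\<lambda>s. \<mu> \<eta> s) \<longlongrightarrow> \<mu> \<eta> \<tau>0) (at \<tau>0 within {\<tau>0..})"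
      using continuous_on_slice(2)[OF cmu, of "{\<tau>0..}" \<eta>] by (simp add: continuous_on_def)
    then have "((\<lambda>s. \<mu> \<eta> s) \<longlongrightarrow> \<mu> \<eta> \<tau>0) (at_right \<tau>0)" by (rule tendsto_within_subset) auto
    then show ?thesis using \<open>0 < \<mu> \<eta> \<tau>0\<close> by (rule order_tendstoD)
  qed
  moreover have "\<forall>\<^sub>F s in at_right \<tau>0. \<tau>0 < s" by (simp add: eventually_at_filter)
  ultimately have "\<forall>\<^sub>F s in at_right \<tau>0. \<tau>0 < s \<and> 0 < \<mu> \<eta> s" by (intro eventually_conj)
  from eventually_happens'[OF trivial_limit_at_right_real this] p_bd[of _ \<eta>]
  show ?thesis by force
qed

sublocale rescaled_flow \<mu> w p z \<tau>0 R \<theta> c k Mb W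
  by unfold_locales
    (use R_pos theta params W_nonneg cmu mu_nonneg mu_supp mu_bd cw cp cz dw_x dw_t HJ_rescaled flux_rescaled p_bd in auto)

lemma N_initial: "N R \<tau>0 = a"
  by (simp add: N_def mu_initial_mass)

sublocale rescaled_flow_uc \<mu> w p z \<tau>0 R \<theta> c k Mb W
  by unfold_locales (use uc0 mass in \<open>simp_all add: \<mu>_def[symmetric] N_initial\<close>)

end

lemma smooth_bump_bounded: "\<exists>b. \<forall>x. smooth_bump x \<le> b"
proof -
  have "compact (smooth_bump ` {0..1})" by (intro compact_continuous_image continuous_on_smooth_bump) auto
  then obtain b where "\<forall>y\<in>smooth_bump ` {0..1}. \<bar>y\<bar> \<le> b"
    using compact_imp_bounded bounded_real by blast
  then have b: "\<bar>smooth_bump x\<bar> \<le> b" if "x \<in> {0..1}" for x using that by blast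
  have "smooth_bump x \<le> b" for x
  proof (cases "x \<in> {0..1}")
    case False
    then have "smooth_bump x = 0" by (intro smooth_bump_0) auto
    then show ?thesis using b[of 0] smooth_bump_0[of 0] by simp
  qed (use b[of x] in simp)
  then show ?thesis by blast
qed

section \<open>The energy of the solution: identification, sign, decay and rates\<close>

context mfg_solution
begin

definition "r = R_mass \<theta> \<alpha> a"
definition "M = stationary \<theta> c r"
definition "\<kappa> = PF M"
definition "E \<tau> = energy \<theta> \<alpha> a \<tau>0 w \<mu> \<tau>"

text \<open>The definite description in \<open>R_mass\<close> is resolved here: existence comes from
  the long-time limit in \<open>energy_lower_bound\<close>, uniqueness from
  \<open>stationary_mass_unique\<close>. The limit profile is therefore the one named in the
  energy.\<close>

lemma
  shows M_mass: "integral {-R..R} M = a"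
    and M_supp: "R \<le> \<bar>x\<bar> \<Longrightarrow> M x = 0"
    and En_lower: "\<tau>0 < \<tau> \<Longrightarrow> - \<kappa> \<le> En \<tau>"
proof -
  obtain s where s: "0 < s" "integral {-R..R} (stationary \<theta> c s) = N R \<tau>0"
    "\<And>x. R \<le> \<bar>x\<bar> \<Longrightarrow> stationary \<theta> c s x = 0"
    "\<And>t. \<tau>0 < t \<Longrightarrow> - PF (stationary \<theta> c s) \<le> En t"
    by (rule energy_lower_bound) (rule that)
  have "continuous_on (cbox (-R) R) (stationary \<theta> c s)"
    unfolding stationary_def[abs_def]
    by (intro continuous_on_powr' continuous_intros) (use theta in auto)
  then have "(LINT x:UNIV|lborel. stationary \<theta> c s x) = integral (cbox (-R) R) (stationary \<theta> c s)"
    by (rule set_lebesgue_integral_eq_integral_cbox) (auto intro!: s(3))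
  then have sa: "(LINT x|lborel. stationary \<theta> c s x) = a"
    using s(2) by (simp add: set_lebesgue_integral_def N_initial)
  have "r = (THE q. 0 < q \<and> (LINT x|lborel. stationary \<theta> c q x) = a)"
    by (simp add: r_def R_mass_def stationary_def c_def)
  also have "\<dots> = s"
    by (rule the_equality) (use s(1) sa stationary_mass_unique params theta in auto)
  finally have "r = s" .
  then show "integral {-R..R} M = a" "R \<le> \<bar>x\<bar> \<Longrightarrow> M x = 0" "\<tau>0 < \<tau> \<Longrightarrow> - \<kappa> \<le> En \<tau>"
    using s N_initial by (simp_all add: M_def \<kappa>_def)
qed

lemma M_nonneg: "0 \<le> M x"
  by (simp add: M_def stationary_def)

lemma cM: "continuous_on T M"
  unfolding M_def stationary_def[abs_def]
  by (intro continuous_on_powr' continuous_intros) (use theta in auto)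

lemma cM_powr: "continuous_on T (\<lambda>x. M x powr (\<theta> + 1))"
  by (intro continuous_on_powr' cM continuous_on_const) (use M_nonneg theta in auto)

lemma M_powr: "M x powr \<theta> = max 0 (r - c * x\<^sup>2)"
  using theta by (simp add: M_def stationary_def powr_powr)

lemma potential_density_eq:
  "potential_density \<theta> \<alpha> a \<mu> \<tau> x = (\<mu> x \<tau> powr (\<theta> + 1) / (\<theta> + 1) + c * x\<^sup>2 * \<mu> x \<tau>)
     - (M x powr (\<theta> + 1) / (\<theta> + 1) + c * x\<^sup>2 * M x) - r * (\<mu> x \<tau> - M x)"
proof -
  have "M_profile \<theta> \<alpha> a x = M x"
    by (simp add: M_profile_def M_def stationary_def r_def c_def)
  then show ?thesis
    unfolding potential_density_def F_pot_def r_def[symmetric] c_def[symmetric]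
    by (simp add: algebra_simps)
qed

text \<open>Convexity of F at \<open>M\<close>, together with M^\<theta> = max 0 (r - c x^2): the
  linear term is exact where \<open>M\<close> is positive, and where \<open>M\<close> vanishes r - c
  x^2 \<le> 0 works in favour of the inequality.\<close>

lemma potential_density_nonneg:
  assumes "\<tau>0 \<le> \<tau>"
  shows "0 \<le> potential_density \<theta> \<alpha> a \<mu> \<tau> x"
proof -
  have nn: "0 \<le> \<mu> x \<tau>" "0 \<le> M x" using mu_nonneg assms M_nonneg by auto
  have "\<mu> x \<tau> * M x powr \<theta> \<le> \<mu> x \<tau> powr (\<theta> + 1) / (\<theta> + 1) + \<theta> / (\<theta> + 1) * M x powr (\<theta> + 1)"
    by (rule Young_powr) (use nn theta in auto)
  moreover have "M x powr (\<theta> + 1) / (\<theta> + 1) = M x powr (\<theta> + 1) - \<theta> / (\<theta> + 1) * M x powr (\<theta> + 1)"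
    using theta by (simp add: field_simps)
  moreover have "M x powr (\<theta> + 1) = M x * M x powr \<theta>" using nn theta by (intro powr_plus_one) auto
  moreover have "M x * M x powr \<theta> = M x * (r - c * x\<^sup>2)"
    using M_powr[of x] theta by (cases "M x = 0") (auto simp: max_def split: if_splits)
  moreover have "\<mu> x \<tau> * (r - c * x\<^sup>2) \<le> \<mu> x \<tau> * M x powr \<theta>"
    unfolding M_powr using nn by (intro mult_left_mono) auto
  ultimately show ?thesis
    unfolding potential_density_eq by (simp add: algebra_simps)
qed

lemma potential_density_support: "\<tau>0 \<le> \<tau> \<Longrightarrow> x \<notin> {-R..R} \<Longrightarrow> potential_density \<theta> \<alpha> a \<mu> \<tau> x = 0"
  using M_supp[of x] mu_supp[of \<tau> x] unfolding potential_density_eq by (auto simp: abs_le_iff not_le)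

lemma potential_density_cont: "\<tau>0 \<le> \<tau> \<Longrightarrow> continuous_on T (potential_density \<theta> \<alpha> a \<mu> \<tau>)"
  unfolding potential_density_eq[abs_def] using theta
  by (intro cont cM cM_powr slices(6) continuous_on_slice(1)[OF cmu0]) auto

lemma potential_integral:
  assumes t: "\<tau>0 \<le> \<tau>"
  shows "integrable lborel (potential_density \<theta> \<alpha> a \<mu> \<tau>)"
    and "(LINT x|lborel. potential_density \<theta> \<alpha> a \<mu> \<tau> x) = Pot \<tau> - \<kappa>"
proof -
  have eq: "(\<lambda>x. indicator {-R..R} x *\<^sub>R potential_density \<theta> \<alpha> a \<mu> \<tau> x) = potential_density \<theta> \<alpha> a \<mu> \<tau>"
    using potential_density_support[OF t] by (auto simp: fun_eq_iff indicator_def)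
  have "integrable lborel (\<lambda>x. indicator {-R..R} x *\<^sub>R potential_density \<theta> \<alpha> a \<mu> \<tau> x)"
    by (rule borel_integrable_compact) (auto intro: potential_density_cont t)
  then show "integrable lborel (potential_density \<theta> \<alpha> a \<mu> \<tau>)" unfolding eq .
  have "(LINT x:UNIV|lborel. potential_density \<theta> \<alpha> a \<mu> \<tau> x) = integral (cbox (-R) R) (potential_density \<theta> \<alpha> a \<mu> \<tau>)"
    by (rule set_lebesgue_integral_eq_integral_cbox) (use potential_density_support[OF t] potential_density_cont[OF t] in auto)
  moreover have "(potential_density \<theta> \<alpha> a \<mu> \<tau> has_integral Pot \<tau> - \<kappa> - r * (a - a)) {-R..R}"
  proof -
    have mt: "integral {-R..R} (\<lambda>x. \<mu> x \<tau>) = a" using mass_const[OF t] N_initial by (simp add: N_def)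
    have "((\<lambda>x. \<mu> x \<tau>) has_integral a) {-R..R}"
      using integrable_integral[OF integrable_continuous_real[OF continuous_on_slice(1)[OF cmu0]], of \<tau> "-R" R] t mt by simp
    moreover have "(M has_integral a) {-R..R}"
      using integrable_integral[OF integrable_continuous_real[OF cM], of "-R" R] M_mass by simp
    moreover have "((\<lambda>x. \<mu> x \<tau> powr (\<theta> + 1) / (\<theta> + 1) + c * x\<^sup>2 * \<mu> x \<tau>) has_integral Pot \<tau>) {-R..R}"
      unfolding Pot_def using t theta
      by (intro integrable_integral integrable_continuous_real cont slices(6) continuous_on_slice(1)[OF cmu0]) auto
    moreover have "((\<lambda>x. M x powr (\<theta> + 1) / (\<theta> + 1) + c * x\<^sup>2 * M x) has_integral \<kappa>) {-R..R}"
      unfolding \<kappa>_def PF_def using theta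
      by (intro integrable_integral integrable_continuous_real cont cM_powr cM) auto
    ultimately show ?thesis
      unfolding potential_density_eq[abs_def] by (intro has_integral_diff has_integral_mult_right)
  qed
  ultimately show "(LINT x|lborel. potential_density \<theta> \<alpha> a \<mu> \<tau> x) = Pot \<tau> - \<kappa>"
    by (simp add: set_lebesgue_integral_def integral_unique)
qed

lemma Pot_ge:
  assumes "\<tau>0 \<le> \<tau>"
  shows "\<kappa> \<le> Pot \<tau>"
proof -
  have "0 \<le> (LINT x|lborel. potential_density \<theta> \<alpha> a \<mu> \<tau> x)"
    by (rule integral_nonneg_AE) (use potential_density_nonneg[OF assms] in auto)
  then show ?thesis unfolding potential_integral(2)[OF assms] by simp
qed

definition "kin \<tau> x = \<mu> x \<tau> * (fst (grad_upto \<tau>0 w (x, \<tau>)))\<^sup>2"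

lemma kin_eq: "\<tau>0 < \<tau> \<Longrightarrow> kin \<tau> = (\<lambda>x. \<mu> x \<tau> * (p x \<tau>)\<^sup>2)"
  by (simp add: kin_def fun_eq_iff grad_w Dw_def)

lemma kin_integral:
  assumes t: "\<tau>0 < \<tau>"
  shows "integrable lborel (kin \<tau>)" and "(LINT x|lborel. kin \<tau> x) = D \<tau>"
proof -
  have c: "continuous_on T (kin \<tau>)" for T
    unfolding kin_eq[OF t] by (intro cont slices) (use t in auto)
  have z: "kin \<tau> x = 0" if "x \<notin> {-R..R}" for x
    using mu_supp[of \<tau> x] t that by (auto simp: kin_def abs_le_iff not_le)
  have eq: "(\<lambda>x. indicator {-R..R} x *\<^sub>R kin \<tau> x) = kin \<tau>"
    using z by (auto simp: fun_eq_iff indicator_def)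
  have "integrable lborel (\<lambda>x. indicator {-R..R} x *\<^sub>R kin \<tau> x)"
    by (rule borel_integrable_compact) (auto intro: c)
  then show "integrable lborel (kin \<tau>)" unfolding eq .
  have "(LINT x:UNIV|lborel. kin \<tau> x) = integral (cbox (-R) R) (kin \<tau>)"
    by (rule set_lebesgue_integral_eq_integral_cbox[OF c]) (use z in auto)
  then show "(LINT x|lborel. kin \<tau> x) = D \<tau>"
    by (simp add: set_lebesgue_integral_def D_def kin_eq[OF t])
qed

definition "sq n = \<tau>0 + 1 / real (Suc n)"

lemma sq: "\<tau>0 < sq n" "sq \<longlonglongrightarrow> \<tau>0"
proof -
  show "\<tau>0 < sq n" by (simp add: sq_def)
  have "sq \<longlonglongrightarrow> \<tau>0 + 0"
    unfolding sq_def[abs_def] using LIMSEQ_inverse_real_of_nat by (intro tendsto_intros) (simp add: inverse_eq_divide)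
  then show "sq \<longlonglongrightarrow> \<tau>0" by simp
qed

lemma kin_le: "\<tau>0 < \<tau> \<Longrightarrow> kin \<tau> x \<le> Mb * W\<^sup>2 * indicator {-R..R} x"
  and kin_nonneg: "\<tau>0 \<le> \<tau> \<Longrightarrow> 0 \<le> kin \<tau> x"
proof -
  show "0 \<le> kin \<tau> x" if "\<tau>0 \<le> \<tau>" using mu_nonneg[OF that, of x] by (simp add: kin_def)
  assume t: "\<tau>0 < \<tau>"
  show "kin \<tau> x \<le> Mb * W\<^sup>2 * indicator {-R..R} x"
  proof (cases "0 < \<mu> x \<tau>")
    case True
    then have "x \<in> {-R..R}" using mu_supp[of \<tau> x] t by (force simp: abs_le_iff)
    moreover have "(p x \<tau>)\<^sup>2 \<le> W\<^sup>2"
      using p_bd[OF t True] by (metis abs_le_square_iff abs_of_nonneg W_nonneg)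
    then have "\<mu> x \<tau> * (p x \<tau>)\<^sup>2 \<le> Mb * W\<^sup>2"
      using mu_bd[of \<tau> x] True t by (intro mult_mono) auto
    ultimately show ?thesis by (simp add: kin_eq[OF t])
  next
    case False
    then have "\<mu> x \<tau> = 0" using mu_nonneg[of \<tau> x] t by simp
    moreover have "0 \<le> Mb" using mu_nonneg[of \<tau> x] mu_bd[of \<tau> x] t by simp
    ultimately show ?thesis by (simp add: kin_def)
  qed
qed

text \<open>Where the initial density is positive the gradients converge to the value prescribed at
  the initial time. Where it is zero nothing is known about that gradient, but the kinetic density
  is at most \<mu> W^2, which tends to 0.\<close>

lemma kin_limit: "(\<lambda>n. kin (sq n) x) \<longlonglongrightarrow> kin \<tau>0 x"
proof (cases "0 < \<mu> x \<tau>0")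
  case True
  have yS: "(x, \<tau>0) \<in> S" using True by (simp add: S_def)
  have mu: "(\<lambda>n. \<mu> x (sq n)) \<longlonglongrightarrow> \<mu> x \<tau>0"
    by (rule continuous_on_tendsto_compose[OF continuous_on_slice(2)[OF cmu0 order_refl] sq(2)])
      (use sq(1) in \<open>auto intro!: always_eventually less_imp_le\<close>)
  have "filterlim (\<lambda>n. (x, sq n)) (at (x, \<tau>0) within UNIV \<times> {\<tau>0<..}) sequentially"
    unfolding filterlim_at
  proof
    show "(\<lambda>n. (x, sq n)) \<longlonglongrightarrow> (x, \<tau>0)" by (intro tendsto_Pair tendsto_const sq)
    show "\<forall>\<^sub>F n in sequentially. (x, sq n) \<in> UNIV \<times> {\<tau>0<..} \<and> (x, sq n) \<noteq> (x, \<tau>0)"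
    proof (intro always_eventually allI)
      show "(x, sq n) \<in> UNIV \<times> {\<tau>0<..} \<and> (x, sq n) \<noteq> (x, \<tau>0)" for n
        using sq(1)[of n] by auto
    qed
  qed
  from filterlim_compose[OF Dv_limit[OF True] this]
  have "(\<lambda>n. Dv (x, sq n) + (\<alpha> * x, 0)) \<longlonglongrightarrow> grad_upto \<tau>0 v (x, \<tau>0) + (\<alpha> * x, 0)"
    by (intro tendsto_add tendsto_const)
  moreover have "Dv (x, sq n) + (\<alpha> * x, 0) = Dw (x, sq n)" for n by (simp add: Dv_def Dw_def)
  ultimately have "(\<lambda>n. Dw (x, sq n)) \<longlonglongrightarrow> grad_upto \<tau>0 w (x, \<tau>0)"
    using grad_w_S[OF yS] by simp
  from tendsto_mult[OF mu tendsto_power[OF tendsto_fst[OF this], of 2]]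
  show ?thesis by (simp add: kin_def grad_w sq(1))
next
  case False
  then have z: "\<mu> x \<tau>0 = 0" using mu_nonneg[of \<tau>0 x] by simp
  have mu: "(\<lambda>n. \<mu> x (sq n) * W\<^sup>2) \<longlonglongrightarrow> \<mu> x \<tau>0 * W\<^sup>2"
    by (intro tendsto_mult tendsto_const continuous_on_tendsto_compose[OF continuous_on_slice(2)[OF cmu0 order_refl] sq(2)])
      (use sq(1) in \<open>auto intro!: always_eventually less_imp_le\<close>)
  have b: "\<bar>kin (sq n) x\<bar> \<le> \<mu> x (sq n) * W\<^sup>2" for n
  proof (cases "0 < \<mu> x (sq n)")
    case True
    have "(p x (sq n))\<^sup>2 \<le> W\<^sup>2"
      using p_bd[OF sq(1) True] by (metis abs_le_square_iff abs_of_nonneg W_nonneg)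
    then show ?thesis using True by (simp add: kin_eq[OF sq(1)] mult_left_mono)
  next
    case False
    then have "\<mu> x (sq n) = 0" using mu_nonneg[of "sq n" x] sq(1)[of n] by simp
    then show ?thesis by (simp add: kin_def)
  qed
  have "(\<lambda>n. kin (sq n) x) \<longlonglongrightarrow> 0"
    by (rule Lim_null_comparison[where g = "\<lambda>n. \<mu> x (sq n) * W\<^sup>2"]) (use b mu z in auto)
  then show ?thesis using z by (simp add: kin_def)
qed

text \<open>The dynamics is known only after \<tau>0. Dominated convergence along times decreasing
  to \<tau>0 brings in the energy at \<tau>0, whose integrability has to be obtained on the
  way.\<close>

lemma energy_eq: "\<tau>0 < \<tau> \<Longrightarrow> E \<tau> = En \<tau> + \<kappa>"
  and energy_limit: "(\<lambda>n. E (sq n)) \<longlonglongrightarrow> E \<tau>0"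
proof -
  have En: "E \<tau> = (LINT x|lborel. kin \<tau> x) / 2 - (Pot \<tau> - \<kappa>)"
    if "\<tau>0 \<le> \<tau>" "integrable lborel (kin \<tau>)" for \<tau>
  proof -
    have "E \<tau> = (LINT x|lborel. 1 / 2 * kin \<tau> x - potential_density \<theta> \<alpha> a \<mu> \<tau> x)"
      by (simp add: E_def energy_def kin_def mult_ac)
    also have "\<dots> = (LINT x|lborel. 1 / 2 * kin \<tau> x) - (LINT x|lborel. potential_density \<theta> \<alpha> a \<mu> \<tau> x)"
      by (intro Bochner_Integration.integral_diff integrable_mult_right that potential_integral(1))
    finally show ?thesis using potential_integral(2)[OF that(1)] by simp
  qed
  show Eq: "E \<tau> = En \<tau> + \<kappa>" if "\<tau>0 < \<tau>" for \<tau>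
    using En[OF less_imp_le[OF that] kin_integral(1)[OF that]] kin_integral(2)[OF that] by (simp add: En_def)
  have meas: "kin (sq n) \<in> borel_measurable lborel" for n
    using kin_integral(1)[OF sq(1)] by (rule borel_measurable_integrable)
  have m0: "kin \<tau>0 \<in> borel_measurable lborel"
    by (rule borel_measurable_LIMSEQ_real[OF kin_limit meas])
  have wi: "integrable lborel (\<lambda>x. Mb * W\<^sup>2 * indicator {-R..R} x)"
    by (intro integrable_mult_right integrable_real_indicator emeasure_lborel_cbox_finite[of "-R" R, unfolded box_real]) simp
  have bound: "norm (kin (sq n) x) \<le> Mb * W\<^sup>2 * indicator {-R..R} x" for n x
    using kin_le[OF sq(1), of n x] kin_nonneg[of "sq n" x] sq(1)[of n] by simp
  have i0: "integrable lborel (kin \<tau>0)"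
    by (rule integrable_dominated_convergence[where s = "\<lambda>n. kin (sq n)", OF m0 meas wi]) (use kin_limit bound in auto)
  have "(\<lambda>n. LINT x|lborel. kin (sq n) x) \<longlonglongrightarrow> (LINT x|lborel. kin \<tau>0 x)"
    by (rule integral_dominated_convergence[where s = "\<lambda>n. kin (sq n)", OF m0 meas wi]) (use kin_limit bound in auto)
  moreover have "(\<lambda>n. Pot (sq n)) \<longlonglongrightarrow> Pot \<tau>0"
    by (rule continuous_on_tendsto_compose[OF cPot sq(2)]) (use sq(1) in \<open>auto intro!: always_eventually less_imp_le\<close>)
  ultimately have "(\<lambda>n. (LINT x|lborel. kin (sq n) x) / 2 - (Pot (sq n) - \<kappa>)) \<longlonglongrightarrow> (LINT x|lborel. kin \<tau>0 x) / 2 - (Pot \<tau>0 - \<kappa>)"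
    by (intro tendsto_intros) auto
  then show "(\<lambda>n. E (sq n)) \<longlonglongrightarrow> E \<tau>0"
    using En[OF order_refl i0] En[OF less_imp_le[OF sq(1)] kin_integral(1)[OF sq(1)]] by simp
qed

lemma E_nonneg: "\<tau>0 \<le> \<tau> \<Longrightarrow> 0 \<le> E \<tau>"
proof -
  have 1: "0 \<le> E \<tau>" if "\<tau>0 < \<tau>" for \<tau> using En_lower[OF that] energy_eq[OF that] by simp
  assume "\<tau>0 \<le> \<tau>"
  then show ?thesis
    using 1 LIMSEQ_le_const[OF energy_limit, of 0] sq(1) by (cases "\<tau> = \<tau>0") auto
qed

text \<open>The energy is at most half the kinetic integral. This bound replaces the initial energy
  in the constant of the pointwise rates.\<close>

lemma E_initial_le: "E \<tau>0 \<le> R * Mb * W\<^sup>2"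
proof -
  have "E (sq n) \<le> R * Mb * W\<^sup>2" for n
    using energy_eq[OF sq(1), of n] D_le[OF sq(1), of n] Pot_ge[of "sq n"] sq(1)[of n] by (simp add: En_def)
  then show ?thesis using LIMSEQ_le_const2[OF energy_limit] by blast
qed

text \<open>The derivative of exp (2 k x) (En x + \<kappa>) is - 2 k exp (2 k x) (Pot x - \<kappa>),
  and \<kappa> is the least value of the potential along the flow's mass class.\<close>

lemma E_decay_interior:
  assumes s: "\<tau>0 < s" "s \<le> \<tau>"
  shows "E \<tau> \<le> exp (- 2 * k * (\<tau> - s)) * E s"
proof -
  have "exp (2 * k * \<tau>) * (En \<tau> + \<kappa>) \<le> exp (2 * k * s) * (En s + \<kappa>)"
  proof (rule DERIV_nonpos_imp_nonincreasing[OF s(2)])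
    fix x assume x: "s \<le> x" "x \<le> \<tau>"
    then have x0: "\<tau>0 < x" using s by simp
    have "((\<lambda>x. exp (2 * k * x)) has_real_derivative 2 * k * exp (2 * k * x)) (at x)"
      by (auto intro!: derivative_eq_intros)
    from DERIV_mult[OF this DERIV_add[OF En_deriv[OF x0] DERIV_const[of \<kappa>]]]
    have "((\<lambda>x. exp (2 * k * x) * (En x + \<kappa>)) has_real_derivative
      2 * k * exp (2 * k * x) * (En x + \<kappa>) + (- k * D x + 0) * exp (2 * k * x)) (at x)" .
    moreover have "2 * k * exp (2 * k * x) * (En x + \<kappa>) + (- k * D x + 0) * exp (2 * k * x)
      = - (2 * k * exp (2 * k * x) * (Pot x - \<kappa>))"
      by (simp add: En_def algebra_simps)
    moreover have "0 \<le> 2 * k * exp (2 * k * x) * (Pot x - \<kappa>)"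
      using Pot_ge[of x] x0 params by simp
    ultimately show "\<exists>y. ((\<lambda>x. exp (2 * k * x) * (En x + \<kappa>)) has_real_derivative y) (at x) \<and> y \<le> 0"
      by (intro exI[of _ "- (2 * k * exp (2 * k * x) * (Pot x - \<kappa>))"]) (simp only: neg_le_0_iff_le)
  qed
  then have "exp (- (2 * k * \<tau>)) * (exp (2 * k * \<tau>) * E \<tau>) \<le> exp (- (2 * k * \<tau>)) * (exp (2 * k * s) * E s)"
    using energy_eq s by (intro mult_left_mono) auto
  moreover have "exp (- (2 * k * \<tau>)) * exp (2 * k * \<tau>) = 1"
    "exp (- (2 * k * \<tau>)) * exp (2 * k * s) = exp (- 2 * k * (\<tau> - s))"
    by (simp_all only: exp_add[symmetric]) (simp_all add: algebra_simps)
  ultimately show ?thesis by (simp only: mult.assoc[symmetric] mult_1_left)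
qed

text \<open>The starting time of the interior estimate is sent to \<tau>0. The factor is normalised
  to be 1 there, so that equality holds at \<tau> = \<tau>0.\<close>

lemma E_decay:
  assumes "\<tau>0 \<le> \<tau>"
  shows "E \<tau> \<le> exp (- 2 * k * (\<tau> - \<tau>0)) * E \<tau>0"
proof (cases "\<tau> = \<tau>0")
  case False
  have lim: "(\<lambda>n. exp (- 2 * k * (\<tau> - sq n)) * E (sq n)) \<longlonglongrightarrow> exp (- 2 * k * (\<tau> - \<tau>0)) * E \<tau>0"
    by (intro tendsto_intros energy_limit sq)
  have "\<forall>\<^sub>F n in sequentially. sq n < \<tau>"
    using order_tendstoD(2)[OF sq(2), of \<tau>] assms False by simp
  then have "\<forall>\<^sub>F n in sequentially. E \<tau> \<le> exp (- 2 * k * (\<tau> - sq n)) * E (sq n)"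
    by (rule eventually_mono) (use E_decay_interior[OF sq(1)] in simp)
  then show ?thesis by (rule tendsto_lowerbound[OF lim]) simp
qed simp

text \<open>Twice the energy plus twice the potential part is the kinetic integral, so both
  quantities inherit the rate found for the potential part in \<open>potential_rate\<close>.\<close>

lemma decay_rates:
  assumes rho: "0 < \<rho>" "\<tau>0 + \<rho> < \<tau>"
    and H1: "H1_norm_le (UNIV \<times> {\<tau> - \<rho><..<\<tau> + \<rho>}) (\<lambda>(\<eta>, \<tau>). \<mu> \<eta> \<tau> powr \<theta>) K"
    and Bb: "\<And>x. smooth_bump x \<le> Bb"
  defines "e \<equiv> R * Mb * W\<^sup>2"
  defines "b \<equiv> K\<^sup>2 + 4 * c\<^sup>2 * R ^ 3 * \<rho> + Mb * e / (2 * k) + Bb * e / (k * \<rho>)"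
  shows "(LINT \<eta>|lborel. \<mu> \<eta> \<tau> * (fst (grad_upto \<tau>0 w (\<eta>, \<tau>)))\<^sup>2) \<le> (2 * e + 2 * b) * exp (- k * (\<tau> - \<tau>0))"
    and "(LINT \<eta>|lborel. potential_density \<theta> \<alpha> a \<mu> \<tau> \<eta>) \<le> (2 * e + 2 * b) * exp (- k * (\<tau> - \<tau>0))"
proof -
  \<comment> \<open>The square of \<open>X\<close> is the decay factor of the energy, as the
    hypothesis of \<open>potential_rate\<close> demands.\<close>
  define X where "X = exp (- k * (\<tau> - \<tau>0))"
  have t: "\<tau>0 < \<tau>" using rho by simp
  have X: "0 < X" "X \<le> 1" "X\<^sup>2 = exp (- 2 * k * (\<tau> - \<tau>0))"
  proof -
    have "0 \<le> k * (\<tau> - \<tau>0)" using t params(4) by simp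
    then show "X \<le> 1" by (simp add: X_def)
    show "X\<^sup>2 = exp (- 2 * k * (\<tau> - \<tau>0))"
      by (simp add: X_def power2_eq_square exp_add[symmetric] algebra_simps)
  qed (simp add: X_def)
  have Mb0: "0 \<le> Mb" using mu_nonneg[of \<tau>0 0] mu_bd[of \<tau>0 0] by simp
  have e: "0 \<le> e" "E \<tau>0 \<le> e" using Mb0 R_pos E_initial_le by (auto simp: e_def)
  have Et: "E \<tau> \<le> X\<^sup>2 * e"
    using E_decay[of \<tau>] t mult_left_mono[OF e(2) zero_le_power2[of X]] unfolding X(3) by linarith
  have B0: "0 \<le> Bb" using Bb[of 0] smooth_bump_nonneg[of 0] by simp
  have b0: "0 \<le> b"
    unfolding b_def using e Mb0 B0 params R_pos rho
    by (intro add_nonneg_nonneg mult_nonneg_nonneg divide_nonneg_nonneg) auto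
  have P: "Pot \<tau> - \<kappa> \<le> X * b"
    unfolding b_def
  proof (rule potential_rate[OF rho H1 _ _ X(1) _ X(2) e(1) Bb])
    show "\<kappa> \<le> Pot t" if "\<tau>0 < t" for t using that by (intro Pot_ge) simp
    show "0 \<le> En t + \<kappa>" if "\<tau>0 < t" for t using En_lower[OF that] by simp
    show "En \<tau> + \<kappa> \<le> X\<^sup>2 * e" using Et energy_eq[OF t] by simp
  qed
  have X2: "X\<^sup>2 * e \<le> X * e" using X(1,2) e(1) by (intro mult_right_mono) (auto simp: power2_eq_square)
  have Xe: "0 \<le> X * e" "0 \<le> X * b" using X e b0 by auto
  have "D \<tau> = 2 * E \<tau> + 2 * (Pot \<tau> - \<kappa>)" using energy_eq[OF t] by (simp add: En_def)
  also have "\<dots> \<le> 2 * (X * e) + 2 * (X * b)"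
    by (intro add_mono mult_left_mono P order_trans[OF Et X2]) auto
  finally have "D \<tau> \<le> 2 * (X * e) + 2 * (X * b)" .
  then show "(LINT \<eta>|lborel. \<mu> \<eta> \<tau> * (fst (grad_upto \<tau>0 w (\<eta>, \<tau>)))\<^sup>2) \<le> (2 * e + 2 * b) * exp (- k * (\<tau> - \<tau>0))"
    using kin_integral(2)[OF t] by (simp add: kin_def[abs_def] X_def algebra_simps)
  have "Pot \<tau> - \<kappa> \<le> 2 * (X * e) + 2 * (X * b)" using P Xe by linarith
  then show "(LINT \<eta>|lborel. potential_density \<theta> \<alpha> a \<mu> \<tau> \<eta>) \<le> (2 * e + 2 * b) * exp (- k * (\<tau> - \<tau>0))"
    using potential_integral(2)[of \<tau>] t by (simp add: X_def algebra_simps)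
qed

end

theorem proposition3p10:
  fixes \<theta> \<alpha> k :: real
  assumes "0 < \<theta>" and "\<theta> < 2" and "\<alpha> = 2 / (2 + \<theta>)" and "k = (2 - \<theta>) / (2 + \<theta>)"
  shows "k = 2 * \<alpha> - 1 \<and>
    (\<exists>C :: real \<Rightarrow> real \<Rightarrow> real \<Rightarrow> real \<Rightarrow> real \<Rightarrow> real \<Rightarrow> real.
      \<forall>(t0::real) (\<tau>0::real) (u :: real \<Rightarrow> real \<Rightarrow> real) (m :: real \<Rightarrow> real \<Rightarrow> real)
        (\<gamma>L :: real \<Rightarrow> real) (\<gamma>R :: real \<Rightarrow> real) (a::real)
        (v :: real \<Rightarrow> real \<Rightarrow> real) (\<mu> :: real \<Rightarrow> real \<Rightarrow> real) (w :: real \<Rightarrow> real \<Rightarrow> real)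
        (\<rho>::real) (K::real) (R::real).
      t0 > 0 \<and> \<tau>0 = ln t0 \<and>
      Ck_on 1 (\<lambda>(x, t). u x t) (UNIV \<times> {t0<..}) \<and>
      continuous_on (UNIV \<times> {t0..}) (\<lambda>(x, t). m x t) \<and>
      (\<forall>x. \<forall>t\<ge>t0. m x t \<ge> 0) \<and>
      HJ_classical \<theta> t0 u m \<and>
      continuity_distributional t0 u m \<and>
      W1inf_loc {t0<..} \<gamma>L \<and> W1inf_loc {t0<..} \<gamma>R \<and>
      (\<forall>t>t0. {x. m x t > 0} = {\<gamma>L t<..<\<gamma>R t}) \<and>
      a = (LINT x|lborel. m x t0) \<and> a > 0 \<and>
      v = rescaled_value \<alpha> u \<and> \<mu> = rescaled_density \<alpha> m \<and>
      w = (\<lambda>\<eta> \<tau>. v \<eta> \<tau> + \<alpha> / 2 * \<eta>\<^sup>2) \<and>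
      bounded ((\<lambda>(\<eta>, \<tau>). \<mu> \<eta> \<tau>) ` (UNIV \<times> {\<tau>0<..})) \<and>
      uniformly_continuous_on (UNIV \<times> {\<tau>0<..}) (\<lambda>(\<eta>, \<tau>). \<mu> \<eta> \<tau>) \<and>
      \<rho> > 0 \<and> K > 0 \<and>
      (\<forall>\<tau>1>\<tau>0 + \<rho>. H1_norm_le (UNIV \<times> {\<tau>1 - \<rho><..<\<tau>1 + \<rho>}) (\<lambda>(\<eta>, \<tau>). \<mu> \<eta> \<tau> powr \<theta>) K) \<and>
      R \<ge> R_mass \<theta> \<alpha> a \<and>
      closure {(\<eta>, \<tau>). \<tau> \<ge> \<tau>0 \<and> \<mu> \<eta> \<tau> \<noteq> 0} \<subseteq> {- R..R} \<times> {\<tau>0..} \<and>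
      Ck_on 1 (grad_upto \<tau>0 v) {(\<eta>, \<tau>). \<tau> \<ge> \<tau>0 \<and> \<mu> \<eta> \<tau> > 0} \<and>
      Linf_on ({- R<..<R} \<times> {\<tau>0<..}) (grad_upto \<tau>0 v)
      \<longrightarrow>
      (\<forall>\<tau>\<ge>\<tau>0. 0 \<le> energy \<theta> \<alpha> a \<tau>0 w \<mu> \<tau> \<and>
        energy \<theta> \<alpha> a \<tau>0 w \<mu> \<tau> \<le> exp (- 2 * k * (\<tau> - \<tau>0)) * energy \<theta> \<alpha> a \<tau>0 w \<mu> \<tau>0) \<and>
      (let C0 = C K R
          (real_of_ereal (Linf_norm (UNIV \<times> {\<tau>0<..}) (\<lambda>(\<eta>, \<tau>). \<mu> \<eta> \<tau>)))
          (real_of_ereal (Linf_norm {(\<eta>, \<tau>). \<tau> \<ge> \<tau>0 \<and> \<mu> \<eta> \<tau> > 0} (grad_upto \<tau>0 w)))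
          \<rho> (1 / \<rho>)
       in \<forall>\<tau>>\<tau>0 + \<rho>.
         (LINT \<eta>|lborel. \<mu> \<eta> \<tau> * (fst (grad_upto \<tau>0 w (\<eta>, \<tau>)))\<^sup>2) \<le> C0 * exp (- k * (\<tau> - \<tau>0)) \<and>
         (LINT \<eta>|lborel. potential_density \<theta> \<alpha> a \<mu> \<tau> \<eta>) \<le> C0 * exp (- k * (\<tau> - \<tau>0))))"
  (is "_ \<and> ?ex")
proof
  show "k = 2 * \<alpha> - 1" unfolding assms(3,4) using assms(1) by (simp add: field_simps)
  \<comment> \<open>A bound for the fixed bump profile: an absolute constant that may enter
    \<open>C\<close>.\<close>
  obtain Bb where Bb: "\<And>x. smooth_bump x \<le> Bb" using smooth_bump_bounded by blast
  \<comment> \<open>\<open>C\<close> has to be fixed before any solution is given, so the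
    coefficient of the quadratic potential is written in terms of \<alpha> and matched with the
    locale constant afterwards.\<close>
  define c0 where "c0 = \<alpha> * (1 - \<alpha>) / 2"
  define C where "C K R M W \<rho> \<rho>' = 2 * (R * M * W\<^sup>2) + 2 * (K\<^sup>2 + 4 * c0\<^sup>2 * R ^ 3 * \<rho> + M * (R * M * W\<^sup>2) / (2 * k) + Bb * (R * M * W\<^sup>2) / (k * \<rho>))"
    for K R M W \<rho> \<rho>' :: real
  show ?ex
  proof (intro exI[of _ C] allI impI, elim conjE)
    fix t0 \<tau>0 :: real and u m :: "real \<Rightarrow> real \<Rightarrow> real" and \<gamma>L \<gamma>R :: "real \<Rightarrow> real" and a :: real
      and v \<mu> w :: "real \<Rightarrow> real \<Rightarrow> real" and \<rho> K R :: real
    assume h: "0 < t0" "\<tau>0 = ln t0" "Ck_on 1 (\<lambda>(x, t). u x t) (UNIV \<times> {t0<..})"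
      "continuous_on (UNIV \<times> {t0..}) (\<lambda>(x, t). m x t)" "\<forall>x. \<forall>t\<ge>t0. 0 \<le> m x t"
      "HJ_classical \<theta> t0 u m" "continuity_distributional t0 u m"
      "a = (LINT x|lborel. m x t0)" "0 < a"
      and vmw: "v = rescaled_value \<alpha> u" "\<mu> = rescaled_density \<alpha> m" "w = (\<lambda>\<eta> \<tau>. v \<eta> \<tau> + \<alpha> / 2 * \<eta>\<^sup>2)"
      and h': "bounded ((\<lambda>(\<eta>, \<tau>). \<mu> \<eta> \<tau>) ` (UNIV \<times> {\<tau>0<..}))"
      "uniformly_continuous_on (UNIV \<times> {\<tau>0<..}) (\<lambda>(\<eta>, \<tau>). \<mu> \<eta> \<tau>)"
      and rho: "0 < \<rho>" "0 < K"
      and H1: "\<forall>\<tau>1>\<tau>0 + \<rho>. H1_norm_le (UNIV \<times> {\<tau>1 - \<rho><..<\<tau>1 + \<rho>}) (\<lambda>(\<eta>, \<tau>). \<mu> \<eta> \<tau> powr \<theta>) K"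
      and h'': "closure {(\<eta>, \<tau>). \<tau>0 \<le> \<tau> \<and> \<mu> \<eta> \<tau> \<noteq> 0} \<subseteq> {- R..R} \<times> {\<tau>0..}"
      "Ck_on 1 (grad_upto \<tau>0 v) {(\<eta>, \<tau>). \<tau>0 \<le> \<tau> \<and> 0 < \<mu> \<eta> \<tau>}"
      "Linf_on ({- R<..<R} \<times> {\<tau>0<..}) (grad_upto \<tau>0 v)"
    interpret mfg_solution \<theta> \<alpha> k t0 \<tau>0 a R u m
      by unfold_locales (use assms h h' h'' in \<open>simp_all add: vmw(1,2)\<close>)
    have mu: "\<mu> = mfg_solution.\<mu> \<alpha> m" by (simp add: vmw \<mu>_def)
    have w: "w = mfg_solution.w \<alpha> u" by (simp add: vmw fun_eq_iff w_def v_def)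
    have cc: "mfg_solution.c \<alpha> = c0" by (simp add: c0_def c_def)
    show "(\<forall>\<tau>\<ge>\<tau>0. 0 \<le> energy \<theta> \<alpha> a \<tau>0 w \<mu> \<tau> \<and>
        energy \<theta> \<alpha> a \<tau>0 w \<mu> \<tau> \<le> exp (- 2 * k * (\<tau> - \<tau>0)) * energy \<theta> \<alpha> a \<tau>0 w \<mu> \<tau>0) \<and>
      (let C0 = C K R
          (real_of_ereal (Linf_norm (UNIV \<times> {\<tau>0<..}) (\<lambda>(\<eta>, \<tau>). \<mu> \<eta> \<tau>)))
          (real_of_ereal (Linf_norm {(\<eta>, \<tau>). \<tau> \<ge> \<tau>0 \<and> \<mu> \<eta> \<tau> > 0} (grad_upto \<tau>0 w)))
          \<rho> (1 / \<rho>)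
       in \<forall>\<tau>>\<tau>0 + \<rho>.
         (LINT \<eta>|lborel. \<mu> \<eta> \<tau> * (fst (grad_upto \<tau>0 w (\<eta>, \<tau>)))\<^sup>2) \<le> C0 * exp (- k * (\<tau> - \<tau>0)) \<and>
         (LINT \<eta>|lborel. potential_density \<theta> \<alpha> a \<mu> \<tau> \<eta>) \<le> C0 * exp (- k * (\<tau> - \<tau>0)))"
      unfolding mu w Let_def Mb_def[symmetric] S_def[symmetric] W_def[symmetric] E_def[symmetric] C_def cc[symmetric]
      using E_nonneg E_decay decay_rates[OF rho(1) _ _ Bb] H1 mu by blast
  qed
qed

end
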